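(* Let $\boldsymbol\tau=\{\tau_Q : Q\in\mathcal Q\}$ be non-negative constants indexed by the dyadic cubes of $\mathbb R^d$, let $\omega,\sigma$ be weights on $\mathbb R^d$, and let $1<p\le q<\infty$. Then $$ \bigl\|T_{\boldsymbol\tau}(\sigma\,\cdot)\bigr\|_{L^p(\sigma)\to L^{q}(\omega)} \simeq [\![\sigma,\omega]\!]^{\mathrm{Loc}}_{\boldsymbol\tau,p,q}+[\![\omega,\sigma]\!]^{\mathrm{Loc}}_{\boldsymbol\tau,q',p'}\qquad (1<p\le q<\infty), $$ $$ \bigl\|T_{\boldsymbol\tau}(\sigma\,\cdot)\bigr\|_{L^p(\sigma)\to L^{q}(\omega)} \simeq [\![\sigma,\omega]\!]^{\mathrm{Glo}}_{\boldsymbol\tau,p,q}+[\![\omega,\sigma]\!]^{\mathrm{Glo}}_{\boldsymbol\tau,q',p'}\qquad (1<p<q<\infty). $$ In particular, the case $p=q=2$ of the first equivalence is the statement that $C_3\simeq C_1+C_2$, where $$C_1^2:=\sup_{R\in\mathcal Q}\sigma(R)^{-1}\int\Bigl[\sum_{Q\in\mathcal Q,\,Q\subset R}\tau_Q\mathbf 1_Q\,\mathbb E_Q\sigma\Bigr]^2\omega\,dx,\qquad C_2^2:=\sup_{R\in\mathcal Q}\omega(R)^{-1}\int\Bigl[\sum_{Q\in\mathcal Q,\,Q\subset R}\tau_Q\mathbf 1_Q\,\mathbb E_Q\omega\Bigr]^2\sigma\,dx,$$ $$C_3:=\sup_{\|f\|_{L^2(\sigma)}=1}\ \sup_{\|g\|_{L^2(\omega)}=1}\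 \sum_{Q\in\mathcal Q}\tau_Q\,\mathbb E_Q(f\sigma)\cdot\mathbb E_Q(g\omega)\cdot|Q| ,$$ the suprema in $C_3$ being over non-negative $f,g$.
   Context: $\mathcal Q$ is a fixed choice of dyadic cubes in $\mathbb R^d$. A weight is a non-negative locally integrable function $\omega:\mathbb R^d\to[0,\infty)$; for a cube $Q$, $\omega(Q)=\int_Q\omega\,dx$, and $L^p(\omega)$ is the $L^p$ space of the measure $\omega\,dx$. For a cube $Q$, $\mathbb E_Q f := |Q|^{-1}\int_Q f\,dx$. For $R\in\mathcal Q$ set $$T_{\boldsymbol\tau}f:=\sum_{Q\in\mathcal Q}\tau_Q\,\mathbb E_Qf\,\mathbf 1_Q,\quad T^{\mathrm{in}}_{\boldsymbol\tau,R}f:=\sum_{Q\in\mathcal Q,\ Q\subset R}\tau_Q\,\mathbb E_Qf\,\mathbf 1_Q,\quad T^{\mathrm{out}}_{\boldsymbol\tau,R}f:=\sum_{Q\in\mathcal Q,\ Q\supset R}\tau_Q\,\mathbb E_Qf\,\mathbf 1_Q$$ (the cube $Q=R$ is included in both localized sums). For $1<r<\infty$, $r'=r/(r-1)$. For weights $\sigma,\omega$ and $1<p\le q<\infty$ define $$[\![\sigma,\omega]\!]^{\mathrm{Loc}}_{\boldsymbol\tau,p,q} := \sup_{R\in\mathcal Q}\omega(R)^{-1/q'}\bigl\| T^{\mathrm{in}}_{\boldsymbol\tau,R}(\omega\mathbf 1_R)\bigr\|_{L^{p'}(\sigma)},\qquad [\![\sigma,\omega]\!]^{\mathrm{Glo}}_{\boldsymbol\tau,p,q}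 := \sup_{R\in\mathcal Q}\omega(R)^{-1/q'}\bigl\| T^{\mathrm{out}}_{\boldsymbol\tau,R}(\omega\mathbf 1_R)\bigr\|_{L^{p'}(\sigma)} .$$ Thus, exchanging the roles of the weights and replacing $(p,q)$ by $(q',p')$, $$[\![\omega,\sigma]\!]^{\mathrm{Loc}}_{\boldsymbol\tau,q',p'}=\sup_{R\in\mathcal Q}\sigma(R)^{-1/p}\bigl\| T^{\mathrm{in}}_{\boldsymbol\tau,R}(\sigma\mathbf 1_R)\bigr\|_{L^{q}(\omega)},\qquad [\![\omega,\sigma]\!]^{\mathrm{Glo}}_{\boldsymbol\tau,q',p'}=\sup_{R\in\mathcal Q}\sigma(R)^{-1/p}\bigl\| T^{\mathrm{out}}_{\boldsymbol\tau,R}(\sigma\mathbf 1_R)\bigr\|_{L^{q}(\omega)}.$$ Cubes $R$ of zero weight contribute $0$ to the suprema. The quantity $\|T_{\boldsymbol\tau}(\sigma\,\cdot)\|_{L^p(\sigma)\to L^{q}(\omega)}$ is the least $N\in[0,\infty]$ such that $\|T_{\boldsymbol\tau}(f\sigma)\|_{L^q(\omega)}\le N\|f\|_{L^p(\sigma)}$ for all non-negative measurable $f$ (since $T_{\boldsymbol\tau}$ is a positive operator this is the same as considering all $f\in L^p(\sigma)$). $A\simeq B$ means $A\le KB$ and $B\le KA$ with a constant $K$ depending only on the dimension $d$ and on $p,q$ (not on $\boldsymbol\tau,\sigma,\omega$). *)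

theory Defs
  imports "HOL-Analysis.Analysis" "HOL-Library.Disjoint_Sets"
begin

definition hcube :: "real ^ 'd \<Rightarrow> real \<Rightarrow> (real ^ 'd) set" where
  "hcube a l = {x. \<forall>i. a $ i \<le> x $ i \<and> x $ i < a $ i + l}"

text \<open>
  A choice of dyadic cubes: half-open cubes with side lengths \<open>2^k\<close>, the cubes of each
  generation \<open>k\<close> tiling the space, any two cubes being nested or disjoint.
  The standard dyadic grid is an instance (proved below).
\<close>

definition dyadic_grid :: "(real ^ 'd) set set \<Rightarrow> bool" where
  "dyadic_grid \<Q> \<longleftrightarrow>
     (\<forall>Q\<in>\<Q>. \<exists>a (k::int). Q = hcube a (2 powi k)) \<and>
     (\<forall>k::int. partition_on UNIV {Q\<in>\<Q>. \<exists>a. Q = hcube a (2 powi k)}) \<and>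
     (\<forall>Q\<in>\<Q>. \<forall>R\<in>\<Q>. Q \<inter> R = {} \<or> Q \<subseteq> R \<or> R \<subseteq> Q)"

definition standard_dyadic_cubes :: "(real ^ 'd) set set" where
  "standard_dyadic_cubes =
     {hcube (\<chi> i. 2 powi k * real_of_int (m $ i)) (2 powi k) | (k::int) (m :: int ^ 'd). True}"

lemma hcube_side_unique:
  fixes a b :: "real ^ 'd"
  assumes eq: "hcube a s = hcube b t" and "s > 0" "t > 0"
  shows "s = t"
proof -
  have *: "(\<lambda>x. x $ i) ` hcube c u = {c $ i..<c $ i + u}" if "u > 0" for c :: "real ^ 'd" and u i
  proof (intro equalityI subsetI)
    fix y assume "y \<in> {c $ i..<c $ i + u}"
    hence "(\<chi> j. if j = i then y else c $ j) \<in> hcube c u"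
      using that by (auto simp: hcube_def)
    thus "y \<in> (\<lambda>x. x $ i) ` hcube c u" by (rule rev_image_eqI) simp
  qed (auto simp: hcube_def)
  fix i :: 'd
  have "{a $ i..<a $ i + s} = {b $ i..<b $ i + t}"
    using *[of s i a] *[of t i b] assms by metis
  thus ?thesis using assms by (subst (asm) atLeastLessThan_eq_iff) auto
qed

lemma mem_standard_cube:
  "x \<in> hcube (\<chi> i. 2 powi k * real_of_int (m $ i)) (2 powi k) \<longleftrightarrow>
     (\<forall>i. \<lfloor>x $ i / 2 powi k\<rfloor> = m $ i)"
  by (auto simp: hcube_def floor_eq_iff field_simps)

lemma standard_dyadic_cubes_nested:
  fixes m n :: "int ^ 'd"
  assumes "k \<le> l"
    and x: "x \<in> hcube (\<chi> i. 2 powi k * real_of_int (m $ i)) (2 powi k)"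
           "x \<in> hcube (\<chi> i. 2 powi l * real_of_int (n $ i)) (2 powi l)"
  shows "hcube (\<chi> i. 2 powi k * real_of_int (m $ i)) (2 powi k) \<subseteq>
         hcube (\<chi> i. 2 powi l * real_of_int (n $ i)) (2 powi l)"
proof -
  define j where "j = nat (l - k)"
  have pw: "(2::real) powi l = 2 powi k * of_int (2 ^ j)"
    using \<open>k \<le> l\<close> by (simp add: j_def power_int_add[symmetric] flip: power_int_of_nat)
  have fl: "\<lfloor>y / 2 powi l\<rfloor> = \<lfloor>y / 2 powi k\<rfloor> div 2 ^ j" for y :: real
    unfolding pw divide_divide_eq_left[symmetric] by (rule floor_divide_real_eq_div) simp
  have "n $ i = m $ i div 2 ^ j" for i
    using x unfolding mem_standard_cube fl by metis
  thus ?thesis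
    unfolding subset_eq Ball_def mem_standard_cube fl by simp
qed

lemma dyadic_grid_standard: "dyadic_grid (standard_dyadic_cubes :: (real ^ 'd) set set)"
  unfolding dyadic_grid_def
proof (intro conjI ballI allI)
  fix Q :: "(real ^ 'd) set" assume "Q \<in> standard_dyadic_cubes"
  thus "\<exists>a (k::int). Q = hcube a (2 powi k)"
    unfolding standard_dyadic_cubes_def by blast
next
  fix k :: int
  let ?c = "\<lambda>m :: int ^ 'd. hcube (\<chi> i. 2 powi k * real_of_int (m $ i)) (2 powi k)"
  have gen: "{Q \<in> standard_dyadic_cubes. \<exists>a. Q = hcube a (2 powi k)} = range ?c"
  proof (intro equalityI subsetI)
    fix Q :: "(real ^ 'd) set"
    assume "Q \<in> {Q \<in> standard_dyadic_cubes. \<exists>a. Q = hcube a (2 powi k)}"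
    then obtain a l and m :: "int ^ 'd" where Q: "Q = hcube a (2 powi k)"
      "Q = hcube (\<chi> i. 2 powi l * real_of_int (m $ i)) (2 powi l)"
      unfolding standard_dyadic_cubes_def by blast
    have "(2::real) powi l = 2 powi k"
      using Q hcube_side_unique[of _ "2 powi l" a "2 powi k"] by simp
    thus "Q \<in> range ?c" using Q by auto
  qed (auto simp: standard_dyadic_cubes_def)
  have ex: "x \<in> ?c (\<chi> i. \<lfloor>x $ i / 2 powi k\<rfloor>)" for x
    unfolding mem_standard_cube by simp
  have ne: "?c m \<noteq> {}" for m
  proof -
    have "(\<chi> i. 2 powi k * real_of_int (m $ i)) \<in> ?c m" by (simp add: hcube_def)
    thus ?thesis by blast
  qed
  have disj: "m = n" if "x \<in> ?c m" "x \<in> ?c n" for m n x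
    using that unfolding mem_standard_cube by (simp add: vec_eq_iff)
  show "partition_on UNIV {Q \<in> standard_dyadic_cubes :: (real ^ 'd) set set. \<exists>a. Q = hcube a (2 powi k)}"
    unfolding gen
  proof (rule partition_onI)
    show "\<Union> (range ?c) = UNIV"
    proof (intro equalityI subsetI UNIV_I)
      show "x \<in> \<Union> (range ?c)" for x using ex[of x] by (rule UnionI[OF rangeI])
    qed
    show "disjnt A B" if AB: "A \<in> range ?c" "B \<in> range ?c" "A \<noteq> B" for A B
    proof -
      obtain m n where mn: "A = ?c m" "B = ?c n" using AB(1,2) by (elim rangeE)
      show ?thesis unfolding disjnt_iff using disj[of _ m n] AB(3) mn by auto
    qed
    show "{} \<notin> range ?c"
    proof
      assume "{} \<in> range ?c"
      then obtain m where "{} = ?c m" by (rule rangeE)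
      thus False using ne[of m] by simp
    qed
  qed
next
  fix Q R :: "(real ^ 'd) set"
  assume "Q \<in> standard_dyadic_cubes" "R \<in> standard_dyadic_cubes"
  then obtain k l and m n :: "int ^ 'd"
    where "Q = hcube (\<chi> i. 2 powi k * real_of_int (m $ i)) (2 powi k)"
          "R = hcube (\<chi> i. 2 powi l * real_of_int (n $ i)) (2 powi l)"
    unfolding standard_dyadic_cubes_def by blast
  thus "Q \<inter> R = {} \<or> Q \<subseteq> R \<or> R \<subseteq> Q"
    using standard_dyadic_cubes_nested[of k l _ m n] standard_dyadic_cubes_nested[of l k _ n m]
    by (cases "k \<le> l") (blast, force)
qed

definition weight :: "(real ^ 'd \<Rightarrow> real) \<Rightarrow> bool" where
  "weight w \<longleftrightarrow> (\<forall>x. 0 \<le> w x) \<and> w \<in> borel_measurable lebesgue \<and>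
     (\<forall>C. compact C \<longrightarrow> set_integrable lebesgue C w)"

definition weight_measure :: "(real ^ 'd \<Rightarrow> real) \<Rightarrow> (real ^ 'd) measure" where
  "weight_measure w = density lebesgue (\<lambda>x. ennreal (w x))"

text \<open>Real powers of extended non-negative numbers; only used with exponents \<open>r > 0\<close>.\<close>

definition ennreal_powr :: "ennreal \<Rightarrow> real \<Rightarrow> ennreal" where
  "ennreal_powr x r = (if x = \<infinity> then \<infinity> else ennreal (enn2real x powr r))"

definition Lp_norm :: "real \<Rightarrow> (real ^ 'd \<Rightarrow> real) \<Rightarrow> (real ^ 'd \<Rightarrow> ennreal) \<Rightarrow> ennreal" where
  "Lp_norm r w F = ennreal_powr (\<integral>\<^sup>+ x. ennreal_powr (F x) r \<partial>weight_measure w) (1 / r)"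

definition conj_exp :: "real \<Rightarrow> real" where
  "conj_exp r = r / (r - 1)"

definition cube_avg :: "(real ^ 'd) set \<Rightarrow> (real ^ 'd \<Rightarrow> ennreal) \<Rightarrow> ennreal" where
  "cube_avg Q f = (\<integral>\<^sup>+ x\<in>Q. f x \<partial>lebesgue) / emeasure lebesgue Q"

definition T_op :: "(real ^ 'd) set set \<Rightarrow> ((real ^ 'd) set \<Rightarrow> real) \<Rightarrow>
    (real ^ 'd \<Rightarrow> ennreal) \<Rightarrow> real ^ 'd \<Rightarrow> ennreal" where
  "T_op \<Q> \<tau> f = (\<lambda>x. \<Sum>\<^sub>\<infinity>Q\<in>\<Q>. ennreal (\<tau> Q) * cube_avg Q f * indicator Q x)"

definition T_in :: "(real ^ 'd) set set \<Rightarrow> ((real ^ 'd) set \<Rightarrow> real) \<Rightarrow> (real ^ 'd) set \<Rightarrow>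
    (real ^ 'd \<Rightarrow> ennreal) \<Rightarrow> real ^ 'd \<Rightarrow> ennreal" where
  "T_in \<Q> \<tau> R = T_op {Q\<in>\<Q>. Q \<subseteq> R} \<tau>"

definition T_out :: "(real ^ 'd) set set \<Rightarrow> ((real ^ 'd) set \<Rightarrow> real) \<Rightarrow> (real ^ 'd) set \<Rightarrow>
    (real ^ 'd \<Rightarrow> ennreal) \<Rightarrow> real ^ 'd \<Rightarrow> ennreal" where
  "T_out \<Q> \<tau> R = T_op {Q\<in>\<Q>. R \<subseteq> Q} \<tau>"

text \<open>
  Cubes of zero weight are excluded from the suprema below; the supremum of the empty set in
  \<open>[0,\<infinity>]\<close> is \<open>0\<close>.
\<close>

definition Loc_const :: "(real ^ 'd) set set \<Rightarrow> ((real ^ 'd) set \<Rightarrow> real) \<Rightarrow>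
    (real ^ 'd \<Rightarrow> real) \<Rightarrow> (real ^ 'd \<Rightarrow> real) \<Rightarrow> real \<Rightarrow> real \<Rightarrow> ennreal" where
  "Loc_const \<Q> \<tau> \<sigma> \<omega> p q =
     (SUP R\<in>{R\<in>\<Q>. emeasure (weight_measure \<omega>) R \<noteq> 0}.
        Lp_norm (conj_exp p) \<sigma> (T_in \<Q> \<tau> R (\<lambda>x. ennreal (\<omega> x) * indicator R x))
        / ennreal_powr (emeasure (weight_measure \<omega>) R) (1 / conj_exp q))"

definition Glo_const :: "(real ^ 'd) set set \<Rightarrow> ((real ^ 'd) set \<Rightarrow> real) \<Rightarrow>
    (real ^ 'd \<Rightarrow> real) \<Rightarrow> (real ^ 'd \<Rightarrow> real) \<Rightarrow> real \<Rightarrow> real \<Rightarrow> ennreal" where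
  "Glo_const \<Q> \<tau> \<sigma> \<omega> p q =
     (SUP R\<in>{R\<in>\<Q>. emeasure (weight_measure \<omega>) R \<noteq> 0}.
        Lp_norm (conj_exp p) \<sigma> (T_out \<Q> \<tau> R (\<lambda>x. ennreal (\<omega> x) * indicator R x))
        / ennreal_powr (emeasure (weight_measure \<omega>) R) (1 / conj_exp q))"

definition T_opnorm :: "(real ^ 'd) set set \<Rightarrow> ((real ^ 'd) set \<Rightarrow> real) \<Rightarrow>
    (real ^ 'd \<Rightarrow> real) \<Rightarrow> (real ^ 'd \<Rightarrow> real) \<Rightarrow> real \<Rightarrow> real \<Rightarrow> ennreal" where
  "T_opnorm \<Q> \<tau> \<sigma> \<omega> p q =
     Inf {N. \<forall>f \<in> borel_measurable lebesgue.
            Lp_norm q \<omega> (T_op \<Q> \<tau> (\<lambda>x. f x * ennreal (\<sigma> x))) \<le> N * Lp_norm p \<sigma> f}"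

definition C1_const :: "(real ^ 'd) set set \<Rightarrow> ((real ^ 'd) set \<Rightarrow> real) \<Rightarrow>
    (real ^ 'd \<Rightarrow> real) \<Rightarrow> (real ^ 'd \<Rightarrow> real) \<Rightarrow> ennreal" where
  "C1_const \<Q> \<tau> \<sigma> \<omega> = ennreal_powr
     (SUP R\<in>{R\<in>\<Q>. emeasure (weight_measure \<sigma>) R \<noteq> 0}.
        (\<integral>\<^sup>+ x. (\<Sum>\<^sub>\<infinity>Q\<in>{Q\<in>\<Q>. Q \<subseteq> R}. ennreal (\<tau> Q) * indicator Q x
             * cube_avg Q (\<lambda>y. ennreal (\<sigma> y))) ^ 2 * ennreal (\<omega> x) \<partial>lebesgue)
        / emeasure (weight_measure \<sigma>) R) (1 / 2)"

definition C2_const :: "(real ^ 'd) set set \<Rightarrow> ((real ^ 'd) set \<Rightarrow> real) \<Rightarrow>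
    (real ^ 'd \<Rightarrow> real) \<Rightarrow> (real ^ 'd \<Rightarrow> real) \<Rightarrow> ennreal" where
  "C2_const \<Q> \<tau> \<sigma> \<omega> = ennreal_powr
     (SUP R\<in>{R\<in>\<Q>. emeasure (weight_measure \<omega>) R \<noteq> 0}.
        (\<integral>\<^sup>+ x. (\<Sum>\<^sub>\<infinity>Q\<in>{Q\<in>\<Q>. Q \<subseteq> R}. ennreal (\<tau> Q) * indicator Q x
             * cube_avg Q (\<lambda>y. ennreal (\<omega> y))) ^ 2 * ennreal (\<sigma> x) \<partial>lebesgue)
        / emeasure (weight_measure \<omega>) R) (1 / 2)"

definition C3_const :: "(real ^ 'd) set set \<Rightarrow> ((real ^ 'd) set \<Rightarrow> real) \<Rightarrow>
    (real ^ 'd \<Rightarrow> real) \<Rightarrow> (real ^ 'd \<Rightarrow> real) \<Rightarrow> ennreal" where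
  "C3_const \<Q> \<tau> \<sigma> \<omega> =
     (SUP f\<in>{f \<in> borel_measurable lebesgue. Lp_norm 2 \<sigma> f = 1}.
      SUP g\<in>{g \<in> borel_measurable lebesgue. Lp_norm 2 \<omega> g = 1}.
        \<Sum>\<^sub>\<infinity>Q\<in>\<Q>. ennreal (\<tau> Q) * cube_avg Q (\<lambda>x. f x * ennreal (\<sigma> x))
               * cube_avg Q (\<lambda>x. g x * ennreal (\<omega> x)) * emeasure lebesgue Q)"

definition comparable :: "real \<Rightarrow> ennreal \<Rightarrow> ennreal \<Rightarrow> bool" where
  "comparable K A B \<longleftrightarrow> A \<le> ennreal K * B \<and> B \<le> ennreal K * A"

end

theory Submission
  imports Defs
begin

text \<open>
Put \<open>c\<^sub>Q = \<tau>\<^sub>Q / |Q|\<close>, \<open>d\<mu> = \<sigma> dx\<close> and \<open>d\<nu> = \<omega> dx\<close>. Then \<open>T\<^sub>\<tau>(f\<sigma>) = \<Sum>\<^sub>Q c\<^sub>Q (\<integral>\<^sub>Q f d\<mu>) 1\<^sub>Q\<close>, and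
pairing with \<open>g d\<nu>\<close> gives the bilinear form
\<open>\<Lambda>(f,g) = \<Sum>\<^sub>Q c\<^sub>Q (\<integral>\<^sub>Q f d\<mu>) (\<integral>\<^sub>Q g d\<nu>)\<close>, which is symmetric under exchanging the two measures. By
Hoelder's inequality and duality the operator norm \<open>L\<^sup>p(\<mu>) \<rightarrow> L\<^sup>q(\<nu>)\<close> is the norm of \<open>\<Lambda>\<close> on
\<open>L\<^sup>p(\<mu>) \<times> L\<^sup>q\<^sup>'(\<nu>)\<close> (\<open>potential_norm_eq_form_norm\<close>). For \<open>p = q = 2\<close> this is the identity between
\<open>C\<^sub>3\<close> and the operator norm, and in general it shows that the operator and its adjoint have the same
norm. Testing on indicators of cubes then bounds every testing constant by the operator norm.

For the converse in the local case, normalise \<open>f\<close> and \<open>g\<close> and write \<open>a\<^sub>Q\<close>, \<open>b\<^sub>Q\<close> for their averages.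
The cubes are split according to which of \<open>\<nu>(Q) b\<^sub>Q\<^sup>q\<^sup>'\<close> and \<open>\<mu>(Q) a\<^sub>Q\<^sup>p\<close> is larger; by symmetry it is enough
to sum over the cubes where \<open>\<mu>(Q) a\<^sub>Q\<^sup>p\<close> dominates (\<open>corona_estimate\<close>). Among these, a stopping cube is
one whose average \<open>a\<^sub>Q\<close> lies on a strictly higher dyadic level than those of all larger cubes of
the family. Each cube \<open>Q\<close> is grouped with the least stopping cube \<open>F\<close> containing it, and
\<open>a\<^sub>Q \<le> 2 a\<^sub>F\<close>. The function \<open>\<Sum>\<^sub>Q c\<^sub>Q \<mu>(Q) 1\<^sub>Q\<close> of the group of \<open>F\<close> is constant on the maximal
stopping cubes below \<open>F\<close>, so \<open>g\<close> may be replaced there by its averages; the testing condition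
controls the group by \<open>a\<^sub>F \<mu>(F)\<^sup>1\<^sup>/\<^sup>p\<close> times the norm of the modified \<open>g\<close>. Because the stopping cubes are
chosen inside the part of the family where \<open>\<mu>(Q) a\<^sub>Q\<^sup>p\<close> dominates, the averages of \<open>g\<close> on them are paid
for by \<open>\<Sum>\<^sub>F \<mu>(F) a\<^sub>F\<^sup>p\<close>, and this sum is bounded by the Carleson embedding theorem (\<open>carleson_embedding\<close>).
The hypothesis \<open>p \<le> q\<close> enters as \<open>1/p + 1/q' \<ge> 1\<close>, which lets the sum over \<open>F\<close> be moved inside
the powers.

For \<open>p < q\<close> the global testing constant dominates the local one
(\<open>local_testing_le_global_testing\<close>), so the second equivalence follows from the first. The cubes
inside \<open>R\<close> are grouped by the dyadic size \<open>2\<^sup>k\<close> of their measure; the cubes of one group through a given point all contain a common minimal member of the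
group, so global testing on the disjoint minimal members controls the group. The bounds form a
geometric series in \<open>k\<close> with ratio \<open>2\<^sup>1\<^sup>/\<^sup>p\<^sup>-\<^sup>1\<^sup>/\<^sup>q > 1\<close>, summed over \<open>2\<^sup>k \<le> \<mu>(R)\<close>.

Of the dyadic cubes the argument uses only that there are countably many, that any two are nested or
disjoint, and that both weights have finite mass on each of them.
\<close>

section \<open>Powers of extended non-negative numbers\<close>

lemma ennreal_powr_ennreal [simp]: "0 \<le> a \<Longrightarrow> ennreal_powr (ennreal a) r = ennreal (a powr r)"
  by (simp add: ennreal_powr_def)

lemma ennreal_powr_top [simp]: "ennreal_powr top r = top"
  by (simp add: ennreal_powr_def)

lemma ennreal_powr_0 [simp]: "ennreal_powr 0 r = 0"
  by (simp add: ennreal_powr_def)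

lemma ennreal_powr_1 [simp]: "ennreal_powr 1 r = 1"
  by (simp add: ennreal_powr_def)

lemma ennreal_powr_one_right [simp]: "ennreal_powr x 1 = x"
  by (cases x) auto

lemma ennreal_powr_mono: "x \<le> y \<Longrightarrow> 0 \<le> r \<Longrightarrow> ennreal_powr x r \<le> ennreal_powr y r"
  by (cases x; cases y) (auto simp: top_unique intro!: ennreal_leI powr_mono2)

lemma ennreal_powr_mult: "0 < r \<Longrightarrow> ennreal_powr (x * y) r = ennreal_powr x r * ennreal_powr y r"
  by (cases x; cases y)
    (auto simp: powr_mult ennreal_mult[symmetric] ennreal_mult_top ennreal_top_mult powr_eq_0_iff)

lemma ennreal_powr_powr: "0 < r \<Longrightarrow> 0 < s \<Longrightarrow> ennreal_powr (ennreal_powr x r) s = ennreal_powr x (r * s)"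
  by (cases x) (auto simp: powr_powr)

lemma ennreal_powr_add:
  "0 < r \<Longrightarrow> 0 < s \<Longrightarrow> ennreal_powr x r * ennreal_powr x s = ennreal_powr x (r + s)"
  by (cases x) (auto simp: powr_add ennreal_mult)

lemma ennreal_powr_divide:
  "0 < r \<Longrightarrow> ennreal_powr (x / y) r = ennreal_powr x r / ennreal_powr y r"
  apply (cases x; cases y)
  apply (auto simp: ennreal_divide_top ennreal_top_divide)
  subgoal for a b
    apply (cases "b = 0")
     apply (cases "a = 0"; simp add: divide_ennreal_def ennreal_mult_top powr_eq_0_iff)
    apply (simp add: divide_ennreal powr_divide)
    done
  done

lemma ennreal_powr_eq_0_iff [simp]: "ennreal_powr x r = 0 \<longleftrightarrow> x = 0"
  by (cases x) auto

lemma ennreal_powr_eq_top_iff [simp]: "ennreal_powr x r = top \<longleftrightarrow> x = top"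
  by (cases x) auto

lemma ennreal_powr_le_iff:
  assumes "0 < r" shows "ennreal_powr x r \<le> y \<longleftrightarrow> x \<le> ennreal_powr y (1 / r)"
proof
  assume "ennreal_powr x r \<le> y"
  from ennreal_powr_mono[OF this, of "1/r"] show "x \<le> ennreal_powr y (1 / r)"
    using assms by (simp add: ennreal_powr_powr)
next
  assume "x \<le> ennreal_powr y (1 / r)"
  from ennreal_powr_mono[OF this, of r] show "ennreal_powr x r \<le> y"
    using assms by (simp add: ennreal_powr_powr)
qed

text \<open>
By the Galois connection \<open>ennreal_powr_le_iff\<close>, a positive power is an order isomorphism of
\<open>[0,\<infinity>]\<close>, hence commutes with suprema.
\<close>

lemma ennreal_powr_SUP:
  assumes "0 < r" shows "ennreal_powr (SUP i\<in>I. f i) r = (SUP i\<in>I. ennreal_powr (f i) r)"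
proof (rule antisym)
  show "ennreal_powr (SUP i\<in>I. f i) r \<le> (SUP i\<in>I. ennreal_powr (f i) r)"
    unfolding ennreal_powr_le_iff[OF assms]
    by (intro SUP_least) (metis SUP_upper assms ennreal_powr_le_iff)
  show "(SUP i\<in>I. ennreal_powr (f i) r) \<le> ennreal_powr (SUP i\<in>I. f i) r"
    using assms by (intro SUP_least ennreal_powr_mono SUP_upper) auto
qed

lemma measurable_ennreal_powr [measurable (raw)]:
  assumes [measurable]: "f \<in> borel_measurable M"
  shows "(\<lambda>x. ennreal_powr (f x) r) \<in> borel_measurable M"
  unfolding ennreal_powr_def by measurable

section \<open>Norms, Hoelder and Minkowski inequalities\<close>

definition Lnorm :: "real \<Rightarrow> 'a measure \<Rightarrow> ('a \<Rightarrow> ennreal) \<Rightarrow> ennreal" where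
  "Lnorm r M F = ennreal_powr (\<integral>\<^sup>+ x. ennreal_powr (F x) r \<partial>M) (1 / r)"

lemma Lp_norm_eq_Lnorm: "Lp_norm r w F = Lnorm r (weight_measure w) F"
  by (simp add: Lp_norm_def Lnorm_def)

lemma Lnorm_le_iff: "0 < r \<Longrightarrow> Lnorm r M F \<le> B \<longleftrightarrow> (\<integral>\<^sup>+ x. ennreal_powr (F x) r \<partial>M) \<le> ennreal_powr B r"
  unfolding Lnorm_def by (simp add: ennreal_powr_le_iff)

lemma Lnorm_mono:
  "0 < r \<Longrightarrow> (\<And>x. x \<in> space M \<Longrightarrow> F x \<le> G x) \<Longrightarrow> Lnorm r M F \<le> Lnorm r M G"
  unfolding Lnorm_def by (intro ennreal_powr_mono nn_integral_mono) auto

lemma Lnorm_cmult: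
  assumes "0 < r" "F \<in> borel_measurable M"
  shows "Lnorm r M (\<lambda>x. a * F x) = a * Lnorm r M F"
  unfolding Lnorm_def using assms
  by (simp add: ennreal_powr_mult nn_integral_cmult ennreal_powr_powr)

lemma Lnorm_indicator:
  assumes "0 < r" "A \<in> sets M"
  shows "Lnorm r M (indicator A) = ennreal_powr (emeasure M A) (1 / r)"
proof -
  have "ennreal_powr (indicator A x) r = indicator A x" for x
    by (auto simp: indicator_def)
  thus ?thesis unfolding Lnorm_def using assms by simp
qed

lemma Lnorm_eq_0_imp_AE:
  assumes "F \<in> borel_measurable M" "Lnorm r M F = 0"
  shows "AE x in M. F x = 0"
proof -
  have "(\<integral>\<^sup>+ x. ennreal_powr (F x) r \<partial>M) = 0" using assms unfolding Lnorm_def by simp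
  thus ?thesis using assms by (subst (asm) nn_integral_0_iff_AE) auto
qed

lemma Youngs_inequality_ennreal:
  assumes "1 < p" "1 < q" "1 / p + 1 / q = (1::real)"
  shows "x * y \<le> ennreal (1 / p) * ennreal_powr x p + ennreal (1 / q) * ennreal_powr y q"
proof (cases x; cases y)
  fix a b assume ab: "0 \<le> a" "x = ennreal a" "0 \<le> b" "y = ennreal b"
  have "ennreal (a * b) \<le> ennreal (a powr p / p + b powr q / q)"
    using ab assms by (intro ennreal_leI Youngs_inequality) auto
  thus ?thesis using ab assms
    by (simp add: ennreal_mult[symmetric] ennreal_plus[symmetric] del: ennreal_plus)
next
  fix a assume "0 \<le> a" "x = ennreal a" "y = top"
  thus ?thesis using assms by (simp add: ennreal_mult_top)
next
  assume "x = top"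
  thus ?thesis using assms by (simp add: ennreal_mult_top)
next
  assume "x = top"
  thus ?thesis using assms by (simp add: ennreal_mult_top)
qed

lemma Lnorm_powr: "0 < r \<Longrightarrow> ennreal_powr (Lnorm r M F) r = (\<integral>\<^sup>+ x. ennreal_powr (F x) r \<partial>M)"
  by (simp add: Lnorm_def ennreal_powr_powr)

text \<open>
Integrating Young's inequality gives \<open>1/p + 1/q\<close> on the right-hand side.
\<close>

lemma Hoelder_nn_integral_normalized:
  assumes pq: "1 < p" "1 < q" "1 / p + 1 / q = (1::real)"
    and [measurable]: "f \<in> borel_measurable M" "g \<in> borel_measurable M"
    and "Lnorm p M f = 1" "Lnorm q M g = 1"
  shows "(\<integral>\<^sup>+ x. f x * g x \<partial>M) \<le> 1"
proof -
  have "(\<integral>\<^sup>+ x. f x * g x \<partial>M) \<le>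
      (\<integral>\<^sup>+ x. ennreal (1 / p) * ennreal_powr (f x) p + ennreal (1 / q) * ennreal_powr (g x) q \<partial>M)"
    by (intro nn_integral_mono Youngs_inequality_ennreal pq)
  also have "\<dots> = ennreal (1 / p) + ennreal (1 / q)"
    using assms Lnorm_powr[of p M f] Lnorm_powr[of q M g] by (simp add: nn_integral_add nn_integral_cmult)
  also have "\<dots> = 1" using pq by (simp add: ennreal_plus[symmetric] del: ennreal_plus)
  finally show ?thesis .
qed

lemma Hoelder_nn_integral:
  assumes pq: "1 < p" "1 < q" "1 / p + 1 / q = (1::real)"
    and f[measurable]: "f \<in> borel_measurable M" and g[measurable]: "g \<in> borel_measurable M"
  shows "(\<integral>\<^sup>+ x. f x * g x \<partial>M) \<le> Lnorm p M f * Lnorm q M g"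
proof -
  let ?A = "Lnorm p M f" and ?B = "Lnorm q M g"
  consider "?A = 0" | "?B = 0" | "?A \<noteq> 0" "?B \<noteq> 0" "?A = top \<or> ?B = top"
    | "?A \<noteq> 0" "?B \<noteq> 0" "?A \<noteq> top" "?B \<noteq> top" by blast
  thus ?thesis
  proof cases
    case 1
    have "AE x in M. f x * g x = 0" using Lnorm_eq_0_imp_AE[OF f 1] by eventually_elim simp
    hence "(\<integral>\<^sup>+ x. f x * g x \<partial>M) = 0" by (subst nn_integral_0_iff_AE) auto
    thus ?thesis by simp
  next
    case 2
    have "AE x in M. f x * g x = 0" using Lnorm_eq_0_imp_AE[OF g 2] by eventually_elim simp
    hence "(\<integral>\<^sup>+ x. f x * g x \<partial>M) = 0" by (subst nn_integral_0_iff_AE) auto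
    thus ?thesis by simp
  next
    case 3
    hence "?A * ?B = top" by (auto simp: ennreal_mult_eq_top_iff)
    thus ?thesis by simp
  next
    case 4
    have inv: "inverse ?A * ?A = 1" "inverse ?B * ?B = 1"
      using 4 by (simp_all add: mult.commute[of "inverse _"] divide_ennreal_def[symmetric] ennreal_divide_self less_top)
    have "(\<integral>\<^sup>+ x. (inverse ?A * f x) * (inverse ?B * g x) \<partial>M) \<le> 1"
      using pq inv by (intro Hoelder_nn_integral_normalized[OF pq]) (auto simp: Lnorm_cmult)
    also have "(\<integral>\<^sup>+ x. (inverse ?A * f x) * (inverse ?B * g x) \<partial>M) =
        inverse ?A * inverse ?B * (\<integral>\<^sup>+ x. f x * g x \<partial>M)"
      by (subst nn_integral_cmult[symmetric]) (auto simp: ac_simps)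
    finally have "?A * ?B * (inverse ?A * inverse ?B * (\<integral>\<^sup>+ x. f x * g x \<partial>M)) \<le> ?A * ?B * 1"
      by (rule mult_left_mono) simp
    also have "?A * ?B * (inverse ?A * inverse ?B * (\<integral>\<^sup>+ x. f x * g x \<partial>M)) =
       (inverse ?A * ?A) * (inverse ?B * ?B) * (\<integral>\<^sup>+ x. f x * g x \<partial>M)"
      by (simp only: ac_simps)
    finally show ?thesis using inv by simp
  qed
qed

text \<open>
Split \<open>(F + G)\<^sup>r = F H + G H\<close> with \<open>H = (F + G)\<^sup>r\<^sup>-\<^sup>1\<close>, apply Hoelder's inequality to both terms and cancel the norm
of \<open>H\<close>. Cancelling needs \<open>\<integral> (F + G)\<^sup>r\<close> to be finite, which follows from \<open>F + G \<le> 2 max F G\<close>.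
\<close>

lemma Lnorm_triangle:
  assumes r: "1 < r" and F[measurable]: "F \<in> borel_measurable M" and G[measurable]: "G \<in> borel_measurable M"
  shows "Lnorm r M (\<lambda>x. F x + G x) \<le> Lnorm r M F + Lnorm r M G"
proof (cases "Lnorm r M F = top \<or> Lnorm r M G = top")
  case False
  define s where "s = r / (r - 1)"
  have s: "1 < s" "1 / r + 1 / s = 1" "(r - 1) * s = r" using r unfolding s_def by (auto simp: field_simps)
  let ?I = "\<integral>\<^sup>+x. ennreal_powr (F x + G x) r \<partial>M"
  define H where "H x = ennreal_powr (F x + G x) (r - 1)" for x
  have Hm[measurable]: "H \<in> borel_measurable M" unfolding H_def by measurable
  have "?I \<le> (\<integral>\<^sup>+x. ennreal_powr 2 r * (ennreal_powr (F x) r + ennreal_powr (G x) r) \<partial>M)"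
  proof (rule nn_integral_mono)
    fix x
    have "F x + G x \<le> 2 * max (F x) (G x)"
      by (simp add: mult_2 add_mono)
    hence "ennreal_powr (F x + G x) r \<le> ennreal_powr 2 r * ennreal_powr (max (F x) (G x)) r"
      using r ennreal_powr_mono[of _ _ r] by (simp add: ennreal_powr_mult[symmetric])
    also have "ennreal_powr (max (F x) (G x)) r \<le> ennreal_powr (F x) r + ennreal_powr (G x) r"
      by (simp add: max_def add_increasing add_increasing2)
    finally show "ennreal_powr (F x + G x) r \<le> ennreal_powr 2 r * (ennreal_powr (F x) r + ennreal_powr (G x) r)"
      by (simp add: mult_left_mono)
  qed
  also have "\<dots> = ennreal_powr 2 r * (ennreal_powr (Lnorm r M F) r + ennreal_powr (Lnorm r M G) r)"
    using r by (simp add: nn_integral_cmult nn_integral_add Lnorm_powr)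
  also have "\<dots> < top" using False
    by (simp add: less_top[symmetric] ennreal_mult_eq_top_iff)
  finally have I: "?I \<noteq> top" by simp
  show ?thesis
  proof (cases "?I = 0")
    case False
    have nz: "ennreal_powr ?I (1 / s) \<noteq> 0" "ennreal_powr ?I (1 / s) \<noteq> top" using False I by simp_all
    have Hs: "Lnorm s M H = ennreal_powr ?I (1 / s)"
      unfolding Lnorm_def H_def using r s by (simp add: ennreal_powr_powr)
    have "ennreal_powr ?I (1 / s) * ennreal_powr ?I (1 / r) = ?I"
      using r s by (simp add: ennreal_powr_add add.commute)
    also have "?I = (\<integral>\<^sup>+x. F x * H x + G x * H x \<partial>M)"
    proof (rule nn_integral_cong)
      fix x show "ennreal_powr (F x + G x) r = F x * H x + G x * H x"
        using ennreal_powr_add[of 1 "r - 1" "F x + G x"] r by (simp add: H_def distrib_right)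
    qed
    also have "\<dots> = (\<integral>\<^sup>+x. F x * H x \<partial>M) + (\<integral>\<^sup>+x. G x * H x \<partial>M)"
      by (rule nn_integral_add) measurable
    also have "\<dots> \<le> Lnorm r M F * Lnorm s M H + Lnorm r M G * Lnorm s M H"
      using r s by (intro add_mono Hoelder_nn_integral) auto
    also have "\<dots> = ennreal_powr ?I (1 / s) * (Lnorm r M F + Lnorm r M G)"
      by (simp add: Hs distrib_left mult.commute[of "Lnorm _ _ _"])
    finally have "ennreal_powr ?I (1 / r) \<le> Lnorm r M F + Lnorm r M G"
      unfolding ennreal_mult_le_mult_iff[OF nz] .
    thus ?thesis by (simp add: Lnorm_def)
  qed (simp add: Lnorm_def)
qed auto

lemma Lnorm_sum_le:
  assumes r: "1 < r" and "finite I" and "\<And>i. i \<in> I \<Longrightarrow> F i \<in> borel_measurable M"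
  shows "Lnorm r M (\<lambda>x. \<Sum>i\<in>I. F i x) \<le> (\<Sum>i\<in>I. Lnorm r M (F i))"
  using assms(2,3)
proof (induction I)
  case (insert i I)
  have "Lnorm r M (\<lambda>x. F i x + (\<Sum>i\<in>I. F i x)) \<le> Lnorm r M (F i) + Lnorm r M (\<lambda>x. \<Sum>i\<in>I. F i x)"
    using insert by (intro Lnorm_triangle r borel_measurable_sum) auto
  also have "\<dots> \<le> Lnorm r M (F i) + (\<Sum>i\<in>I. Lnorm r M (F i))"
    using insert by (intro add_left_mono) auto
  finally show ?case using insert by simp
qed (simp add: Lnorm_def)

text \<open>
One increasing sequence of finite sets exhausts a countable sum for all summands simultaneously.
This turns infinite sums of functions into monotone limits, to which monotone convergence applies.
\<close>

lemma infsum_ennreal_exhaustion: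
  assumes "countable D"
  obtains S :: "nat \<Rightarrow> 'a set" where "\<And>n. finite (S n)" "\<And>n Q. Q \<in> S n \<Longrightarrow> Q \<in> D" "incseq S"
    "\<And>u :: 'a \<Rightarrow> ennreal. infsum u D = (SUP n. sum u (S n))"
proof -
  obtain e :: "nat \<Rightarrow> 'a" where e: "D \<subseteq> range e"
    using assms by (metis countable_subset_image countable_empty empty_subsetI image_mono
      range_from_nat_into subset_UNIV subset_refl from_nat_into)
  define S where "S n = e ` {..<n} \<inter> D" for n
  have inc: "incseq S" unfolding S_def incseq_def by fastforce
  have ex: "\<exists>n. F \<subseteq> S n" if "finite F" "F \<subseteq> D" for F
    using that
  proof (induction F)
    case (insert x F)
    then obtain n i where "F \<subseteq> S n" "x = e i" using e by auto
    hence "insert x F \<subseteq> S (max n (Suc i))"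
      using insert.prems inc unfolding S_def by fastforce
    thus ?case ..
  qed auto
  show ?thesis
  proof
    show "finite (S n)" "\<And>Q. Q \<in> S n \<Longrightarrow> Q \<in> D" for n by (auto simp: S_def)
    show "incseq S" by fact
    show "infsum u D = (SUP n. sum u (S n))" for u :: "'a \<Rightarrow> ennreal"
    proof (subst nonneg_infsum_complete, simp, rule antisym)
      show "(SUP F\<in>{F. finite F \<and> F \<subseteq> D}. sum u F) \<le> (SUP n. sum u (S n))"
      proof (rule SUP_least, clarify)
        fix F assume F: "finite F" "F \<subseteq> D"
        then obtain n where "F \<subseteq> S n" using ex by blast
        hence "sum u F \<le> sum u (S n)" by (intro sum_mono2) (auto simp: S_def)
        also have "\<dots> \<le> (SUP n. sum u (S n))" by (rule SUP_upper) simp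
        finally show "sum u F \<le> (SUP n. sum u (S n))" .
      qed
      show "(SUP n. sum u (S n)) \<le> (SUP F\<in>{F. finite F \<and> F \<subseteq> D}. sum u F)"
      proof (rule SUP_least)
        fix n show "sum u (S n) \<le> (SUP F\<in>{F. finite F \<and> F \<subseteq> D}. sum u F)"
          by (rule SUP_upper) (auto simp: S_def)
      qed
    qed
  qed
qed

lemma infsum_ennreal_le:
  fixes u :: "'a \<Rightarrow> ennreal"
  assumes "\<And>S. finite S \<Longrightarrow> S \<subseteq> D \<Longrightarrow> sum u S \<le> B"
  shows "infsum u D \<le> B"
  by (subst nonneg_infsum_complete) (auto intro!: SUP_least assms)

lemma infsum_ennreal_subset_mono:
  fixes u :: "'a \<Rightarrow> ennreal"
  assumes "D \<subseteq> E" shows "infsum u D \<le> infsum u E"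
  by (rule infsum_mono_neutral) (use assms in \<open>auto intro: nonneg_summable_on_complete\<close>)

lemma infsum_ennreal_cmult: "(\<Sum>\<^sub>\<infinity>x\<in>D. (c::ennreal) * u x) = c * infsum u D"
  by (simp add: nonneg_infsum_complete SUP_mult_left_ennreal sum_distrib_left)

lemma borel_measurable_infsum_ennreal [measurable (raw)]:
  assumes "countable D" "\<And>Q. Q \<in> D \<Longrightarrow> u Q \<in> borel_measurable M"
  shows "(\<lambda>x. \<Sum>\<^sub>\<infinity>Q\<in>D. (u Q x :: ennreal)) \<in> borel_measurable M"
proof -
  obtain S where S: "\<And>n. finite (S n)" "\<And>n Q. Q \<in> S n \<Longrightarrow> Q \<in> D" "incseq S"
    "\<And>u :: _ \<Rightarrow> ennreal. infsum u D = (SUP n. sum u (S n))"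
    using infsum_ennreal_exhaustion[OF assms(1)] by metis
  show ?thesis unfolding S(4)
    by (intro borel_measurable_SUP borel_measurable_sum assms) (use S in auto)
qed

lemma nn_integral_infsum:
  assumes "countable D" "\<And>Q. Q \<in> D \<Longrightarrow> u Q \<in> borel_measurable M"
  shows "(\<integral>\<^sup>+ x. (\<Sum>\<^sub>\<infinity>Q\<in>D. u Q x) \<partial>M) = (\<Sum>\<^sub>\<infinity>Q\<in>D. \<integral>\<^sup>+ x. u Q x \<partial>M)"
proof -
  obtain S where S: "\<And>n. finite (S n)" "\<And>n Q. Q \<in> S n \<Longrightarrow> Q \<in> D" "incseq S"
    "\<And>u :: _ \<Rightarrow> ennreal. infsum u D = (SUP n. sum u (S n))"
    using infsum_ennreal_exhaustion[OF assms(1)] by metis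
  have "(\<integral>\<^sup>+ x. (SUP n. \<Sum>Q\<in>S n. u Q x) \<partial>M) = (SUP n. \<integral>\<^sup>+ x. (\<Sum>Q\<in>S n. u Q x) \<partial>M)"
  proof (rule nn_integral_monotone_convergence_SUP)
    show "incseq (\<lambda>n x. \<Sum>Q\<in>S n. u Q x)"
      unfolding incseq_def le_fun_def using S(1)
      by (intro allI impI sum_mono2 incseqD[OF S(3)]) auto
    show "(\<lambda>x. \<Sum>Q\<in>S n. u Q x) \<in> borel_measurable M" for n
      using S assms by (intro borel_measurable_sum) auto
  qed
  also have "\<dots> = (SUP n. \<Sum>Q\<in>S n. \<integral>\<^sup>+ x. u Q x \<partial>M)"
    using S assms by (intro SUP_cong refl nn_integral_sum) auto
  finally show ?thesis unfolding S(4) .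
qed

lemma Lnorm_infsum_le:
  assumes "0 < r" "countable D" "\<And>Q. Q \<in> D \<Longrightarrow> u Q \<in> borel_measurable M"
    and le: "\<And>S. finite S \<Longrightarrow> S \<subseteq> D \<Longrightarrow> Lnorm r M (\<lambda>x. \<Sum>Q\<in>S. u Q x) \<le> B"
  shows "Lnorm r M (\<lambda>x. \<Sum>\<^sub>\<infinity>Q\<in>D. u Q x) \<le> B"
proof -
  obtain S where S: "\<And>n. finite (S n)" "\<And>n Q. Q \<in> S n \<Longrightarrow> Q \<in> D" "incseq S"
    "\<And>u :: _ \<Rightarrow> ennreal. infsum u D = (SUP n. sum u (S n))"
    using infsum_ennreal_exhaustion[OF assms(2)] by metis
  have "(\<integral>\<^sup>+ x. ennreal_powr (\<Sum>\<^sub>\<infinity>Q\<in>D. u Q x) r \<partial>M)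
      = (\<integral>\<^sup>+ x. (SUP n. ennreal_powr (\<Sum>Q\<in>S n. u Q x) r) \<partial>M)"
    unfolding S(4) using assms by (simp add: ennreal_powr_SUP)
  also have "\<dots> = (SUP n. \<integral>\<^sup>+ x. ennreal_powr (\<Sum>Q\<in>S n. u Q x) r \<partial>M)"
  proof (rule nn_integral_monotone_convergence_SUP)
    show "incseq (\<lambda>n x. ennreal_powr (\<Sum>Q\<in>S n. u Q x) r)"
      unfolding incseq_def le_fun_def using assms(1) S(1)
      by (intro allI impI ennreal_powr_mono sum_mono2 incseqD[OF S(3)]) auto
    show "(\<lambda>x. ennreal_powr (\<Sum>Q\<in>S n. u Q x) r) \<in> borel_measurable M" for n
      using S assms by (intro measurable_ennreal_powr borel_measurable_sum) auto
  qed
  also have "\<dots> \<le> ennreal_powr B r"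
  proof (rule SUP_least)
    fix n
    have "S n \<subseteq> D" using S(2) by blast
    thus "(\<integral>\<^sup>+ x. ennreal_powr (\<Sum>Q\<in>S n. u Q x) r \<partial>M) \<le> ennreal_powr B r"
      using le[OF S(1)[of n]] unfolding Lnorm_le_iff[OF assms(1)] by simp
  qed
  finally show ?thesis using assms(1) by (simp add: Lnorm_le_iff)
qed

lemma conjugate_exponent_gt_1:
  fixes q r :: real
  assumes "1 < q" "1 / q + 1 / r = 1"
  shows "1 < r"
proof -
  have "0 < 1 / q" "1 / q < 1" using assms(1) by auto
  hence "0 < 1 / r" "1 / r < 1" using assms(2) by linarith+
  thus ?thesis by (simp add: divide_less_eq)
qed

lemma conjugate_exponent_eq:
  fixes q r :: real
  assumes "1 < q" "1 / q + 1 / r = 1"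
  shows "r = q / (q - 1)"
proof -
  have "r > 0" using conjugate_exponent_gt_1[OF assms] by simp
  thus ?thesis using assms by (simp add: field_simps)
qed

section \<open>Dyadic potentials, their bilinear form and testing constants\<close>

definition dyadic_potential ::
    "'a set set \<Rightarrow> ('a set \<Rightarrow> real) \<Rightarrow> 'a measure \<Rightarrow> ('a \<Rightarrow> ennreal) \<Rightarrow> 'a \<Rightarrow> ennreal" where
  "dyadic_potential D c \<mu> f x = (\<Sum>\<^sub>\<infinity>Q\<in>D. ennreal (c Q) * (\<integral>\<^sup>+y\<in>Q. f y \<partial>\<mu>) * indicator Q x)"

definition dyadic_form ::
    "'a set set \<Rightarrow> ('a set \<Rightarrow> real) \<Rightarrow> 'a measure \<Rightarrow> 'a measure \<Rightarrow> ('a \<Rightarrow> ennreal) \<Rightarrow> ('a \<Rightarrow> ennreal) \<Rightarrow> ennreal" where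
  "dyadic_form D c \<mu> \<nu> f g = (\<Sum>\<^sub>\<infinity>Q\<in>D. ennreal (c Q) * (\<integral>\<^sup>+x\<in>Q. f x \<partial>\<mu>) * (\<integral>\<^sup>+x\<in>Q. g x \<partial>\<nu>))"

definition potential_norm ::
    "'a set set \<Rightarrow> ('a set \<Rightarrow> real) \<Rightarrow> 'a measure \<Rightarrow> 'a measure \<Rightarrow> real \<Rightarrow> real \<Rightarrow> ennreal" where
  "potential_norm D c \<mu> \<nu> p q =
     Inf {N. \<forall>f\<in>borel_measurable \<mu>. Lnorm q \<nu> (dyadic_potential D c \<mu> f) \<le> N * Lnorm p \<mu> f}"

definition form_norm ::
    "'a set set \<Rightarrow> ('a set \<Rightarrow> real) \<Rightarrow> 'a measure \<Rightarrow> 'a measure \<Rightarrow> real \<Rightarrow> real \<Rightarrow> ennreal" where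
  "form_norm D c \<mu> \<nu> p r =
     (SUP f\<in>{f \<in> borel_measurable \<mu>. Lnorm p \<mu> f = 1}.
      SUP g\<in>{g \<in> borel_measurable \<nu>. Lnorm r \<nu> g = 1}. dyadic_form D c \<mu> \<nu> f g)"

text \<open>
The family \<open>E R\<close> selects the cubes of the localised operator: those inside \<open>R\<close> for local testing
and those containing \<open>R\<close> for global testing.
\<close>

definition testing_const ::
    "'a set set \<Rightarrow> ('a set \<Rightarrow> 'a set set) \<Rightarrow> ('a set \<Rightarrow> real) \<Rightarrow> 'a measure \<Rightarrow> 'a measure \<Rightarrow> real \<Rightarrow> real \<Rightarrow> ennreal" where
  "testing_const D E c \<mu> \<nu> p q =
     (SUP R\<in>{R\<in>D. emeasure \<mu> R \<noteq> 0}.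
        Lnorm q \<nu> (dyadic_potential (E R) c \<mu> (indicator R)) / ennreal_powr (emeasure \<mu> R) (1 / p))"

text \<open>
The abstract setting: a countable family of sets, any two of which are nested or disjoint, and two
measures that are finite on its members. The assumptions are symmetric in the two measures, so
every statement has a dual one, obtained from \<open>swap\<close>.
\<close>

locale dyadic_pair =
  fixes D :: "'a set set" and c :: "'a set \<Rightarrow> real" and \<mu> \<nu> :: "'a measure"
  assumes countable_D: "countable D"
    and laminar: "\<And>Q R. Q \<in> D \<Longrightarrow> R \<in> D \<Longrightarrow> Q \<inter> R = {} \<or> Q \<subseteq> R \<or> R \<subseteq> Q"
    and c_nonneg: "\<And>Q. Q \<in> D \<Longrightarrow> 0 \<le> c Q"
    and sets_eq: "sets \<nu> = sets \<mu>"
    and in_sets: "\<And>Q. Q \<in> D \<Longrightarrow> Q \<in> sets \<mu>"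
    and mu_finite: "\<And>Q. Q \<in> D \<Longrightarrow> emeasure \<mu> Q < top"
    and nu_finite: "\<And>Q. Q \<in> D \<Longrightarrow> emeasure \<nu> Q < top"
begin

lemma swap: "dyadic_pair D c \<nu> \<mu>"
  using countable_D laminar c_nonneg sets_eq in_sets mu_finite nu_finite
  by unfold_locales auto

lemma restrict_family: assumes "D' \<subseteq> D" shows "dyadic_pair D' c \<mu> \<nu>"
proof
  show "countable D'" using assms countable_D by (rule countable_subset)
  show "Q \<inter> R = {} \<or> Q \<subseteq> R \<or> R \<subseteq> Q" if "Q \<in> D'" "R \<in> D'" for Q R
    using that assms by (intro laminar) auto
qed (use assms c_nonneg sets_eq in_sets mu_finite nu_finite in auto)

lemma in_sets_nu: "Q \<in> D \<Longrightarrow> Q \<in> sets \<nu>" using in_sets sets_eq by simp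

lemma potential_measurable: "dyadic_potential D c \<mu> f \<in> borel_measurable \<nu>"
  unfolding dyadic_potential_def
  by (intro borel_measurable_infsum_ennreal countable_D borel_measurable_times_ennreal
      borel_measurable_const borel_measurable_indicator in_sets_nu)

lemma potential_mono_sets: "D' \<subseteq> D \<Longrightarrow> dyadic_potential D' c \<mu> f x \<le> dyadic_potential D c \<mu> f x"
  unfolding dyadic_potential_def by (rule infsum_ennreal_subset_mono)

text \<open>
As all terms are non-negative, the sum over the countable family \<open>D\<close> passes through the integral.
\<close>

lemma nn_integral_potential_mult:
  assumes g: "g \<in> borel_measurable \<nu>"
  shows "(\<integral>\<^sup>+x. dyadic_potential D c \<mu> f x * g x \<partial>\<nu>) = dyadic_form D c \<mu> \<nu> f g"
proof -
  have "(\<integral>\<^sup>+x. dyadic_potential D c \<mu> f x * g x \<partial>\<nu>) =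
     (\<integral>\<^sup>+x. (\<Sum>\<^sub>\<infinity>Q\<in>D. ennreal (c Q) * (\<integral>\<^sup>+y\<in>Q. f y \<partial>\<mu>) * (g x * indicator Q x)) \<partial>\<nu>)"
    unfolding dyadic_potential_def
    by (subst mult.commute, subst infsum_ennreal_cmult[symmetric]) (simp add: ac_simps)
  also have "\<dots> = (\<Sum>\<^sub>\<infinity>Q\<in>D. \<integral>\<^sup>+x. ennreal (c Q) * (\<integral>\<^sup>+y\<in>Q. f y \<partial>\<mu>) * (g x * indicator Q x) \<partial>\<nu>)"
    using g in_sets_nu by (intro nn_integral_infsum countable_D) auto
  also have "\<dots> = dyadic_form D c \<mu> \<nu> f g"
    unfolding dyadic_form_def using g in_sets_nu
    by (intro infsum_cong nn_integral_cmult) auto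
  finally show ?thesis .
qed

lemma form_swap: "dyadic_form D c \<nu> \<mu> g f = dyadic_form D c \<mu> \<nu> f g"
  unfolding dyadic_form_def by (simp add: ac_simps)

lemma form_norm_swap: "form_norm D c \<nu> \<mu> r p = form_norm D c \<mu> \<nu> p r"
  unfolding form_norm_def form_swap by (rule SUP_commute)

lemma form_cmult:
  assumes "f \<in> borel_measurable \<mu>" "g \<in> borel_measurable \<nu>"
  shows "dyadic_form D c \<mu> \<nu> (\<lambda>x. a * f x) (\<lambda>x. b * g x) = a * b * dyadic_form D c \<mu> \<nu> f g"
proof -
  have "(\<integral>\<^sup>+x\<in>Q. a * f x \<partial>\<mu>) = a * (\<integral>\<^sup>+x\<in>Q. f x \<partial>\<mu>)"
       "(\<integral>\<^sup>+x\<in>Q. b * g x \<partial>\<nu>) = b * (\<integral>\<^sup>+x\<in>Q. g x \<partial>\<nu>)" if "Q \<in> D" for Q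
    using assms that in_sets in_sets_nu
    by (auto simp: mult.assoc intro!: nn_integral_cmult)
  hence "dyadic_form D c \<mu> \<nu> (\<lambda>x. a * f x) (\<lambda>x. b * g x) =
     (\<Sum>\<^sub>\<infinity>Q\<in>D. (a * b) * (ennreal (c Q) * (\<integral>\<^sup>+x\<in>Q. f x \<partial>\<mu>) * (\<integral>\<^sup>+x\<in>Q. g x \<partial>\<nu>)))"
    unfolding dyadic_form_def by (intro infsum_cong) (simp add: ac_simps)
  thus ?thesis unfolding dyadic_form_def by (simp only: infsum_ennreal_cmult)
qed

lemma form_mono_sets: "S \<subseteq> D \<Longrightarrow> dyadic_form S c \<mu> \<nu> f g \<le> dyadic_form D c \<mu> \<nu> f g"
  unfolding dyadic_form_def by (rule infsum_ennreal_subset_mono)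

lemma form_le_form_norm:
  assumes f: "f \<in> borel_measurable \<mu>" and g: "g \<in> borel_measurable \<nu>" and pr: "0 < p" "0 < r"
    and "Lnorm p \<mu> f \<noteq> 0" "Lnorm p \<mu> f \<noteq> top" "Lnorm r \<nu> g \<noteq> 0" "Lnorm r \<nu> g \<noteq> top"
  shows "dyadic_form D c \<mu> \<nu> f g \<le> form_norm D c \<mu> \<nu> p r * (Lnorm p \<mu> f * Lnorm r \<nu> g)"
proof -
  let ?A = "Lnorm p \<mu> f" and ?B = "Lnorm r \<nu> g"
  have inv: "inverse ?A * ?A = 1" "inverse ?B * ?B = 1"
    using assms by (simp_all add: mult.commute[of "inverse _"] divide_ennreal_def[symmetric] less_top)
  have "dyadic_form D c \<mu> \<nu> (\<lambda>x. inverse ?A * f x) (\<lambda>x. inverse ?B * g x) \<le> form_norm D c \<mu> \<nu> p r"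
    unfolding form_norm_def
    using f g pr inv
    by (intro SUP_upper2[of "\<lambda>x. inverse ?A * f x"] SUP_upper2[of "\<lambda>x. inverse ?B * g x"])
      (auto simp: Lnorm_cmult)
  also have "dyadic_form D c \<mu> \<nu> (\<lambda>x. inverse ?A * f x) (\<lambda>x. inverse ?B * g x) =
      inverse ?A * inverse ?B * dyadic_form D c \<mu> \<nu> f g"
    by (rule form_cmult[OF f g])
  finally have "?A * ?B * (inverse ?A * inverse ?B * dyadic_form D c \<mu> \<nu> f g) \<le> ?A * ?B * form_norm D c \<mu> \<nu> p r"
    by (rule mult_left_mono) simp
  also have "?A * ?B * (inverse ?A * inverse ?B * dyadic_form D c \<mu> \<nu> f g) =
      (inverse ?A * ?A) * (inverse ?B * ?B) * dyadic_form D c \<mu> \<nu> f g"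
    by (simp only: ac_simps)
  finally show ?thesis unfolding inv by (simp add: ac_simps)
qed

lemma set_integral_finite:
  assumes f: "f \<in> borel_measurable \<mu>" and p: "1 < p" and "Lnorm p \<mu> f \<noteq> top" and Q: "Q \<in> D"
  shows "(\<integral>\<^sup>+x\<in>Q. f x \<partial>\<mu>) < top"
proof -
  define p' where "p' = p / (p - 1)"
  have p': "1 < p'" "1 / p + 1 / p' = 1" using p unfolding p'_def by (auto simp: field_simps)
  have "(\<integral>\<^sup>+x\<in>Q. f x \<partial>\<mu>) \<le> Lnorm p \<mu> f * Lnorm p' \<mu> (indicator Q)"
    using Q in_sets f p p' by (intro Hoelder_nn_integral) auto
  also have "\<dots> < top" using assms p' in_sets[OF Q] mu_finite[OF Q]
    by (simp add: Lnorm_indicator ennreal_mult_eq_top_iff less_top[symmetric])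
  finally show ?thesis .
qed

text \<open>
The extremal function for \<open>h\<close> is \<open>g = h\<^sup>q\<^sup>-\<^sup>1\<close>. Taking \<open>h\<close> to be a finite partial sum of the potential
makes \<open>h\<close> bounded and supported on a set of finite measure, so that \<open>\<integral> h\<^sup>q\<close> is finite and may be
cancelled; the whole potential follows by monotone convergence.
\<close>

lemma potential_le_form_norm:
  assumes f: "f \<in> borel_measurable \<mu>" and pq: "1 < p" "1 < q" "1 / q + 1 / r = 1"
    and fin: "Lnorm p \<mu> f \<noteq> top" and nz: "Lnorm p \<mu> f \<noteq> 0"
  shows "Lnorm q \<nu> (dyadic_potential D c \<mu> f) \<le> form_norm D c \<mu> \<nu> p r * Lnorm p \<mu> f"
  unfolding dyadic_potential_def
proof (rule Lnorm_infsum_le)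
  fix S assume S: "finite S" "S \<subseteq> D"
  have r: "1 < r" "r = q / (q - 1)"
    using conjugate_exponent_gt_1 conjugate_exponent_eq pq by blast+
  define h where "h = (\<lambda>x. \<Sum>Q\<in>S. ennreal (c Q) * (\<integral>\<^sup>+y\<in>Q. f y \<partial>\<mu>) * indicator Q x)"
  define B where "B = (\<Sum>Q\<in>S. ennreal (c Q) * (\<integral>\<^sup>+y\<in>Q. f y \<partial>\<mu>))"
  have B: "B < top" unfolding B_def
    using S set_integral_finite[OF f pq(1) fin] by (auto simp: ennreal_mult_less_top)
  have hm[measurable]: "h \<in> borel_measurable \<nu>"
    unfolding h_def using S in_sets_nu by (intro borel_measurable_sum) auto
  have US: "\<Union>S \<in> sets \<nu>" using S in_sets_nu by (intro sets.finite_Union) auto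
  have hB: "h x \<le> B * indicator (\<Union>S) x" for x
  proof (cases "x \<in> \<Union>S")
    case True
    have "h x \<le> B" unfolding h_def B_def
      by (intro sum_mono) (auto simp: indicator_def)
    with True show ?thesis by simp
  next
    case False
    hence "h x = 0" unfolding h_def by (intro sum.neutral) (auto simp: indicator_def)
    thus ?thesis by simp
  qed
  have "Lnorm q \<nu> h \<le> Lnorm q \<nu> (\<lambda>x. B * indicator (\<Union>S) x)"
    using pq hB by (intro Lnorm_mono) auto
  also have "\<dots> = B * ennreal_powr (emeasure \<nu> (\<Union>S)) (1 / q)"
    using pq US by (simp add: Lnorm_cmult Lnorm_indicator)
  also have "\<dots> < top"
  proof -
    have "emeasure \<nu> (\<Union>S) \<le> (\<Sum>Q\<in>S. emeasure \<nu> Q)"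
      using emeasure_subadditive_finite[OF S(1), of "\<lambda>Q. Q" \<nu>] S in_sets_nu by auto
    also have "\<dots> < top" using S nu_finite by auto
    finally show ?thesis using B by (simp add: ennreal_mult_eq_top_iff less_top[symmetric])
  qed
  finally have hfin: "Lnorm q \<nu> h \<noteq> top" by simp
  show "Lnorm q \<nu> (\<lambda>x. \<Sum>Q\<in>S. ennreal (c Q) * (\<integral>\<^sup>+y\<in>Q. f y \<partial>\<mu>) * indicator Q x) \<le>
        form_norm D c \<mu> \<nu> p r * Lnorm p \<mu> f"
  proof (cases "Lnorm q \<nu> h = 0")
    case False
    define g where "g x = ennreal_powr (h x) (q - 1)" for x
    have gm[measurable]: "g \<in> borel_measurable \<nu>" unfolding g_def by measurable
    let ?I = "\<integral>\<^sup>+x. ennreal_powr (h x) q \<partial>\<nu>"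
    have I: "?I \<noteq> 0" "?I \<noteq> top" using False hfin unfolding Lnorm_def by auto
    have gn: "Lnorm r \<nu> g = ennreal_powr ?I (1 / r)"
      unfolding Lnorm_def g_def using pq r by (simp add: ennreal_powr_powr)
    have gnz: "Lnorm r \<nu> g \<noteq> 0" "Lnorm r \<nu> g \<noteq> top" unfolding gn using I by simp_all
    have "?I = (\<integral>\<^sup>+x. h x * g x \<partial>\<nu>)"
    proof (rule nn_integral_cong)
      fix x show "ennreal_powr (h x) q = h x * g x"
        using ennreal_powr_add[of 1 "q - 1" "h x"] pq by (simp add: g_def)
    qed
    also have "\<dots> = dyadic_form S c \<mu> \<nu> f g"
    proof -
      interpret S: dyadic_pair S c \<mu> \<nu> by (rule restrict_family[OF S(2)])
      have "h = dyadic_potential S c \<mu> f"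
        unfolding h_def dyadic_potential_def using S by (auto simp: fun_eq_iff)
      thus ?thesis using S.nn_integral_potential_mult[OF gm] by simp
    qed
    also have "\<dots> \<le> dyadic_form D c \<mu> \<nu> f g" by (rule form_mono_sets[OF S(2)])
    also have "\<dots> \<le> form_norm D c \<mu> \<nu> p r * (Lnorm p \<mu> f * Lnorm r \<nu> g)"
      using pq r(1) f fin nz gnz by (intro form_le_form_norm) auto
    finally have "ennreal_powr ?I (1 / q) * ennreal_powr ?I (1 / r) \<le>
        form_norm D c \<mu> \<nu> p r * Lnorm p \<mu> f * ennreal_powr ?I (1 / r)"
      using pq(2,3) r(1) by (simp add: gn[symmetric] mult.assoc) (simp add: gn ennreal_powr_add)
    hence "ennreal_powr ?I (1 / q) \<le> form_norm D c \<mu> \<nu> p r * Lnorm p \<mu> f"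
      using I by (simp only: mult.commute[of _ "ennreal_powr ?I (1 / r)"] ennreal_mult_le_mult_iff
          ennreal_powr_eq_0_iff ennreal_powr_eq_top_iff not_False_eq_True)
    thus ?thesis unfolding h_def[symmetric] Lnorm_def .
  qed (simp add: h_def)
qed (use pq countable_D in_sets_nu in auto)

lemma potential_norm_eq_form_norm:
  assumes pq: "1 < p" "1 < q" "1 / q + 1 / r = 1"
  shows "potential_norm D c \<mu> \<nu> p q = form_norm D c \<mu> \<nu> p r"
proof (rule antisym)
  have r: "1 < r" using conjugate_exponent_gt_1 pq by blast
  show "form_norm D c \<mu> \<nu> p r \<le> potential_norm D c \<mu> \<nu> p q"
    unfolding potential_norm_def form_norm_def
  proof (intro Inf_greatest SUP_least, clarify)
    fix N and f g :: "'a \<Rightarrow> ennreal"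
    assume N: "\<forall>f\<in>borel_measurable \<mu>. Lnorm q \<nu> (dyadic_potential D c \<mu> f) \<le> N * Lnorm p \<mu> f"
      and f: "f \<in> borel_measurable \<mu>" "Lnorm p \<mu> f = 1" and g: "g \<in> borel_measurable \<nu>" "Lnorm r \<nu> g = 1"
    have "dyadic_form D c \<mu> \<nu> f g \<le> Lnorm q \<nu> (dyadic_potential D c \<mu> f) * Lnorm r \<nu> g"
      unfolding nn_integral_potential_mult[OF g(1), symmetric]
      using pq r g potential_measurable by (intro Hoelder_nn_integral) auto
    also have "\<dots> \<le> N" using N f g by auto
    finally show "dyadic_form D c \<mu> \<nu> f g \<le> N" .
  qed
  show "potential_norm D c \<mu> \<nu> p q \<le> form_norm D c \<mu> \<nu> p r"
  proof (rule dense_ge)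
    \<comment> \<open>For \<open>N\<close> strictly above the form norm, \<open>N > 0\<close> and functions of infinite norm satisfy the inequality
      because \<open>N \<cdot> \<infinity> = \<infinity>\<close>.\<close>
    fix N assume N: "form_norm D c \<mu> \<nu> p r < N"
    show "potential_norm D c \<mu> \<nu> p q \<le> N"
      unfolding potential_norm_def
    proof (intro Inf_lower CollectI ballI)
      fix f :: "'a \<Rightarrow> ennreal" assume f: "f \<in> borel_measurable \<mu>"
      consider "Lnorm p \<mu> f = 0" | "Lnorm p \<mu> f = top" | "Lnorm p \<mu> f \<noteq> 0" "Lnorm p \<mu> f \<noteq> top" by blast
      thus "Lnorm q \<nu> (dyadic_potential D c \<mu> f) \<le> N * Lnorm p \<mu> f"
      proof cases
        case 1
        have "(\<integral>\<^sup>+y\<in>Q. f y \<partial>\<mu>) = 0" if "Q \<in> D" for Q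
          using f in_sets[OF that] Lnorm_eq_0_imp_AE[OF f 1] by (subst nn_integral_0_iff_AE) auto
        hence "dyadic_potential D c \<mu> f x = 0" for x
          unfolding dyadic_potential_def by (intro infsum_0) auto
        thus ?thesis by (simp add: Lnorm_def)
      next
        case 2
        thus ?thesis using N by (auto simp: ennreal_mult_top)
      next
        case 3
        have "Lnorm q \<nu> (dyadic_potential D c \<mu> f) \<le> form_norm D c \<mu> \<nu> p r * Lnorm p \<mu> f"
          using potential_le_form_norm[OF f pq] 3 by simp
        also have "\<dots> \<le> N * Lnorm p \<mu> f" using N by (intro mult_right_mono) auto
        finally show ?thesis .
      qed
    qed
  qed
qed

text \<open>
Duality: both sides are the norm of the same bilinear form.
\<close>

lemma potential_norm_dual:
  assumes "1 < p" "1 < q" "1 / p + 1 / s = 1" "1 / q + 1 / r = 1"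
  shows "potential_norm D c \<nu> \<mu> r s = potential_norm D c \<mu> \<nu> p q"
proof -
  interpret sw: dyadic_pair D c \<nu> \<mu> by (rule swap)
  have rs: "1 < r" "1 < s" using conjugate_exponent_gt_1 assms by blast+
  show ?thesis
    using potential_norm_eq_form_norm[OF assms(1,2,4)]
      sw.potential_norm_eq_form_norm[OF rs, of p] assms form_norm_swap by (simp add: add.commute)
qed

text \<open>
The testing constant restricts the norm inequality to \<open>f = 1\<^sub>R\<close> and discards part of the
non-negative sum defining the potential.
\<close>

lemma testing_le_potential_norm:
  assumes "\<And>R. R \<in> D \<Longrightarrow> E R \<subseteq> D" "1 < p" "1 < q"
  shows "testing_const D E c \<mu> \<nu> p q \<le> potential_norm D c \<mu> \<nu> p q"
  unfolding testing_const_def potential_norm_def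
proof (intro SUP_least Inf_greatest, clarify)
  fix R N assume R: "R \<in> D" "emeasure \<mu> R \<noteq> 0"
    and N: "\<forall>f\<in>borel_measurable \<mu>. Lnorm q \<nu> (dyadic_potential D c \<mu> f) \<le> N * Lnorm p \<mu> f"
  have "Lnorm q \<nu> (dyadic_potential (E R) c \<mu> (indicator R)) \<le> Lnorm q \<nu> (dyadic_potential D c \<mu> (indicator R))"
    using assms R by (intro Lnorm_mono potential_mono_sets) auto
  also have "\<dots> \<le> N * Lnorm p \<mu> (indicator R)" using N in_sets[OF R(1)] by auto
  also have "\<dots> = N * ennreal_powr (emeasure \<mu> R) (1 / p)"
    using assms in_sets[OF R(1)] by (simp add: Lnorm_indicator)
  finally show "Lnorm q \<nu> (dyadic_potential (E R) c \<mu> (indicator R)) / ennreal_powr (emeasure \<mu> R) (1 / p) \<le> N"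
    using R mu_finite[OF R(1)] by (intro divide_le_posI_ennreal) (auto simp: mult.commute zero_less_iff_neq_zero)
qed

end

section \<open>Dyadic levels and the Carleson embedding\<close>

lemma sum_geometric_int_le:
  fixes s :: real and m :: int
  assumes "0 < s" "finite I" "\<And>k. k \<in> I \<Longrightarrow> k \<le> m"
  shows "(\<Sum>k\<in>I. 2 powr (s * of_int k)) \<le> 2 powr (s * of_int m) / (1 - 2 powr (- s))"
proof -
  let ?x = "2 powr (- s) :: real"
  have x: "0 < ?x" "?x < 1" using assms(1) by (auto simp: powr_less_one)
  have inj: "inj_on (\<lambda>k. nat (m - k)) I"
    using assms(3) by (intro inj_onI) (metis diff_ge_0_iff_ge diff_left_imp_eq eq_nat_nat_iff)
  have summand: "2 powr (s * of_int k) = 2 powr (s * of_int m) * ?x ^ nat (m - k)" if "k \<in> I" for k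
  proof -
    have "?x ^ nat (m - k) = 2 powr (- s * of_int (m - k))"
      using assms(3)[OF that] by (simp add: powr_realpow[symmetric] powr_powr)
    thus ?thesis by (simp add: powr_add[symmetric] algebra_simps)
  qed
  have "(\<Sum>k\<in>I. ?x ^ nat (m - k)) = (\<Sum>j\<in>(\<lambda>k. nat (m - k)) ` I. ?x ^ j)"
    using inj by (simp add: sum.reindex)
  also have "\<dots> \<le> (\<Sum>j. ?x ^ j)"
    using x assms(2) by (intro sum_le_suminf summable_geometric) auto
  also have "\<dots> = 1 / (1 - ?x)" using x by (intro suminf_geometric) auto
  finally have "2 powr (s * of_int m) * (\<Sum>k\<in>I. ?x ^ nat (m - k)) \<le> 2 powr (s * of_int m) * (1 / (1 - ?x))"
    by (rule mult_left_mono) simp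
  thus ?thesis using summand by (simp add: sum_distrib_left)
qed

definition level :: "real \<Rightarrow> int" where "level a = \<lfloor>log 2 a\<rfloor>"

lemma level_bounds:
  assumes "0 < a" shows "2 powr of_int (level a) \<le> a" "a < 2 powr (of_int (level a) + 1)"
proof -
  have "of_int (level a) \<le> log 2 a" "log 2 a < of_int (level a) + 1"
    unfolding level_def by linarith+
  thus "2 powr of_int (level a) \<le> a" "a < 2 powr (of_int (level a) + 1)"
    using assms by (simp_all add: le_log_iff log_less_iff)
qed

lemma level_mono: "0 < a \<Longrightarrow> a \<le> b \<Longrightarrow> level a \<le> level b"
  unfolding level_def by (intro floor_mono) simp

text \<open>
Up to a factor \<open>2\<close> for passing to half of the mass, the constant comes from summing \<open>a\<^sup>p\<^sup>-\<^sup>1\<close> over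
values \<open>a \<le> 2y\<close> on distinct dyadic levels: a geometric series of ratio \<open>2\<^sup>-\<^sup>(\<^sup>p\<^sup>-\<^sup>1\<^sup>)\<close>, with one factor \<open>2\<^sup>p\<^sup>-\<^sup>1\<close> for rounding \<open>a\<close> up to the next power of two and one
for the bound \<open>2y\<close> in place of \<open>y\<close>.
\<close>

definition carleson_factor :: "real \<Rightarrow> real" where
  "carleson_factor p = 2 * 4 powr (p - 1) / (1 - 2 powr (- (p - 1)))"

lemma carleson_factor_pos: "1 < p \<Longrightarrow> 0 < carleson_factor p"
  unfolding carleson_factor_def by (auto intro!: divide_pos_pos simp: powr_less_one)

lemma sum_distinct_levels_le:
  assumes p: "1 < p" and "finite G" and y: "0 \<le> y"
    and a: "\<And>F. F \<in> G \<Longrightarrow> 0 < a F \<and> a F \<le> 2 * y" and inj: "inj_on (\<lambda>F. level (a F)) G"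
  shows "(\<Sum>F\<in>G. 2 * a F powr (p - 1) * y) \<le> carleson_factor p * y powr p"
proof (cases "G = {}")
  case True
  thus ?thesis using carleson_factor_pos[OF p] by simp
next
  case False
  hence y0: "0 < y" using a by force
  let ?s = "p - 1" and ?m = "level (2 * y)"
  have "(\<Sum>F\<in>G. a F powr ?s) \<le> (\<Sum>F\<in>G. 2 powr ?s * 2 powr (?s * of_int (level (a F))))"
  proof (rule sum_mono)
    fix F assume "F \<in> G"
    hence "a F powr ?s \<le> (2 powr (of_int (level (a F)) + 1)) powr ?s"
      using a p level_bounds[of "a F"] by (intro powr_mono2) (auto simp: less_imp_le)
    thus "a F powr ?s \<le> 2 powr ?s * 2 powr (?s * of_int (level (a F)))"
      by (simp add: powr_powr powr_add[symmetric] algebra_simps)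
  qed
  also have "\<dots> = 2 powr ?s * (\<Sum>k\<in>(\<lambda>F. level (a F)) ` G. 2 powr (?s * of_int k))"
    using inj by (simp add: sum_distrib_left sum.reindex)
  also have "\<dots> \<le> 2 powr ?s * (2 powr (?s * of_int ?m) / (1 - 2 powr (- ?s)))"
    using assms by (intro mult_left_mono sum_geometric_int_le) (auto intro!: level_mono)
  also have "\<dots> \<le> 2 powr ?s * ((2 * y) powr ?s / (1 - 2 powr (- ?s)))"
  proof (intro mult_left_mono divide_right_mono)
    have "(2 powr of_int ?m) powr ?s \<le> (2 * y) powr ?s"
      using level_bounds[of "2 * y"] y0 p by (intro powr_mono2) auto
    thus "2 powr (?s * of_int ?m) \<le> (2 * y) powr ?s" by (simp add: powr_powr mult.commute)
    show "0 \<le> 1 - 2 powr (- ?s)" using p by (simp add: powr_le_one_le less_imp_le powr_less_one)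
  qed simp
  also have "\<dots> = 4 powr ?s / (1 - 2 powr (- ?s)) * y powr ?s"
  proof -
    have "2 powr ?s * (2 * y) powr ?s = 4 powr ?s * y powr ?s"
      using y0 by (simp add: powr_mult[symmetric])
    thus ?thesis by simp
  qed
  finally have *: "(\<Sum>F\<in>G. a F powr ?s) \<le> 4 powr ?s / (1 - 2 powr (- ?s)) * y powr ?s" .
  have "(\<Sum>F\<in>G. 2 * a F powr ?s * y) = 2 * y * (\<Sum>F\<in>G. a F powr ?s)"
    by (simp add: sum_distrib_left ac_simps)
  also have "\<dots> \<le> 2 * y * (4 powr ?s / (1 - 2 powr (- ?s)) * y powr ?s)"
    using * y by (intro mult_left_mono) auto
  also have "\<dots> = carleson_factor p * (y powr ?s * y powr 1)"
    unfolding carleson_factor_def using y0 by simp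
  also have "y powr ?s * y powr 1 = y powr p"
    by (subst powr_add[symmetric]) simp
  finally show ?thesis .
qed

text \<open>
At least half of the mass \<open>a\<^sub>F \<mu>(F)\<close> of \<open>f\<close> on \<open>F\<close> is carried by the points where \<open>f \<ge> a\<^sub>F / 2\<close>. Multiplying by
\<open>a\<^sub>F\<^sup>p\<^sup>-\<^sup>1\<close> and summing over \<open>F\<close> under the integral, only the \<open>F\<close> containing \<open>x\<close> with \<open>a\<^sub>F \<le> 2 f(x)\<close>
contribute at \<open>x\<close>; their levels are distinct, so the sum is at most a constant times \<open>f(x)\<^sup>p\<^sup>-\<^sup>1\<close>. This
avoids the maximal function.
\<close>

lemma carleson_embedding:
  assumes p: "1 < p" and fin: "finite \<F>"
    and f[measurable]: "f \<in> borel_measurable \<mu>" and f0: "\<And>x. 0 \<le> f x"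
    and sets: "\<And>F. F \<in> \<F> \<Longrightarrow> F \<in> sets \<mu> \<and> emeasure \<mu> F < top"
    and a0: "\<And>F. F \<in> \<F> \<Longrightarrow> 0 < a F"
    and avg: "\<And>F. F \<in> \<F> \<Longrightarrow> ennreal (a F * measure \<mu> F) \<le> (\<integral>\<^sup>+x\<in>F. ennreal (f x) \<partial>\<mu>)"
    and lev: "\<And>F G. F \<in> \<F> \<Longrightarrow> G \<in> \<F> \<Longrightarrow> F \<noteq> G \<Longrightarrow> F \<inter> G \<noteq> {} \<Longrightarrow> level (a F) \<noteq> level (a G)"
  shows "ennreal (\<Sum>F\<in>\<F>. a F powr p * measure \<mu> F) \<le>
         ennreal (carleson_factor p) * (\<integral>\<^sup>+x. ennreal (f x powr p) \<partial>\<mu>)"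
proof -
  let ?u = "\<lambda>F x. ennreal (2 * a F powr (p - 1) * f x) * indicator (F \<inter> {x. a F \<le> 2 * f x}) x"
  have half: "ennreal (a F powr p * measure \<mu> F) \<le> (\<integral>\<^sup>+x. ?u F x \<partial>\<mu>)" if F: "F \<in> \<F>" for F
  proof -
    have m[measurable]: "F \<in> sets \<mu>" using sets F by simp
    have em: "emeasure \<mu> F = ennreal (measure \<mu> F)"
      using sets[OF F] by (intro emeasure_eq_ennreal_measure) auto
    let ?X = "\<integral>\<^sup>+x. ennreal (f x) * indicator (F \<inter> {x. a F \<le> 2 * f x}) x \<partial>\<mu>"
    have "ennreal (a F * measure \<mu> F) \<le> (\<integral>\<^sup>+x\<in>F. ennreal (f x) \<partial>\<mu>)" by (rule avg[OF F])
    also have "\<dots> \<le> (\<integral>\<^sup>+x. ennreal (f x) * indicator (F \<inter> {x. a F \<le> 2 * f x}) x + ennreal (a F / 2) * indicator F x \<partial>\<mu>)"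
      using a0[OF F] by (intro nn_integral_mono) (auto simp: indicator_def intro!: ennreal_leI)
    also have "\<dots> = ?X + (\<integral>\<^sup>+x. ennreal (a F / 2) * indicator F x \<partial>\<mu>)"
      by (rule nn_integral_add) measurable
    also have "(\<integral>\<^sup>+x. ennreal (a F / 2) * indicator F x \<partial>\<mu>) = ennreal (a F / 2 * measure \<mu> F)"
      using a0[OF F] by (simp add: nn_integral_cmult em ennreal_mult[symmetric])
    finally have "ennreal (a F / 2 * measure \<mu> F) + ennreal (a F / 2 * measure \<mu> F) \<le> ennreal (a F / 2 * measure \<mu> F) + ?X"
      using a0[OF F] by (simp add: ennreal_plus[symmetric] add.commute del: ennreal_plus)
    hence "ennreal (a F / 2 * measure \<mu> F) \<le> ?X"
      by (simp add: ennreal_add_left_cancel_le)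
    hence "ennreal (2 * a F powr (p - 1)) * ennreal (a F / 2 * measure \<mu> F) \<le> ennreal (2 * a F powr (p - 1)) * ?X"
      by (rule mult_left_mono) simp
    also have "ennreal (2 * a F powr (p - 1)) * ennreal (a F / 2 * measure \<mu> F) = ennreal (a F powr p * measure \<mu> F)"
      using a0[OF F] by (simp add: ennreal_mult[symmetric] powr_diff)
    also have "ennreal (2 * a F powr (p - 1)) * ?X = (\<integral>\<^sup>+x. ?u F x \<partial>\<mu>)"
      using f0 by (subst nn_integral_cmult[symmetric]) (auto simp: ennreal_mult mult.assoc)
    finally show ?thesis .
  qed
  have "ennreal (\<Sum>F\<in>\<F>. a F powr p * measure \<mu> F) = (\<Sum>F\<in>\<F>. ennreal (a F powr p * measure \<mu> F))"
    by (rule sum_ennreal[symmetric]) simp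
  also have "\<dots> \<le> (\<Sum>F\<in>\<F>. \<integral>\<^sup>+x. ?u F x \<partial>\<mu>)" by (rule sum_mono) (rule half)
  also have "\<dots> = (\<integral>\<^sup>+x. (\<Sum>F\<in>\<F>. ?u F x) \<partial>\<mu>)"
  proof (rule nn_integral_sum[symmetric])
    fix F assume "F \<in> \<F>"
    hence [measurable]: "F \<in> sets \<mu>" using sets by simp
    show "?u F \<in> borel_measurable \<mu>" by measurable
  qed
  also have "\<dots> \<le> (\<integral>\<^sup>+x. ennreal (carleson_factor p) * ennreal (f x powr p) \<partial>\<mu>)"
  proof (rule nn_integral_mono)
    fix x
    let ?G = "{F\<in>\<F>. x \<in> F \<and> a F \<le> 2 * f x}"
    have "(\<Sum>F\<in>\<F>. ?u F x) = (\<Sum>F\<in>?G. ennreal (2 * a F powr (p - 1) * f x))"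
      using fin by (intro sum.mono_neutral_cong_right) (auto simp: indicator_def)
    also have "\<dots> = ennreal (\<Sum>F\<in>?G. 2 * a F powr (p - 1) * f x)"
      using f0 by (intro sum_ennreal) auto
    also have "\<dots> \<le> ennreal (carleson_factor p * f x powr p)"
    proof (intro ennreal_leI sum_distinct_levels_le p f0)
      show "inj_on (\<lambda>F. level (a F)) ?G"
      proof (rule inj_onI, rule ccontr)
        fix F G assume "F \<in> ?G" "G \<in> ?G" "level (a F) = level (a G)" "F \<noteq> G"
        thus False using lev[of F G] by auto
      qed
    qed (use fin a0 in auto)
    finally show "(\<Sum>F\<in>\<F>. ?u F x) \<le> ennreal (carleson_factor p) * ennreal (f x powr p)"
      using carleson_factor_pos[OF p] by (simp add: ennreal_mult)
  qed
  also have "\<dots> = ennreal (carleson_factor p) * (\<integral>\<^sup>+x. ennreal (f x powr p) \<partial>\<mu>)"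
    by (rule nn_integral_cmult) measurable
  finally show ?thesis .
qed

section \<open>Stopping sets\<close>

definition stopping_sets :: "'a set set \<Rightarrow> ('a set \<Rightarrow> int) \<Rightarrow> 'a set set" where
  "stopping_sets S l = {F\<in>S. \<forall>Q\<in>S. F \<subset> Q \<longrightarrow> l Q < l F}"

definition stopping_children :: "'a set set \<Rightarrow> 'a set \<Rightarrow> 'a set set" where
  "stopping_children \<F> F = {G\<in>\<F>. G \<subset> F \<and> (\<forall>H\<in>\<F>. H \<subset> F \<longrightarrow> \<not> G \<subset> H)}"

text \<open>
Among the sets of the family containing \<open>Q\<close>, take those of maximal level and of these a largest one:
all larger sets have a smaller level, so it is a stopping set, and no stopping set strictly inside
it contains \<open>Q\<close>, since the level of such a set would exceed the maximum.
\<close>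

lemma stopping_parent_exists:
  assumes fin: "finite S" and lam: "\<And>Q R. Q \<in> S \<Longrightarrow> R \<in> S \<Longrightarrow> Q \<inter> R = {} \<or> Q \<subseteq> R \<or> R \<subseteq> Q"
    and Q: "Q \<in> S" "Q \<noteq> {}"
  shows "\<exists>F\<in>stopping_sets S l. Q \<subseteq> F \<and> l Q \<le> l F \<and> (\<forall>G\<in>stopping_sets S l. Q \<subseteq> G \<longrightarrow> F \<subseteq> G)"
proof -
  define A where "A = {R\<in>S. Q \<subseteq> R}"
  define k where "k = Max (l ` A)"
  have A: "finite A" "Q \<in> A" using fin Q by (auto simp: A_def)
  have k: "l R \<le> k" if "R \<in> A" for R using A that by (auto simp: k_def)
  have "k \<in> l ` A" unfolding k_def using A by (intro Max_in) auto
  hence "finite {R\<in>A. l R = k}" "{R\<in>A. l R = k} \<noteq> {}" using A by auto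
  then obtain F where F: "F \<in> A" "l F = k" and max: "\<And>R. R \<in> A \<Longrightarrow> l R = k \<Longrightarrow> F \<subseteq> R \<Longrightarrow> R = F"
    using finite_has_maximal[of "{R\<in>A. l R = k}"] by blast
  have "l R < l F" if R: "R \<in> S" "F \<subset> R" for R
  proof -
    have "R \<in> A" using R F by (auto simp: A_def)
    thus ?thesis using k[of R] max[of R] R F by force
  qed
  hence "F \<in> stopping_sets S l" using F by (auto simp: stopping_sets_def A_def)
  moreover have "F \<subseteq> G" if G: "G \<in> stopping_sets S l" "Q \<subseteq> G" for G
  proof (rule ccontr)
    assume "\<not> F \<subseteq> G"
    moreover have "F \<inter> G \<noteq> {}" using F G Q by (auto simp: A_def)
    ultimately have "G \<subset> F" using lam[of F G] F G by (auto simp: A_def stopping_sets_def)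
    hence "l F < l G" using F G by (auto simp: A_def stopping_sets_def)
    moreover have "G \<in> A" using G by (auto simp: A_def stopping_sets_def)
    ultimately show False using k[of G] F by simp
  qed
  ultimately show ?thesis using F k[OF A(2)] by (auto simp: A_def)
qed

lemma stopping_child_exists:
  assumes "finite \<F>" "H \<in> \<F>" "H \<subset> F"
  shows "\<exists>G\<in>stopping_children \<F> F. H \<subseteq> G"
proof -
  let ?A = "{G\<in>\<F>. H \<subseteq> G \<and> G \<subset> F}"
  have "finite ?A" "?A \<noteq> {}" using assms by auto
  from finite_has_maximal[OF this]
  obtain G where G: "G \<in> ?A" and max: "\<forall>R\<in>?A. G \<subseteq> R \<longrightarrow> G = R" by (elim bexE)
  have "\<not> G \<subset> R" if "R \<in> \<F>" "R \<subset> F" for R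
    using max that G by blast
  thus ?thesis using G unfolding stopping_children_def by blast
qed

section \<open>The corona estimate\<close>

text \<open>
Each term is at most \<open>z\<^sup>\<alpha>\<^sup>+\<^sup>\<beta>\<close> with \<open>z = x\<^sub>i + y\<^sub>i\<close>, and \<open>\<alpha> + \<beta> \<ge> 1\<close> allows one to bound all but one power
of \<open>z\<close> by the corresponding power of the full sum.
\<close>

lemma sum_powr_mult_powr_le:
  fixes x y :: "'i \<Rightarrow> real"
  assumes "finite I" and x: "\<And>i. i \<in> I \<Longrightarrow> 0 \<le> x i" and y: "\<And>i. i \<in> I \<Longrightarrow> 0 \<le> y i"
    and ab: "0 < \<alpha>" "0 < \<beta>" "1 \<le> \<alpha> + \<beta>"
  shows "(\<Sum>i\<in>I. x i powr \<alpha> * y i powr \<beta>) \<le> (\<Sum>i\<in>I. x i + y i) powr (\<alpha> + \<beta>)"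
proof -
  let ?Z = "\<Sum>i\<in>I. x i + y i" and ?t = "\<alpha> + \<beta>"
  have Z0: "0 \<le> ?Z" using x y by (intro sum_nonneg) auto
  have "x i powr \<alpha> * y i powr \<beta> \<le> (x i + y i) * ?Z powr (?t - 1)" if i: "i \<in> I" for i
  proof (cases "x i + y i = 0")
    case True
    hence "x i = 0" using x[OF i] y[OF i] by simp
    thus ?thesis using x[OF i] y[OF i] by simp
  next
    case False
    hence z: "0 < x i + y i" using x[OF i] y[OF i] by simp
    have "x i + y i \<le> ?Z" using i assms(1) x y by (intro member_le_sum) (auto intro: add_nonneg_nonneg)
    have "x i powr \<alpha> * y i powr \<beta> \<le> (x i + y i) powr \<alpha> * (x i + y i) powr \<beta>"
      using x[OF i] y[OF i] ab by (intro mult_mono powr_mono2) auto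
    also have "\<dots> = (x i + y i) powr 1 * (x i + y i) powr (?t - 1)"
      by (simp only: powr_add[symmetric]) simp
    also have "\<dots> \<le> (x i + y i) * ?Z powr (?t - 1)"
      using z ab \<open>x i + y i \<le> ?Z\<close> by (auto intro!: mult_left_mono powr_mono2)
    finally show ?thesis .
  qed
  hence "(\<Sum>i\<in>I. x i powr \<alpha> * y i powr \<beta>) \<le> (\<Sum>i\<in>I. (x i + y i) * ?Z powr (?t - 1))"
    by (rule sum_mono)
  also have "\<dots> = ?Z * ?Z powr (?t - 1)" by (simp add: sum_distrib_right)
  also have "\<dots> = ?Z powr ?t" using Z0 by (cases "?Z = 0") (auto simp: powr_diff)
  finally show ?thesis .
qed

lemma stopping_children_disjoint:
  assumes lam: "\<And>Q R. Q \<in> \<F> \<Longrightarrow> R \<in> \<F> \<Longrightarrow> Q \<inter> R = {} \<or> Q \<subseteq> R \<or> R \<subseteq> Q"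
    and "G \<in> stopping_children \<F> F" "H \<in> stopping_children \<F> F" "x \<in> G" "x \<in> H"
  shows "G = H"
  using lam[of G H] assms(2-) unfolding stopping_children_def by blast

lemma stopping_child_unique_parent:
  assumes lam: "\<And>Q R. Q \<in> \<F> \<Longrightarrow> R \<in> \<F> \<Longrightarrow> Q \<inter> R = {} \<or> Q \<subseteq> R \<or> R \<subseteq> Q"
    and "F \<in> \<F>" "F' \<in> \<F>" "G \<in> stopping_children \<F> F" "G \<in> stopping_children \<F> F'" "G \<noteq> {}"
  shows "F = F'"
  using lam[of F F'] assms(2-) unfolding stopping_children_def by blast

definition corona_factor :: "real \<Rightarrow> real \<Rightarrow> real" where
  "corona_factor p r = 2 * (2 * carleson_factor p + 1) powr (1 / p + 1 / r)"

context dyadic_pair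
begin



lemma emeasure_mu: "Q \<in> D \<Longrightarrow> emeasure \<mu> Q = ennreal (measure \<mu> Q)"
  using mu_finite by (intro emeasure_eq_ennreal_measure) (simp add: less_top)

lemma emeasure_nu: "Q \<in> D \<Longrightarrow> emeasure \<nu> Q = ennreal (measure \<nu> Q)"
  using nu_finite by (intro emeasure_eq_ennreal_measure) (simp add: less_top)

text \<open>
Half of the sufficiency of local testing: the part of the form carried by the sets \<open>Q\<close> on which
\<open>\<mu>(Q) a\<^sub>Q\<^sup>p\<close> dominates \<open>\<nu>(Q) b\<^sub>Q\<^sup>r\<close>, where \<open>a\<^sub>Q\<close>, \<open>b\<^sub>Q\<close> are the averages of the normalised functions. The
stopping sets are chosen by the averages of \<open>f\<close> alone, and domination makes the averages of \<open>g\<close> on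
them summable as well.
\<close>

lemma corona_estimate:
  fixes f g :: "'a \<Rightarrow> real" and a b :: "'a set \<Rightarrow> real"
  assumes p: "1 < p" and pq: "p \<le> q" and qr: "1 / q + 1 / r = 1"
    and S: "finite S" "S \<subseteq> D"
    and f[measurable]: "f \<in> borel_measurable \<mu>" and f0: "\<And>x. 0 \<le> f x"
    and fp: "(\<integral>\<^sup>+x. ennreal (f x powr p) \<partial>\<mu>) \<le> 1"
    and g[measurable]: "g \<in> borel_measurable \<nu>" and g0: "\<And>x. 0 \<le> g x"
    and gr: "(\<integral>\<^sup>+x. ennreal (g x powr r) \<partial>\<nu>) \<le> 1"
    and mpos: "\<And>Q. Q \<in> S \<Longrightarrow> 0 < measure \<mu> Q"
    and a0: "\<And>Q. Q \<in> S \<Longrightarrow> 0 < a Q"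
    and a: "\<And>Q. Q \<in> S \<Longrightarrow> ennreal (a Q * measure \<mu> Q) = (\<integral>\<^sup>+x\<in>Q. ennreal (f x) \<partial>\<mu>)"
    and b0: "\<And>Q. Q \<in> S \<Longrightarrow> 0 \<le> b Q"
    and b: "\<And>Q. Q \<in> S \<Longrightarrow> ennreal (b Q * measure \<nu> Q) = (\<integral>\<^sup>+x\<in>Q. ennreal (g x) \<partial>\<nu>)"
    and dom: "\<And>Q. Q \<in> S \<Longrightarrow> b Q powr r * measure \<nu> Q \<le> a Q powr p * measure \<mu> Q"
    and L: "0 \<le> L"
    and test: "\<And>R. R \<in> S \<Longrightarrow>
      Lnorm q \<nu> (\<lambda>x. \<Sum>Q\<in>{Q\<in>S. Q \<subseteq> R}. ennreal (c Q * measure \<mu> Q) * indicator Q x)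
        \<le> ennreal (L * measure \<mu> R powr (1 / p))"
  shows "(\<Sum>Q\<in>S. c Q * (a Q * measure \<mu> Q) * (b Q * measure \<nu> Q)) \<le> corona_factor p r * L"
proof -
  have q: "1 < q" using p pq by simp
  have r: "1 < r" using conjugate_exponent_gt_1[OF q qr] .
  have exps: "1 \<le> 1 / p + 1 / r"
    using p pq qr by (smt (verit) frac_le)
  define l where "l Q = level (a Q)" for Q
  define \<F> where "\<F> = stopping_sets S l"
  have FS: "\<F> \<subseteq> S" unfolding \<F>_def stopping_sets_def by auto
  have finF: "finite \<F>" using FS S finite_subset by blast
  have lamS: "Q \<inter> R = {} \<or> Q \<subseteq> R \<or> R \<subseteq> Q" if "Q \<in> S" "R \<in> S" for Q R
    using that S laminar by blast
  have lamF: "Q \<inter> R = {} \<or> Q \<subseteq> R \<or> R \<subseteq> Q" if "Q \<in> \<F>" "R \<in> \<F>" for Q R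
    using that FS lamS by blast
  have ne: "Q \<noteq> {}" if "Q \<in> S" for Q using mpos[OF that] by auto
  have "\<forall>Q\<in>S. \<exists>F. F \<in> \<F> \<and> Q \<subseteq> F \<and> l Q \<le> l F \<and> (\<forall>G\<in>\<F>. Q \<subseteq> G \<longrightarrow> F \<subseteq> G)"
    unfolding \<F>_def using stopping_parent_exists[OF S(1) lamS _ ne] by blast
  then obtain \<pi> where \<pi>: "\<forall>Q\<in>S. \<pi> Q \<in> \<F> \<and> Q \<subseteq> \<pi> Q \<and> l Q \<le> l (\<pi> Q) \<and> (\<forall>G\<in>\<F>. Q \<subseteq> G \<longrightarrow> \<pi> Q \<subseteq> G)"
    by (rule bchoice[THEN exE])
  have aF: "a Q \<le> 2 * a (\<pi> Q)" if Q: "Q \<in> S" for Q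
  proof -
    have F: "\<pi> Q \<in> S" "l Q \<le> l (\<pi> Q)" using \<pi> Q FS by auto
    have "a Q \<le> 2 powr (of_int (l Q) + 1)" using level_bounds(2)[OF a0[OF Q]] by (simp add: l_def)
    also have "\<dots> \<le> 2 powr (of_int (l (\<pi> Q)) + 1)" using F by (intro powr_mono) auto
    also have "\<dots> = 2 * 2 powr (of_int (l (\<pi> Q)))" by (simp add: powr_add)
    also have "\<dots> \<le> 2 * a (\<pi> Q)" using level_bounds(1)[OF a0[OF F(1)]] by (simp add: l_def)
    finally show ?thesis .
  qed
  \<comment> \<open>The levels of nested stopping sets differ, so their \<open>p\<close>-energy is controlled by the norm of \<open>f\<close>.\<close>
  define X where "X = (\<Sum>F\<in>\<F>. a F powr p * measure \<mu> F)"
  have XK: "X \<le> carleson_factor p"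
  proof -
    have "ennreal X \<le> ennreal (carleson_factor p) * (\<integral>\<^sup>+x. ennreal (f x powr p) \<partial>\<mu>)"
      unfolding X_def
    proof (rule carleson_embedding[OF p finF f f0])
      fix F assume F: "F \<in> \<F>"
      with FS S show "F \<in> sets \<mu> \<and> emeasure \<mu> F < top" using in_sets mu_finite by blast
      show "0 < a F" using F FS a0 by blast
      show "ennreal (a F * measure \<mu> F) \<le> (\<integral>\<^sup>+x\<in>F. ennreal (f x) \<partial>\<mu>)" using F FS a by force
    next
      fix F G assume "F \<in> \<F>" "G \<in> \<F>" "F \<noteq> G" "F \<inter> G \<noteq> {}"
      with lamF[of F G] have "F \<subset> G \<or> G \<subset> F" "F \<in> stopping_sets S l" "G \<in> stopping_sets S l"
        by (auto simp: \<F>_def)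
      thus "level (a F) \<noteq> level (a G)" unfolding stopping_sets_def l_def by auto
    qed
    also have "\<dots> \<le> ennreal (carleson_factor p) * 1" by (intro mult_left_mono fp) simp
    finally show ?thesis using carleson_factor_pos[OF p] by (simp add: ennreal_le_iff)
  qed
  \<comment> \<open>The part of \<open>F\<close> outside all smaller stopping sets; these parts are pairwise disjoint.\<close>
  define E where "E F = F - \<Union>{G\<in>\<F>. G \<subset> F}" for F
  define ch where "ch F = stopping_children \<F> F" for F
  have chF: "ch F \<subseteq> \<F>" for F unfolding ch_def stopping_children_def by auto
  have finch: "finite (ch F)" for F using chF finF finite_subset by blast
  have Fsets[measurable]: "F \<in> sets \<nu>" if "F \<in> \<F>" for F using that FS S in_sets_nu by blast
  have Esets[measurable]: "E F \<in> sets \<nu>" if "F \<in> \<F>" for F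
    unfolding E_def using that finF by (intro sets.Diff sets.finite_Union) auto
  define e where "e F = enn2real (\<integral>\<^sup>+x\<in>E F. ennreal (g x powr r) \<partial>\<nu>)" for F
  have e0: "0 \<le> e F" for F by (simp add: e_def)
  have e: "ennreal (e F) = (\<integral>\<^sup>+x\<in>E F. ennreal (g x powr r) \<partial>\<nu>)" for F
  proof -
    have "(\<integral>\<^sup>+x\<in>E F. ennreal (g x powr r) \<partial>\<nu>) \<le> (\<integral>\<^sup>+x. ennreal (g x powr r) \<partial>\<nu>)"
      by (intro nn_integral_mono) (auto simp: indicator_def)
    also have "\<dots> < top" using gr by (rule le_less_trans) simp
    finally show ?thesis unfolding e_def by simp
  qed
  have sum_e: "(\<Sum>F\<in>\<F>. e F) \<le> 1"
  proof -
    have "ennreal (\<Sum>F\<in>\<F>. e F) = (\<Sum>F\<in>\<F>. \<integral>\<^sup>+x\<in>E F. ennreal (g x powr r) \<partial>\<nu>)"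
      using e0 by (simp add: sum_ennreal[symmetric] e)
    also have "\<dots> = (\<integral>\<^sup>+x. (\<Sum>F\<in>\<F>. ennreal (g x powr r) * indicator (E F) x) \<partial>\<nu>)"
      by (rule nn_integral_sum[symmetric]) simp
    also have "\<dots> \<le> (\<integral>\<^sup>+x. ennreal (g x powr r) \<partial>\<nu>)"
    proof (rule nn_integral_mono)
      fix x
      show "(\<Sum>F\<in>\<F>. ennreal (g x powr r) * indicator (E F) x) \<le> ennreal (g x powr r)"
      proof (cases "\<exists>F\<in>\<F>. x \<in> E F")
        case True
        then obtain F where F: "F \<in> \<F>" "x \<in> E F" by blast
        have "x \<notin> E G" if "G \<in> \<F>" "G \<noteq> F" for G
          using lamF[of F G] F that unfolding E_def by auto
        hence "(\<Sum>G\<in>\<F>. ennreal (g x powr r) * indicator (E G) x) = (\<Sum>G\<in>\<F>. if G = F then ennreal (g x powr r) else 0)"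
          using F by (intro sum.cong) auto
        also have "\<dots> = ennreal (g x powr r)" using F finF by simp
        finally show ?thesis by simp
      qed (auto simp: sum.neutral)
    qed
    also note gr
    finally have "ennreal (\<Sum>F\<in>\<F>. e F) \<le> ennreal 1" by simp
    thus ?thesis by (subst (asm) ennreal_le_iff) auto
  qed
  \<comment> \<open>\<open>Y F\<close> bounds the \<open>r\<close>-th power of the norm of the modification \<open>G F\<close> of \<open>g\<close> introduced below. Each stopping set is a child
    of at most one other, so domination on the children bounds the sum of all \<open>Y F\<close> by \<open>1 + X\<close>.\<close>
  define Y where "Y F = e F + (\<Sum>G\<in>ch F. b G powr r * measure \<nu> G)" for F
  have Y0: "0 \<le> Y F" for F unfolding Y_def using e0 by (auto intro!: add_nonneg_nonneg sum_nonneg)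
  have sum_Y: "(\<Sum>F\<in>\<F>. Y F) \<le> 1 + X"
  proof -
    have "(\<Sum>F\<in>\<F>. \<Sum>G\<in>ch F. b G powr r * measure \<nu> G) = (\<Sum>G\<in>(\<Union>F\<in>\<F>. ch F). b G powr r * measure \<nu> G)"
    proof (rule sum.UNION_disjoint[symmetric])
      show "\<forall>F\<in>\<F>. \<forall>F'\<in>\<F>. F \<noteq> F' \<longrightarrow> ch F \<inter> ch F' = {}"
      proof (intro ballI impI, rule ccontr)
        fix F F' assume "F \<in> \<F>" "F' \<in> \<F>" "F \<noteq> F'" "ch F \<inter> ch F' \<noteq> {}"
        then obtain G where "G \<in> ch F" "G \<in> ch F'" by blast
        moreover have "G \<noteq> {}" using \<open>G \<in> ch F\<close> chF FS ne by blast
        ultimately show False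
          using stopping_child_unique_parent[of \<F>, OF lamF] \<open>F \<in> \<F>\<close> \<open>F' \<in> \<F>\<close> \<open>F \<noteq> F'\<close> unfolding ch_def by blast
      qed
    qed (use finF finch in auto)
    also have "\<dots> \<le> (\<Sum>G\<in>\<F>. b G powr r * measure \<nu> G)"
      using chF finF by (intro sum_mono2) auto
    also have "\<dots> \<le> X" unfolding X_def using FS dom by (intro sum_mono) auto
    finally show ?thesis using sum_e by (simp add: Y_def sum.distrib)
  qed
  \<comment> \<open>On \<open>F\<close>, the function \<open>g\<close> with its values on each child of \<open>F\<close> replaced by their average.\<close>
  define G where "G F x = g x * indicator (E F) x + (\<Sum>H\<in>ch F. b H * indicator H x)" for F x
  have bch: "0 \<le> b H" if "H \<in> ch F" for H F using that chF FS b0 by blast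
  have G0: "0 \<le> G F x" for F x
    unfolding G_def using g0 bch by (auto intro!: add_nonneg_nonneg sum_nonneg simp: indicator_def)
  have Gm[measurable]: "G F \<in> borel_measurable \<nu>" if "F \<in> \<F>" for F
  proof -
    have [measurable]: "H \<in> sets \<nu>" if "H \<in> ch F" for H F using that chF Fsets by blast
    show ?thesis unfolding G_def using that by (intro borel_measurable_add borel_measurable_sum borel_measurable_times) auto
  qed
  have G_norm: "Lnorm r \<nu> (\<lambda>x. ennreal (G F x)) \<le> ennreal (Y F powr (1 / r))" if F: "F \<in> \<F>" for F
  proof -
    have [measurable]: "H \<in> sets \<nu>" if "H \<in> ch F" for H F using that chF Fsets by blast
    have pt: "ennreal (G F x powr r) \<le> ennreal (g x powr r) * indicator (E F) x + (\<Sum>H\<in>ch F. ennreal (b H powr r) * indicator H x)" for x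
    proof (cases "\<exists>H\<in>ch F. x \<in> H")
      case True
      then obtain H where H: "H \<in> ch F" "x \<in> H" by blast
      have "x \<notin> E F" using H unfolding E_def ch_def stopping_children_def by auto
      moreover have "(\<Sum>H'\<in>ch F. b H' * indicator H' x) = (\<Sum>H'\<in>ch F. if H' = H then b H else 0)"
      proof (rule sum.cong[OF refl])
        fix H' assume H': "H' \<in> ch F"
        have "x \<in> H' \<longleftrightarrow> H' = H"
          using stopping_children_disjoint[of \<F> H' F H x] lamF H H' unfolding ch_def by blast
        thus "b H' * indicator H' x = (if H' = H then b H else 0)" by (auto simp: indicator_def)
      qed
      ultimately have "G F x = b H" using H finch by (simp add: G_def)
      hence "ennreal (G F x powr r) = ennreal (b H powr r) * indicator H x" using H by simp
      also have "\<dots> \<le> (\<Sum>H\<in>ch F. ennreal (b H powr r) * indicator H x)"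
        using H finch by (intro member_le_sum) auto
      finally show ?thesis by (simp add: \<open>x \<notin> E F\<close>)
    next
      case False
      hence "(\<Sum>H\<in>ch F. b H * indicator H x) = 0" by (intro sum.neutral) auto
      hence "ennreal (G F x powr r) = ennreal (g x powr r) * indicator (E F) x"
        using r by (simp add: G_def indicator_def)
      thus ?thesis by simp
    qed
    have "(\<integral>\<^sup>+x. ennreal (G F x powr r) \<partial>\<nu>) \<le>
       (\<integral>\<^sup>+x. ennreal (g x powr r) * indicator (E F) x + (\<Sum>H\<in>ch F. ennreal (b H powr r) * indicator H x) \<partial>\<nu>)"
      by (intro nn_integral_mono pt)
    also have "\<dots> = ennreal (e F) + (\<Sum>H\<in>ch F. \<integral>\<^sup>+x. ennreal (b H powr r) * indicator H x \<partial>\<nu>)"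
      unfolding e using F by (subst nn_integral_add) (auto intro!: nn_integral_sum)
    also have "(\<Sum>H\<in>ch F. \<integral>\<^sup>+x. ennreal (b H powr r) * indicator H x \<partial>\<nu>) = (\<Sum>H\<in>ch F. ennreal (b H powr r * measure \<nu> H))"
    proof (rule sum.cong[OF refl])
      fix H assume H: "H \<in> ch F"
      hence "H \<in> D" using chF FS S by blast
      thus "(\<integral>\<^sup>+x. ennreal (b H powr r) * indicator H x \<partial>\<nu>) = ennreal (b H powr r * measure \<nu> H)"
        using in_sets_nu by (simp add: nn_integral_cmult emeasure_nu ennreal_mult)
    qed
    also have "ennreal (e F) + \<dots> = ennreal (Y F)"
      unfolding Y_def using e0 by (simp add: ennreal_plus sum_nonneg)
    finally show ?thesis
      using r G0 Y0 by (simp add: Lnorm_le_iff powr_powr)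
  qed
  \<comment> \<open>If \<open>F\<close> is the least stopping set containing \<open>Q\<close>, a child of \<open>F\<close> that meets \<open>Q\<close> is contained in \<open>Q\<close>;
    hence \<open>g\<close> and \<open>G F\<close> have the same mass on \<open>Q\<close>, of which one inequality is needed.\<close>
  have replace_g: "ennreal (b Q * measure \<nu> Q) \<le> (\<integral>\<^sup>+x. ennreal (G (\<pi> Q) x) * indicator Q x \<partial>\<nu>)" if Q: "Q \<in> S" for Q
  proof -
    let ?F = "\<pi> Q"
    have F: "?F \<in> \<F>" "Q \<subseteq> ?F" "\<And>H. H \<in> \<F> \<Longrightarrow> Q \<subseteq> H \<Longrightarrow> ?F \<subseteq> H" using \<pi> Q by auto
    have Qs[measurable]: "Q \<in> sets \<nu>" using Q S in_sets_nu by blast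
    have chm[measurable]: "H \<in> sets \<nu>" if "H \<in> ch ?F" for H using that chF Fsets by blast
    have Esm[measurable]: "E ?F \<in> sets \<nu>" using F by auto
    let ?C = "{H\<in>ch ?F. H \<subseteq> Q}"
    have pt: "ennreal (g x) * indicator Q x \<le> ennreal (g x) * indicator (E ?F \<inter> Q) x + (\<Sum>H\<in>?C. ennreal (g x) * indicator H x)" for x
    proof (cases "x \<in> Q \<and> x \<notin> E ?F")
      case True
      then obtain H' where "H' \<in> \<F>" "H' \<subset> ?F" "x \<in> H'" using F unfolding E_def by blast
      then obtain H where H: "H \<in> ch ?F" "x \<in> H"
        using stopping_child_exists[OF finF, of H' ?F] unfolding ch_def by blast
      have "H \<in> \<F>" "H \<subset> ?F" using H unfolding ch_def stopping_children_def by auto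
      have "H \<subseteq> Q"
        using lamS[of H Q] \<open>H \<in> \<F>\<close> FS Q H(2) True F(3)[of H] \<open>H \<subset> ?F\<close> by blast
      hence "ennreal (g x) * indicator H x \<le> (\<Sum>H\<in>?C. ennreal (g x) * indicator H x)"
        using H finch by (intro member_le_sum) auto
      thus ?thesis using True H by simp
    qed (auto simp: indicator_def)
    have avg: "(\<integral>\<^sup>+x. ennreal (g x) * indicator H x \<partial>\<nu>) = (\<integral>\<^sup>+x. ennreal (b H) * indicator H x \<partial>\<nu>)" if H: "H \<in> ch ?F" for H
    proof -
      have "H \<in> S" "H \<in> D" using H chF FS S by blast+
      thus ?thesis using b[of H] b0[of H] chm[OF H] by (simp add: nn_integral_cmult emeasure_nu ennreal_mult)
    qed
    have "ennreal (b Q * measure \<nu> Q) \<le> (\<integral>\<^sup>+x. ennreal (g x) * indicator (E ?F \<inter> Q) x + (\<Sum>H\<in>?C. ennreal (g x) * indicator H x) \<partial>\<nu>)"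
      unfolding b[OF Q] by (intro nn_integral_mono pt)
    also have "\<dots> = (\<integral>\<^sup>+x. ennreal (g x) * indicator (E ?F \<inter> Q) x \<partial>\<nu>) + (\<Sum>H\<in>?C. \<integral>\<^sup>+x. ennreal (g x) * indicator H x \<partial>\<nu>)"
      using chm by (subst nn_integral_add) (auto intro!: nn_integral_sum)
    also have "\<dots> = (\<integral>\<^sup>+x. ennreal (g x) * indicator (E ?F \<inter> Q) x \<partial>\<nu>) + (\<Sum>H\<in>?C. \<integral>\<^sup>+x. ennreal (b H) * indicator H x \<partial>\<nu>)"
      using avg by simp
    also have "\<dots> = (\<integral>\<^sup>+x. ennreal (g x) * indicator (E ?F \<inter> Q) x + (\<Sum>H\<in>?C. ennreal (b H) * indicator H x) \<partial>\<nu>)"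
      using chm by (subst nn_integral_add) (auto intro!: nn_integral_sum[symmetric])
    also have "\<dots> \<le> (\<integral>\<^sup>+x. ennreal (G ?F x) * indicator Q x \<partial>\<nu>)"
    proof (rule nn_integral_mono)
      fix x
      have "ennreal (g x) * indicator (E ?F \<inter> Q) x + (\<Sum>H\<in>?C. ennreal (b H) * indicator H x) =
         ennreal (g x * indicator (E ?F \<inter> Q) x + (\<Sum>H\<in>?C. b H * indicator H x))"
      proof -
        have "(\<Sum>H\<in>?C. ennreal (b H) * indicator H x) = (\<Sum>H\<in>?C. ennreal (b H * indicator H x))"
          by (intro sum.cong) (auto simp: indicator_def)
        also have "\<dots> = ennreal (\<Sum>H\<in>?C. b H * indicator H x)"
          using bch by (intro sum_ennreal) auto
        finally have "(\<Sum>H\<in>?C. ennreal (b H) * indicator H x) = ennreal (\<Sum>H\<in>?C. b H * indicator H x)" .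
        moreover have "0 \<le> (\<Sum>H\<in>?C. b H * indicator H x)" using bch by (intro sum_nonneg) auto
        moreover have "ennreal (g x) * indicator (E ?F \<inter> Q) x = ennreal (g x * indicator (E ?F \<inter> Q) x)"
          by (auto simp: indicator_def)
        ultimately show ?thesis using g0[of x] by (simp add: ennreal_plus)
      qed
      also have "\<dots> \<le> ennreal (G ?F x * indicator Q x)"
      proof (rule ennreal_leI, cases "x \<in> Q")
        case True
        have "(\<Sum>H\<in>?C. b H * indicator H x) \<le> (\<Sum>H\<in>ch ?F. b H * indicator H x)"
          using finch bch by (intro sum_mono2) auto
        thus "g x * indicator (E ?F \<inter> Q) x + (\<Sum>H\<in>?C. b H * indicator H x) \<le> G ?F x * indicator Q x"
          using True unfolding G_def by (simp add: indicator_def)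
      next
        case False
        hence "(\<Sum>H\<in>?C. b H * indicator H x) = 0" by (intro sum.neutral) (auto simp: indicator_def)
        thus "g x * indicator (E ?F \<inter> Q) x + (\<Sum>H\<in>?C. b H * indicator H x) \<le> G ?F x * indicator Q x"
          using False by simp
      qed
      finally show "ennreal (g x) * indicator (E ?F \<inter> Q) x + (\<Sum>H\<in>?C. ennreal (b H) * indicator H x)
          \<le> ennreal (G ?F x) * indicator Q x"
        by (cases "x \<in> Q") simp_all
    qed
    finally show ?thesis .
  qed
  \<comment> \<open>Hoelder's inequality and the testing condition on \<open>F\<close>, for the sets grouped with \<open>F\<close>.\<close>
  have stopping_estimate: "(\<Sum>Q\<in>{Q\<in>S. \<pi> Q = F}. c Q * measure \<mu> Q * (b Q * measure \<nu> Q)) \<le>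
      L * measure \<mu> F powr (1 / p) * Y F powr (1 / r)" if F: "F \<in> \<F>" for F
  proof -
    let ?S = "{Q\<in>S. \<pi> Q = F}"
    let ?T = "\<lambda>x. \<Sum>Q\<in>?S. ennreal (c Q * measure \<mu> Q) * indicator Q x"
    have finS: "finite ?S" using S by simp
    have cm: "0 \<le> c Q * measure \<mu> Q" if "Q \<in> S" for Q using that S c_nonneg by (intro mult_nonneg_nonneg) auto
    have Qs: "Q \<in> sets \<nu>" if "Q \<in> S" for Q using that S in_sets_nu by blast
    have Tm: "?T \<in> borel_measurable \<nu>"
      using Qs by (intro borel_measurable_sum borel_measurable_times_ennreal) auto
    have "ennreal (\<Sum>Q\<in>?S. c Q * measure \<mu> Q * (b Q * measure \<nu> Q)) =
        (\<Sum>Q\<in>?S. ennreal (c Q * measure \<mu> Q) * ennreal (b Q * measure \<nu> Q))"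
      using cm b0 by (subst sum_ennreal[symmetric]) (auto simp: ennreal_mult)
    also have "\<dots> \<le> (\<Sum>Q\<in>?S. ennreal (c Q * measure \<mu> Q) * (\<integral>\<^sup>+x. ennreal (G F x) * indicator Q x \<partial>\<nu>))"
      using replace_g by (intro sum_mono mult_left_mono) auto
    also have "\<dots> = (\<Sum>Q\<in>?S. \<integral>\<^sup>+x. ennreal (c Q * measure \<mu> Q) * (ennreal (G F x) * indicator Q x) \<partial>\<nu>)"
      using Qs Gm[OF F] by (intro sum.cong refl nn_integral_cmult[symmetric]) auto
    also have "\<dots> = (\<integral>\<^sup>+x. (\<Sum>Q\<in>?S. ennreal (c Q * measure \<mu> Q) * (ennreal (G F x) * indicator Q x)) \<partial>\<nu>)"
      using Qs Gm[OF F] by (intro nn_integral_sum[symmetric]) auto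
    also have "\<dots> = (\<integral>\<^sup>+x. ?T x * ennreal (G F x) \<partial>\<nu>)"
      by (intro nn_integral_cong) (simp add: sum_distrib_left ac_simps)
    also have "\<dots> \<le> Lnorm q \<nu> ?T * Lnorm r \<nu> (\<lambda>x. ennreal (G F x))"
      using Gm[OF F] Tm by (intro Hoelder_nn_integral q r qr) auto
    also have "Lnorm q \<nu> ?T \<le> ennreal (L * measure \<mu> F powr (1 / p))"
    proof -
      have "Lnorm q \<nu> ?T \<le> Lnorm q \<nu> (\<lambda>x. \<Sum>Q\<in>{Q\<in>S. Q \<subseteq> F}. ennreal (c Q * measure \<mu> Q) * indicator Q x)"
        using q S \<pi> by (intro Lnorm_mono sum_mono2) auto
      also have "\<dots> \<le> ennreal (L * measure \<mu> F powr (1 / p))" using test F FS by blast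
      finally show ?thesis .
    qed
    also have "Lnorm r \<nu> (\<lambda>x. ennreal (G F x)) \<le> ennreal (Y F powr (1 / r))" by (rule G_norm[OF F])
    finally have "ennreal (\<Sum>Q\<in>?S. c Q * measure \<mu> Q * (b Q * measure \<nu> Q)) \<le>
        ennreal (L * measure \<mu> F powr (1 / p) * Y F powr (1 / r))"
      using L by (simp add: ennreal_mult mult_right_mono mult_left_mono)
    thus ?thesis using L by (subst (asm) ennreal_le_iff) auto
  qed
  have "(\<Sum>Q\<in>S. c Q * (a Q * measure \<mu> Q) * (b Q * measure \<nu> Q)) =
      (\<Sum>F\<in>\<F>. \<Sum>Q\<in>{Q\<in>S. \<pi> Q = F}. c Q * (a Q * measure \<mu> Q) * (b Q * measure \<nu> Q))"
    using \<pi> S finF by (intro sum.group[symmetric]) auto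
  also have "\<dots> \<le> (\<Sum>F\<in>\<F>. 2 * L * ((a F powr p * measure \<mu> F) powr (1 / p) * Y F powr (1 / r)))"
  proof (rule sum_mono)
    fix F assume F: "F \<in> \<F>"
    hence aF0: "0 < a F" using FS a0 by blast
    have "(\<Sum>Q\<in>{Q\<in>S. \<pi> Q = F}. c Q * (a Q * measure \<mu> Q) * (b Q * measure \<nu> Q)) \<le>
        (\<Sum>Q\<in>{Q\<in>S. \<pi> Q = F}. 2 * a F * (c Q * measure \<mu> Q * (b Q * measure \<nu> Q)))"
    proof (rule sum_mono)
      fix Q assume Q: "Q \<in> {Q\<in>S. \<pi> Q = F}"
      hence "0 \<le> c Q * measure \<mu> Q * (b Q * measure \<nu> Q)"
        using S c_nonneg b0 by (intro mult_nonneg_nonneg) auto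
      hence "a Q * (c Q * measure \<mu> Q * (b Q * measure \<nu> Q)) \<le> 2 * a F * (c Q * measure \<mu> Q * (b Q * measure \<nu> Q))"
        using aF[of Q] Q by (intro mult_right_mono) auto
      thus "c Q * (a Q * measure \<mu> Q) * (b Q * measure \<nu> Q) \<le> 2 * a F * (c Q * measure \<mu> Q * (b Q * measure \<nu> Q))"
        by (simp add: ac_simps)
    qed
    also have "\<dots> = 2 * a F * (\<Sum>Q\<in>{Q\<in>S. \<pi> Q = F}. c Q * measure \<mu> Q * (b Q * measure \<nu> Q))"
      by (rule sum_distrib_left[symmetric])
    also have "\<dots> \<le> 2 * a F * (L * measure \<mu> F powr (1 / p) * Y F powr (1 / r))"
      using aF0 stopping_estimate[OF F] by (intro mult_left_mono) auto
    also have "\<dots> = 2 * L * ((a F powr p * measure \<mu> F) powr (1 / p) * Y F powr (1 / r))"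
      using aF0 p by (simp add: powr_mult powr_powr)
    finally show "(\<Sum>Q\<in>{Q\<in>S. \<pi> Q = F}. c Q * (a Q * measure \<mu> Q) * (b Q * measure \<nu> Q)) \<le>
       2 * L * ((a F powr p * measure \<mu> F) powr (1 / p) * Y F powr (1 / r))" .
  qed
  also have "\<dots> = 2 * L * (\<Sum>F\<in>\<F>. (a F powr p * measure \<mu> F) powr (1 / p) * Y F powr (1 / r))"
    by (rule sum_distrib_left[symmetric])
  also have "\<dots> \<le> 2 * L * (\<Sum>F\<in>\<F>. a F powr p * measure \<mu> F + Y F) powr (1 / p + 1 / r)"
    using L finF Y0 p r exps by (intro mult_left_mono sum_powr_mult_powr_le) auto
  also have "\<dots> \<le> 2 * L * (2 * carleson_factor p + 1) powr (1 / p + 1 / r)"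
  proof (intro mult_left_mono powr_mono2)
    show "(\<Sum>F\<in>\<F>. a F powr p * measure \<mu> F + Y F) \<le> 2 * carleson_factor p + 1"
      using XK sum_Y unfolding X_def by (simp add: sum.distrib)
    show "0 \<le> (\<Sum>F\<in>\<F>. a F powr p * measure \<mu> F + Y F)" using Y0 by (intro sum_nonneg) auto
  qed (use L p r in auto)
  finally show ?thesis by (simp add: corona_factor_def ac_simps)
qed

end

text \<open>
Passing to strictly positive real bounds \<open>L\<close> avoids the products \<open>0 \<cdot> \<infinity>\<close> that arise when \<open>G\<close> is \<open>0\<close>
or infinite.
\<close>

lemma ennreal_le_cmult_of_bounds:
  fixes X G :: ennreal
  assumes K: "0 < K" and bound: "\<And>L. 0 < L \<Longrightarrow> G \<le> ennreal L \<Longrightarrow> X \<le> ennreal (K * L)"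
  shows "X \<le> ennreal K * G"
proof (cases G)
  case (real g)
  show ?thesis
  proof (rule ennreal_le_epsilon)
    fix e :: real assume e: "0 < e"
    have "X \<le> ennreal (K * (g + e / K))"
      using real e K by (intro bound ennreal_leI) (auto intro: add_nonneg_pos)
    also have "K * (g + e / K) = K * g + e" using K by (simp add: field_simps)
    finally show "X \<le> ennreal K * G + ennreal e"
      using real e K by (simp add: ennreal_mult ennreal_plus)
  qed
qed (use K in \<open>simp add: ennreal_mult_top\<close>)

section \<open>Sufficiency of local testing\<close>

abbreviation cubes_inside :: "'a set set \<Rightarrow> 'a set \<Rightarrow> 'a set set" where
  "cubes_inside D R \<equiv> {Q\<in>D. Q \<subseteq> R}"

abbreviation cubes_containing :: "'a set set \<Rightarrow> 'a set \<Rightarrow> 'a set set" where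
  "cubes_containing D R \<equiv> {Q\<in>D. R \<subseteq> Q}"

text \<open>
The sum of the geometric series over the levels; the factor \<open>2\<close> is the ratio of two powers of two
enclosing the measures on one level.
\<close>

definition global_to_local_factor :: "real \<Rightarrow> real \<Rightarrow> real" where
  "global_to_local_factor p q = 2 / (1 - 2 powr (- (1 / p - 1 / q)))"

lemma global_to_local_factor_pos: "1 < p \<Longrightarrow> p < q \<Longrightarrow> 0 < global_to_local_factor p q"
  unfolding global_to_local_factor_def
  by (intro divide_pos_pos) (auto simp: powr_less_one frac_less2)

context dyadic_pair
begin

lemma testing_bound:
  assumes "testing_const D E c \<mu> \<nu> p q \<le> ennreal L" "R \<in> D" "0 < measure \<mu> R" "0 \<le> L"
  shows "Lnorm q \<nu> (dyadic_potential (E R) c \<mu> (indicator R)) \<le> ennreal (L * measure \<mu> R powr (1 / p))"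
proof -
  let ?N = "Lnorm q \<nu> (dyadic_potential (E R) c \<mu> (indicator R))" and ?m = "ennreal_powr (emeasure \<mu> R) (1 / p)"
  have R: "emeasure \<mu> R \<noteq> 0" "emeasure \<mu> R \<noteq> top" using assms emeasure_mu[OF assms(2)] by auto
  have "?N / ?m \<le> testing_const D E c \<mu> \<nu> p q"
    unfolding testing_const_def using assms R by (intro SUP_upper) auto
  hence "?N / ?m \<le> ennreal L" using assms by simp
  hence "?N / ?m * ?m \<le> ennreal L * ?m" by (rule mult_right_mono) simp
  moreover have "?N / ?m * ?m = ?N"
  proof -
    have "?m / ?m = 1" using R by (intro ennreal_divide_self) (simp_all add: less_top[symmetric])
    thus ?thesis by (simp add: ennreal_divide_times)
  qed
  ultimately show ?thesis using assms emeasure_mu[OF assms(2)] by (simp add: ennreal_mult)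
qed

lemma potential_ge_finite_sum:
  assumes "finite S" "S \<subseteq> D'" "\<And>Q. Q \<in> S \<Longrightarrow> 0 \<le> c Q \<and> ennreal (c Q * w Q) \<le> ennreal (c Q) * (\<integral>\<^sup>+y\<in>Q. f y \<partial>\<mu>)"
  shows "(\<Sum>Q\<in>S. ennreal (c Q * w Q) * indicator Q x) \<le> dyadic_potential D' c \<mu> f x"
proof -
  have "(\<Sum>Q\<in>S. ennreal (c Q * w Q) * indicator Q x) \<le>
      (\<Sum>Q\<in>S. ennreal (c Q) * (\<integral>\<^sup>+y\<in>Q. f y \<partial>\<mu>) * indicator Q x)"
    using assms by (intro sum_mono mult_right_mono) auto
  also have "\<dots> = (\<Sum>\<^sub>\<infinity>Q\<in>S. ennreal (c Q) * (\<integral>\<^sup>+y\<in>Q. f y \<partial>\<mu>) * indicator Q x)"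
    using assms by simp
  also have "\<dots> \<le> dyadic_potential D' c \<mu> f x"
    unfolding dyadic_potential_def by (rule infsum_ennreal_subset_mono[OF assms(2)])
  finally show ?thesis .
qed

lemma integral_indicator_inter:
  assumes "Q \<in> D" "R \<in> D" shows "(\<integral>\<^sup>+y\<in>Q. indicator R y \<partial>\<mu>) = emeasure \<mu> (Q \<inter> R)"
  using assms in_sets by (simp add: indicator_inter_arith[symmetric] Int_commute sets.Int)

lemma local_testing_finite:
  assumes "testing_const D (cubes_inside D) c \<mu> \<nu> p q \<le> ennreal L" "R \<in> D" "0 < measure \<mu> R" "0 \<le> L"
    and S: "finite S" "S \<subseteq> D" and "0 < q"
  shows "Lnorm q \<nu> (\<lambda>x. \<Sum>Q\<in>{Q\<in>S. Q \<subseteq> R}. ennreal (c Q * measure \<mu> Q) * indicator Q x)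
     \<le> ennreal (L * measure \<mu> R powr (1 / p))"
proof -
  have "Lnorm q \<nu> (\<lambda>x. \<Sum>Q\<in>{Q\<in>S. Q \<subseteq> R}. ennreal (c Q * measure \<mu> Q) * indicator Q x) \<le>
     Lnorm q \<nu> (dyadic_potential (cubes_inside D R) c \<mu> (indicator R))"
  proof (intro Lnorm_mono potential_ge_finite_sum)
    fix Q assume "Q \<in> {Q\<in>S. Q \<subseteq> R}"
    hence Q: "Q \<in> D" "Q \<inter> R = Q" using S by auto
    thus "0 \<le> c Q \<and> ennreal (c Q * measure \<mu> Q) \<le> ennreal (c Q) * (\<integral>\<^sup>+y\<in>Q. indicator R y \<partial>\<mu>)"
      using assms c_nonneg by (simp add: integral_indicator_inter emeasure_mu ennreal_mult)
  qed (use assms in auto)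
  also have "\<dots> \<le> ennreal (L * measure \<mu> R powr (1 / p))"
    by (rule testing_bound[OF assms(1-4)])
  finally show ?thesis .
qed

text \<open>
Split a finite part of the family by which of \<open>\<mu>(Q) a\<^sub>Q\<^sup>p\<close> and \<open>\<nu>(Q) b\<^sub>Q\<^sup>r\<close> dominates. The first part is
\<open>corona_estimate\<close>; the second is its dual, with the measures exchanged and \<open>(p,q)\<close> replaced by
\<open>(r,s) = (q',p')\<close>. Sets on which \<open>f\<close> or \<open>g\<close> has no mass contribute nothing and are dropped first, which
makes all remaining measures and averages positive.
\<close>

lemma form_norm_le_testing:
  assumes p: "1 < p" and pq: "p \<le> q" and ps: "1 / p + 1 / s = 1" and qr: "1 / q + 1 / r = 1"
    and L: "0 < L"
    and t1: "testing_const D (cubes_inside D) c \<mu> \<nu> p q \<le> ennreal L"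
    and t2: "testing_const D (cubes_inside D) c \<nu> \<mu> r s \<le> ennreal L"
  shows "form_norm D c \<mu> \<nu> p r \<le> ennreal ((corona_factor p r + corona_factor r p) * L)"
  unfolding form_norm_def
proof (intro SUP_least, clarify)
  interpret sw: dyadic_pair D c \<nu> \<mu> by (rule swap)
  fix f0 g0 :: "'a \<Rightarrow> ennreal"
  assume f0: "f0 \<in> borel_measurable \<mu>" "Lnorm p \<mu> f0 = 1" and g0: "g0 \<in> borel_measurable \<nu>" "Lnorm r \<nu> g0 = 1"
  have q: "1 < q" using p pq by simp
  have r: "1 < r" and s: "1 < s" using conjugate_exponent_gt_1 p q ps qr by blast+
  have rs: "r \<le> s"
  proof -
    have "1 / q \<le> 1 / p" using p pq by (simp add: frac_le)
    hence "1 / s \<le> 1 / r" using ps qr by linarith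
    thus ?thesis using r s by (simp add: field_simps)
  qed
  \<comment> \<open>Functions of finite norm are finite almost everywhere, so they may be taken real-valued.\<close>
  define f where "f x = enn2real (f0 x)" for x
  define g where "g x = enn2real (g0 x)" for x
  have AE_fin: "AE x in M. h x = ennreal (enn2real (h x))"
    if "h \<in> borel_measurable M" "Lnorm t M h = 1" "0 < t" for h :: "'a \<Rightarrow> ennreal" and M t
  proof -
    have "(\<integral>\<^sup>+x. ennreal_powr (h x) t \<partial>M) \<noteq> \<infinity>"
      using Lnorm_powr[of t M h] that by auto
    hence "AE x in M. ennreal_powr (h x) t \<noteq> \<infinity>"
      using that by (intro nn_integral_noteq_infinite) auto
    thus ?thesis by eventually_elim (simp add: less_top)
  qed
  have AEf: "AE x in \<mu>. f0 x = ennreal (f x)" unfolding f_def using AE_fin[OF f0] p by simp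
  have AEg: "AE x in \<nu>. g0 x = ennreal (g x)" unfolding g_def using AE_fin[OF g0] r by simp
  have fm: "f \<in> borel_measurable \<mu>" unfolding f_def using f0 by simp
  have gm: "g \<in> borel_measurable \<nu>" unfolding g_def using g0 by simp
  have f_pos: "0 \<le> f x" for x by (simp add: f_def)
  have g_pos: "0 \<le> g x" for x by (simp add: g_def)
  have "(\<integral>\<^sup>+x. ennreal (f x powr p) \<partial>\<mu>) = (\<integral>\<^sup>+x. ennreal_powr (f0 x) p \<partial>\<mu>)"
    using AEf by (intro nn_integral_cong_AE) (auto simp: f_pos elim!: eventually_mono)
  hence fp: "(\<integral>\<^sup>+x. ennreal (f x powr p) \<partial>\<mu>) \<le> 1"
    using Lnorm_powr[of p \<mu> f0] p f0 by simp
  have "(\<integral>\<^sup>+x. ennreal (g x powr r) \<partial>\<nu>) = (\<integral>\<^sup>+x. ennreal_powr (g0 x) r \<partial>\<nu>)"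
    using AEg by (intro nn_integral_cong_AE) (auto simp: g_pos elim!: eventually_mono)
  hence gr: "(\<integral>\<^sup>+x. ennreal (g x powr r) \<partial>\<nu>) \<le> 1"
    using Lnorm_powr[of r \<nu> g0] r g0 by simp
  define If where "If Q = (\<integral>\<^sup>+x\<in>Q. f0 x \<partial>\<mu>)" for Q
  define Ig where "Ig Q = (\<integral>\<^sup>+x\<in>Q. g0 x \<partial>\<nu>)" for Q
  have If_eq: "If Q = (\<integral>\<^sup>+x\<in>Q. ennreal (f x) \<partial>\<mu>)" for Q
    unfolding If_def using AEf by (intro nn_integral_cong_AE) (auto elim!: eventually_mono)
  have Ig_eq: "Ig Q = (\<integral>\<^sup>+x\<in>Q. ennreal (g x) \<partial>\<nu>)" for Q
    unfolding Ig_def using AEg by (intro nn_integral_cong_AE) (auto elim!: eventually_mono)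
  have If_fin: "If Q < top" if "Q \<in> D" for Q
    unfolding If_def using set_integral_finite[OF f0(1) p _ that] f0(2) by simp
  have Ig_fin: "Ig Q < top" if "Q \<in> D" for Q
    unfolding Ig_def using sw.set_integral_finite[OF g0(1) r _ that] g0(2) by simp
  have If_null: "If Q = 0" if "Q \<in> D" "measure \<mu> Q = 0" for Q
  proof -
    have "Q \<in> null_sets \<mu>" using that in_sets emeasure_mu by auto
    hence "AE x in \<mu>. x \<notin> Q" by (rule AE_not_in)
    hence "(\<integral>\<^sup>+x\<in>Q. f0 x \<partial>\<mu>) = (\<integral>\<^sup>+x. 0 \<partial>\<mu>)"
      by (intro nn_integral_cong_AE) (auto elim!: eventually_mono)
    thus ?thesis by (simp add: If_def)
  qed
  have Ig_null: "Ig Q = 0" if "Q \<in> D" "measure \<nu> Q = 0" for Q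
  proof -
    have "Q \<in> null_sets \<nu>" using that in_sets_nu emeasure_nu by auto
    hence "AE x in \<nu>. x \<notin> Q" by (rule AE_not_in)
    hence "(\<integral>\<^sup>+x\<in>Q. g0 x \<partial>\<nu>) = (\<integral>\<^sup>+x. 0 \<partial>\<nu>)"
      by (intro nn_integral_cong_AE) (auto elim!: eventually_mono)
    thus ?thesis by (simp add: Ig_def)
  qed
  define a where "a Q = enn2real (If Q) / measure \<mu> Q" for Q
  define b where "b Q = enn2real (Ig Q) / measure \<nu> Q" for Q
  show "dyadic_form D c \<mu> \<nu> f0 g0 \<le> ennreal ((corona_factor p r + corona_factor r p) * L)"
    unfolding dyadic_form_def
  proof (rule infsum_ennreal_le)
    fix S0 assume S0: "finite S0" "S0 \<subseteq> D"
    define S where "S = {Q\<in>S0. If Q \<noteq> 0 \<and> Ig Q \<noteq> 0}"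
    have S: "finite S" "S \<subseteq> D" using S0 by (auto simp: S_def)
    have mpos: "0 < measure \<mu> Q" and npos: "0 < measure \<nu> Q" if "Q \<in> S" for Q
      using If_null[of Q] Ig_null[of Q] that S by (auto simp: S_def zero_less_measure_iff)
    have apos: "0 < a Q" and bpos: "0 < b Q" if "Q \<in> S" for Q
      using mpos[OF that] npos[OF that] that S If_fin[of Q] Ig_fin[of Q]
      unfolding a_def b_def by (auto intro!: divide_pos_pos simp: S_def enn2real_positive_iff zero_less_iff_neq_zero)
    have If_a: "ennreal (a Q * measure \<mu> Q) = If Q" and Ig_b: "ennreal (b Q * measure \<nu> Q) = Ig Q" if "Q \<in> S" for Q
      using mpos[OF that] npos[OF that] that S If_fin[of Q] Ig_fin[of Q] unfolding a_def b_def by auto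
    define SA where "SA = {Q\<in>S. b Q powr r * measure \<nu> Q \<le> a Q powr p * measure \<mu> Q}"
    define SB where "SB = {Q\<in>S. \<not> b Q powr r * measure \<nu> Q \<le> a Q powr p * measure \<mu> Q}"
    have SA: "finite SA" "SA \<subseteq> D" "SA \<subseteq> S" and SB: "finite SB" "SB \<subseteq> D" "SB \<subseteq> S"
      using S by (auto simp: SA_def SB_def)
    have estA: "(\<Sum>Q\<in>SA. c Q * (a Q * measure \<mu> Q) * (b Q * measure \<nu> Q)) \<le> corona_factor p r * L"
    proof (rule corona_estimate[OF p pq qr SA(1,2) fm f_pos fp gm g_pos gr])
      show "ennreal (a Q * measure \<mu> Q) = (\<integral>\<^sup>+x\<in>Q. ennreal (f x) \<partial>\<mu>)" if "Q \<in> SA" for Q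
        using If_a[of Q] that SA(3) If_eq by auto
      show "ennreal (b Q * measure \<nu> Q) = (\<integral>\<^sup>+x\<in>Q. ennreal (g x) \<partial>\<nu>)" if "Q \<in> SA" for Q
        using Ig_b[of Q] that SA(3) Ig_eq by auto
      show "Lnorm q \<nu> (\<lambda>x. \<Sum>Q\<in>{Q\<in>SA. Q \<subseteq> R}. ennreal (c Q * measure \<mu> Q) * indicator Q x)
          \<le> ennreal (L * measure \<mu> R powr (1 / p))" if "R \<in> SA" for R
        using local_testing_finite[OF t1 _ _ _ SA(1,2)] that SA mpos L q by auto
    qed (use SA mpos apos bpos L in \<open>auto simp: SA_def less_imp_le\<close>)
    have estB: "(\<Sum>Q\<in>SB. c Q * (b Q * measure \<nu> Q) * (a Q * measure \<mu> Q)) \<le> corona_factor r p * L"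
    proof (rule sw.corona_estimate[OF r rs _ SB(1,2) gm g_pos gr fm f_pos fp])
      show "1 / s + 1 / p = 1" using ps by simp
      show "ennreal (a Q * measure \<mu> Q) = (\<integral>\<^sup>+x\<in>Q. ennreal (f x) \<partial>\<mu>)" if "Q \<in> SB" for Q
        using If_a[of Q] that SB(3) If_eq by auto
      show "ennreal (b Q * measure \<nu> Q) = (\<integral>\<^sup>+x\<in>Q. ennreal (g x) \<partial>\<nu>)" if "Q \<in> SB" for Q
        using Ig_b[of Q] that SB(3) Ig_eq by auto
      show "Lnorm s \<mu> (\<lambda>x. \<Sum>Q\<in>{Q\<in>SB. Q \<subseteq> R}. ennreal (c Q * measure \<nu> Q) * indicator Q x)
          \<le> ennreal (L * measure \<nu> R powr (1 / r))" if "R \<in> SB" for R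
        using sw.local_testing_finite[OF t2 _ _ _ SB(1,2)] that SB npos L s by auto
    qed (use SB npos apos bpos L in \<open>auto simp: SB_def less_imp_le\<close>)
    have "(\<Sum>Q\<in>S0. ennreal (c Q) * (\<integral>\<^sup>+x\<in>Q. f0 x \<partial>\<mu>) * (\<integral>\<^sup>+x\<in>Q. g0 x \<partial>\<nu>)) =
        (\<Sum>Q\<in>S. ennreal (c Q) * If Q * Ig Q)"
      unfolding If_def[symmetric] Ig_def[symmetric]
      using S0 by (intro sum.mono_neutral_right) (auto simp: S_def)
    also have "\<dots> = (\<Sum>Q\<in>S. ennreal (c Q * (a Q * measure \<mu> Q) * (b Q * measure \<nu> Q)))"
    proof (rule sum.cong[OF refl])
      fix Q assume Q: "Q \<in> S"
      hence "0 \<le> c Q" "0 < a Q" "0 < b Q" using S c_nonneg apos bpos by auto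
      thus "ennreal (c Q) * If Q * Ig Q = ennreal (c Q * (a Q * measure \<mu> Q) * (b Q * measure \<nu> Q))"
        by (simp add: If_a[OF Q, symmetric] Ig_b[OF Q, symmetric] ennreal_mult)
    qed
    also have "\<dots> = ennreal (\<Sum>Q\<in>S. c Q * (a Q * measure \<mu> Q) * (b Q * measure \<nu> Q))"
      using S c_nonneg apos bpos by (intro sum_ennreal) (auto intro!: mult_nonneg_nonneg simp: less_imp_le)
    also have "(\<Sum>Q\<in>S. c Q * (a Q * measure \<mu> Q) * (b Q * measure \<nu> Q)) =
        (\<Sum>Q\<in>SA. c Q * (a Q * measure \<mu> Q) * (b Q * measure \<nu> Q)) +
        (\<Sum>Q\<in>SB. c Q * (b Q * measure \<nu> Q) * (a Q * measure \<mu> Q))"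
    proof -
      have "S = SA \<union> SB" "SA \<inter> SB = {}" by (auto simp: SA_def SB_def)
      thus ?thesis using SA SB by (simp add: sum.union_disjoint ac_simps)
    qed
    also have "ennreal \<dots> \<le> ennreal ((corona_factor p r + corona_factor r p) * L)"
      using estA estB by (intro ennreal_leI) (simp add: distrib_right)
    finally show "(\<Sum>Q\<in>S0. ennreal (c Q) * (\<integral>\<^sup>+x\<in>Q. f0 x \<partial>\<mu>) * (\<integral>\<^sup>+x\<in>Q. g0 x \<partial>\<nu>))
        \<le> ennreal ((corona_factor p r + corona_factor r p) * L)" .
  qed
qed

section \<open>Global testing dominates local testing\<close>

text \<open>
For \<open>Q \<supseteq> R\<close> the integral of \<open>1\<^sub>R\<close> over \<open>Q\<close> is \<open>\<mu>(R)\<close>. Dividing the testing inequality for \<open>R\<close> by this common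
factor bounds \<open>\<Sum> c\<^sub>Q 1\<^sub>Q\<close> over \<open>Q \<supseteq> R\<close>.
\<close>

lemma global_testing_finite:
  assumes t: "testing_const D (cubes_containing D) c \<mu> \<nu> p q \<le> ennreal L"
    and R: "R \<in> D" "0 < measure \<mu> R" and L: "0 \<le> L" and S: "finite S" "S \<subseteq> D" and q: "0 < q"
  shows "(\<integral>\<^sup>+x. ennreal ((\<Sum>Q\<in>{Q\<in>S. R \<subseteq> Q}. c Q * indicator Q x) powr q) \<partial>\<nu>)
     \<le> ennreal ((L * measure \<mu> R powr (1 / p - 1)) powr q)"
proof -
  let ?m = "measure \<mu> R"
  let ?K = "\<lambda>x. \<Sum>Q\<in>{Q\<in>S. R \<subseteq> Q}. c Q * indicator Q x"
  have c0: "0 \<le> c Q" if "Q \<in> S" for Q using that S c_nonneg by blast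
  have K0: "0 \<le> ?K x" for x using c0 by (intro sum_nonneg) auto
  have Km: "?K \<in> borel_measurable \<nu>"
    using S in_sets_nu by (intro borel_measurable_sum borel_measurable_times) auto
  have "Lnorm q \<nu> (\<lambda>x. ennreal ?m * ennreal (?K x)) =
      Lnorm q \<nu> (\<lambda>x. \<Sum>Q\<in>{Q\<in>S. R \<subseteq> Q}. ennreal (c Q * ?m) * indicator Q x)"
  proof -
    have "ennreal ?m * ennreal (?K x) = (\<Sum>Q\<in>{Q\<in>S. R \<subseteq> Q}. ennreal (c Q * ?m) * indicator Q x)" for x
    proof -
      have "ennreal ?m * ennreal (?K x) = ennreal (\<Sum>Q\<in>{Q\<in>S. R \<subseteq> Q}. c Q * ?m * indicator Q x)"
        using K0 by (simp add: ennreal_mult[symmetric] sum_distrib_left ac_simps)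
      also have "\<dots> = (\<Sum>Q\<in>{Q\<in>S. R \<subseteq> Q}. ennreal (c Q * ?m * indicator Q x))"
        using c0 by (intro sum_ennreal[symmetric]) auto
      also have "\<dots> = (\<Sum>Q\<in>{Q\<in>S. R \<subseteq> Q}. ennreal (c Q * ?m) * indicator Q x)"
        by (intro sum.cong) (auto simp: indicator_def)
      finally show ?thesis .
    qed
    thus ?thesis by simp
  qed
  also have "\<dots> \<le> Lnorm q \<nu> (dyadic_potential (cubes_containing D R) c \<mu> (indicator R))"
  proof (intro Lnorm_mono q potential_ge_finite_sum)
    fix Q assume "Q \<in> {Q\<in>S. R \<subseteq> Q}"
    hence Q: "Q \<in> D" "Q \<inter> R = R" using S by auto
    thus "0 \<le> c Q \<and> ennreal (c Q * ?m) \<le> ennreal (c Q) * (\<integral>\<^sup>+y\<in>Q. indicator R y \<partial>\<mu>)"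
      using R c_nonneg by (simp add: integral_indicator_inter emeasure_mu ennreal_mult)
  qed (use S in auto)
  also have "\<dots> \<le> ennreal (L * ?m powr (1 / p))" by (rule testing_bound[OF t R L])
  also have "L * ?m powr (1 / p) = ?m * (L * ?m powr (1 / p - 1))"
    using R by (simp add: powr_diff)
  finally have "ennreal ?m * Lnorm q \<nu> (\<lambda>x. ennreal (?K x)) \<le> ennreal ?m * ennreal (L * ?m powr (1 / p - 1))"
    using q Km L by (simp add: Lnorm_cmult ennreal_mult)
  hence "Lnorm q \<nu> (\<lambda>x. ennreal (?K x)) \<le> ennreal (L * ?m powr (1 / p - 1))"
    using R by (subst (asm) ennreal_mult_le_mult_iff) auto
  thus ?thesis using q L K0 by (simp add: Lnorm_le_iff)
qed

text \<open>
Fix a point \<open>x\<close>. The members of the family containing \<open>x\<close> form a chain, so they all contain one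
minimal member \<open>J\<close>, and as \<open>\<mu>(Q) \<le> 2\<^sup>k\<^sup>+\<^sup>1\<close>, the sum at \<open>x\<close> is at most \<open>2\<^sup>k\<^sup>+\<^sup>1 \<Sum> c\<^sub>Q 1\<^sub>Q(x)\<close> over \<open>Q \<supseteq> J\<close>. Global testing on \<open>J\<close>
controls the norm of the latter by a negative power of \<open>\<mu>(J) \<ge> 2\<^sup>k\<close>. The minimal members are disjoint
subsets of \<open>R\<close>, so their measures add up to at most \<open>\<mu>(R)\<close>.
\<close>

lemma single_level_estimate:
  fixes k :: int and S :: "'a set set"
  assumes t: "testing_const D (cubes_containing D) c \<mu> \<nu> p q \<le> ennreal L"
    and p: "1 < p" and q: "1 < q" and L: "0 \<le> L" and R: "R \<in> D"
    and S: "finite S" "S \<subseteq> D" and SR: "\<And>Q. Q \<in> S \<Longrightarrow> Q \<subseteq> R"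
    and pos: "\<And>Q. Q \<in> S \<Longrightarrow> 0 < measure \<mu> Q" and lev: "\<And>Q. Q \<in> S \<Longrightarrow> level (measure \<mu> Q) = k"
  shows "Lnorm q \<nu> (\<lambda>x. \<Sum>Q\<in>S. ennreal (c Q * measure \<mu> Q) * indicator Q x)
     \<le> ennreal (2 * L * measure \<mu> R powr (1 / q) * 2 powr ((1 / p - 1 / q) * of_int k))"
proof -
  let ?M = "measure \<mu> R"
  define h where "h x = (\<Sum>Q\<in>S. c Q * measure \<mu> Q * indicator Q x)" for x
  define K where "K J x = (\<Sum>Q\<in>{Q\<in>S. J \<subseteq> Q}. c Q * indicator Q x)" for J x
  define N where "N = {J\<in>S. \<forall>Q\<in>S. \<not> Q \<subset> J}"
  have N: "N \<subseteq> S" "finite N" using S by (auto simp: N_def)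
  have c0: "0 \<le> c Q" if "Q \<in> S" for Q using that S c_nonneg by blast
  have h0: "0 \<le> h x" for x unfolding h_def using c0 pos by (intro sum_nonneg mult_nonneg_nonneg) auto
  have K0: "0 \<le> K J x" for J x unfolding K_def using c0 by (intro sum_nonneg mult_nonneg_nonneg) auto
  have mb: "2 powr of_int k \<le> measure \<mu> Q" "measure \<mu> Q \<le> 2 powr (of_int k + 1)" if "Q \<in> S" for Q
    using level_bounds[OF pos[OF that]] lev[OF that] by (auto simp: less_imp_le)
  have lamS: "Q \<inter> R = {} \<or> Q \<subseteq> R \<or> R \<subseteq> Q" if "Q \<in> S" "R \<in> S" for Q R
    using that S laminar by blast
  have pt: "ennreal (h x powr q) \<le> (\<Sum>J\<in>N. ennreal ((2 powr (of_int k + 1)) powr q) * ennreal (K J x powr q))" for x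
  proof (cases "\<exists>Q\<in>S. x \<in> Q")
    case True
    hence "finite {Q\<in>S. x \<in> Q}" "{Q\<in>S. x \<in> Q} \<noteq> {}" using S by auto
    from finite_has_minimal[OF this] obtain Q0 where Q0: "Q0 \<in> S" "x \<in> Q0"
      and min: "\<And>Q. Q \<in> S \<Longrightarrow> x \<in> Q \<Longrightarrow> Q \<subseteq> Q0 \<Longrightarrow> Q0 = Q" by blast
    obtain J where J: "J \<in> S" "J \<subseteq> Q0" "\<And>Q. Q \<in> S \<Longrightarrow> Q \<subseteq> J \<Longrightarrow> J = Q"
      using finite_has_minimal2[OF S(1) Q0(1)] by blast
    have JN: "J \<in> N" using J unfolding N_def by blast
    \<comment> \<open>\<open>Q0\<close> is the least set of the chain through \<open>x\<close>, and \<open>J\<close> a minimal member below it.\<close>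
    have up: "J \<subseteq> Q" if "Q \<in> S" "x \<in> Q" for Q
      using lamS[OF that(1) Q0(1)] Q0 that min[of Q] J(2) by blast
    have "h x = (\<Sum>Q\<in>{Q\<in>S. J \<subseteq> Q}. c Q * measure \<mu> Q * indicator Q x)"
      unfolding h_def using S up by (intro sum.mono_neutral_right) (auto simp: indicator_def)
    also have "\<dots> \<le> (\<Sum>Q\<in>{Q\<in>S. J \<subseteq> Q}. 2 powr (of_int k + 1) * (c Q * indicator Q x))"
    proof (rule sum_mono)
      fix Q assume "Q \<in> {Q\<in>S. J \<subseteq> Q}"
      hence "measure \<mu> Q * (c Q * indicator Q x) \<le> 2 powr (of_int k + 1) * (c Q * indicator Q x)"
        using mb(2)[of Q] c0[of Q] by (intro mult_right_mono) auto
      thus "c Q * measure \<mu> Q * indicator Q x \<le> 2 powr (of_int k + 1) * (c Q * indicator Q x)"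
        by (simp add: ac_simps)
    qed
    also have "\<dots> = 2 powr (of_int k + 1) * K J x"
      unfolding K_def by (rule sum_distrib_left[symmetric])
    finally have "h x powr q \<le> (2 powr (of_int k + 1) * K J x) powr q"
      using h0 q by (intro powr_mono2) auto
    also have "\<dots> = (2 powr (of_int k + 1)) powr q * K J x powr q"
      using K0 by (simp add: powr_mult)
    finally have "ennreal (h x powr q) \<le> ennreal ((2 powr (of_int k + 1)) powr q) * ennreal (K J x powr q)"
      by (simp add: ennreal_mult[symmetric] ennreal_leI)
    also have "\<dots> \<le> (\<Sum>J\<in>N. ennreal ((2 powr (of_int k + 1)) powr q) * ennreal (K J x powr q))"
      using JN N by (intro member_le_sum) auto
    finally show ?thesis .
  next
    case False
    hence "h x = 0" unfolding h_def by (intro sum.neutral) (auto simp: indicator_def)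
    thus ?thesis by simp
  qed
  have Km: "K J \<in> borel_measurable \<nu>" for J
    unfolding K_def using S in_sets_nu by (intro borel_measurable_sum borel_measurable_times) auto
  have "(\<integral>\<^sup>+x. ennreal (h x powr q) \<partial>\<nu>) \<le>
     (\<integral>\<^sup>+x. (\<Sum>J\<in>N. ennreal ((2 powr (of_int k + 1)) powr q) * ennreal (K J x powr q)) \<partial>\<nu>)"
    by (intro nn_integral_mono pt)
  also have "\<dots> = (\<Sum>J\<in>N. ennreal ((2 powr (of_int k + 1)) powr q) * (\<integral>\<^sup>+x. ennreal (K J x powr q) \<partial>\<nu>))"
    using Km by (subst nn_integral_sum) (auto simp: nn_integral_cmult)
  also have "\<dots> \<le> (\<Sum>J\<in>N. ennreal ((2 powr (of_int k + 1)) powr q) *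
       ennreal (L powr q * 2 powr (of_int k * (q * (1 / p - 1) - 1)) * measure \<mu> J))"
  proof (intro sum_mono mult_left_mono)
    fix J assume "J \<in> N"
    hence J: "J \<in> S" "J \<in> D" "0 < measure \<mu> J" using N S pos by auto
    have "(\<integral>\<^sup>+x. ennreal (K J x powr q) \<partial>\<nu>) \<le> ennreal ((L * measure \<mu> J powr (1 / p - 1)) powr q)"
      unfolding K_def using q by (intro global_testing_finite[OF t J(2,3) L S]) auto
    also have "(L * measure \<mu> J powr (1 / p - 1)) powr q = L powr q * measure \<mu> J powr (q * (1 / p - 1))"
      using L by (simp add: powr_mult powr_powr mult.commute)
    \<comment> \<open>One factor \<open>\<mu>(J)\<close> is kept for the sum over the disjoint sets \<open>J\<close>; the remaining exponent is negative.\<close>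
    also have "measure \<mu> J powr (q * (1 / p - 1)) = measure \<mu> J powr (q * (1 / p - 1) - 1) * measure \<mu> J"
      using J(3) by (simp add: powr_diff)
    also have "ennreal (L powr q * (measure \<mu> J powr (q * (1 / p - 1) - 1) * measure \<mu> J)) \<le>
        ennreal (L powr q * 2 powr (of_int k * (q * (1 / p - 1) - 1)) * measure \<mu> J)"
    proof (intro ennreal_leI)
      have "q * (1 / p - 1) \<le> 0" using p q by (intro mult_nonneg_nonpos) auto
      hence "measure \<mu> J powr (q * (1 / p - 1) - 1) \<le> (2 powr of_int k) powr (q * (1 / p - 1) - 1)"
        using mb(1)[OF J(1)] by (intro powr_mono2') auto
      also have "\<dots> = 2 powr (of_int k * (q * (1 / p - 1) - 1))" by (simp add: powr_powr)
      finally show "L powr q * (measure \<mu> J powr (q * (1 / p - 1) - 1) * measure \<mu> J) \<le>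
          L powr q * 2 powr (of_int k * (q * (1 / p - 1) - 1)) * measure \<mu> J"
        unfolding mult.assoc by (intro mult_left_mono mult_right_mono) auto
    qed
    finally show "(\<integral>\<^sup>+x. ennreal (K J x powr q) \<partial>\<nu>) \<le>
        ennreal (L powr q * 2 powr (of_int k * (q * (1 / p - 1) - 1)) * measure \<mu> J)" .
  qed simp
  also have "\<dots> = ennreal ((2 powr (of_int k + 1)) powr q * L powr q * 2 powr (of_int k * (q * (1 / p - 1) - 1)) * (\<Sum>J\<in>N. measure \<mu> J))"
  proof -
    have *: "(\<Sum>J\<in>N. ennreal A * ennreal (B * measure \<mu> J)) = ennreal (A * B * (\<Sum>J\<in>N. measure \<mu> J))"
      if "0 \<le> A" "0 \<le> B" for A B :: real
      using that by (simp add: ennreal_mult[symmetric] sum_distrib_left mult.assoc)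
    show ?thesis
      by (subst *) (auto simp: mult.assoc)
  qed
  also have "\<dots> \<le> ennreal ((2 powr (of_int k + 1)) powr q * L powr q * 2 powr (of_int k * (q * (1 / p - 1) - 1)) * ?M)"
  proof (intro ennreal_leI mult_left_mono)
    \<comment> \<open>Two minimal members are never strictly nested, hence disjoint.\<close>
    have disj: "disjoint_family_on (\<lambda>J. J) N"
      unfolding disjoint_family_on_def
    proof (intro ballI impI)
      fix J J' assume J: "J \<in> N" "J' \<in> N" "J \<noteq> J'"
      hence "J \<in> S" "J' \<in> S" "\<not> J \<subset> J'" "\<not> J' \<subset> J" by (auto simp: N_def)
      thus "J \<inter> J' = {}" using lamS[of J J'] J(3) by blast
    qed
    have Ns: "(\<lambda>J. J) ` N \<subseteq> sets \<mu>" using N S in_sets by auto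
    have "ennreal (\<Sum>J\<in>N. measure \<mu> J) = (\<Sum>J\<in>N. emeasure \<mu> J)"
      using N S by (subst sum_ennreal[symmetric]) (auto intro!: sum.cong simp: emeasure_mu subset_eq)
    also have "\<dots> = emeasure \<mu> (\<Union>J\<in>N. J)" by (rule sum_emeasure[OF Ns disj N(2)])
    also have "\<dots> \<le> emeasure \<mu> R" using N SR in_sets[OF R] by (intro emeasure_mono) auto
    also have "\<dots> = ennreal ?M" by (rule emeasure_mu[OF R])
    finally show "(\<Sum>J\<in>N. measure \<mu> J) \<le> ?M" by simp
  qed simp
  also have "(2 powr (of_int k + 1)) powr q * L powr q * 2 powr (of_int k * (q * (1 / p - 1) - 1)) * ?M =
      (2 * L * ?M powr (1 / q) * 2 powr ((1 / p - 1 / q) * of_int k)) powr q"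
  proof -
    have "(2 powr (of_int k + 1)) powr q * 2 powr (of_int k * (q * (1 / p - 1) - 1)) =
        2 powr q * 2 powr ((1 / p - 1 / q) * of_int k * q)"
    proof -
      have "(of_int k + 1) * q + of_int k * (q * (1 / p - 1) - 1) = q + (1 / p - 1 / q) * of_int k * q"
        using q p by (simp add: field_simps)
      thus ?thesis by (simp only: powr_powr powr_add[symmetric])
    qed
    thus ?thesis using L q by (simp add: powr_mult powr_powr ac_simps)
  qed
  finally have "Lnorm q \<nu> (\<lambda>x. ennreal (h x)) \<le>
      ennreal (2 * L * ?M powr (1 / q) * 2 powr ((1 / p - 1 / q) * of_int k))"
    using q L h0 by (simp add: Lnorm_le_iff)
  moreover have "ennreal (h x) = (\<Sum>Q\<in>S. ennreal (c Q * measure \<mu> Q) * indicator Q x)" for x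
  proof -
    have "ennreal (h x) = (\<Sum>Q\<in>S. ennreal (c Q * measure \<mu> Q * indicator Q x))"
      unfolding h_def using c0 pos by (intro sum_ennreal[symmetric]) (auto intro!: mult_nonneg_nonneg)
    also have "\<dots> = (\<Sum>Q\<in>S. ennreal (c Q * measure \<mu> Q) * indicator Q x)"
      by (intro sum.cong) (auto simp: indicator_def)
    finally show ?thesis .
  qed
  ultimately show ?thesis by simp
qed

text \<open>
Sum \<open>single_level_estimate\<close> over the levels \<open>k\<close> with \<open>2\<^sup>k \<le> \<mu>(R)\<close>. Since \<open>1/p - 1/q > 0\<close> this is a
geometric series dominated by its largest term, and \<open>\<mu>(R)\<^sup>1\<^sup>/\<^sup>q \<mu>(R)\<^sup>1\<^sup>/\<^sup>p\<^sup>-\<^sup>1\<^sup>/\<^sup>q = \<mu>(R)\<^sup>1\<^sup>/\<^sup>p\<close>.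
\<close>

lemma local_testing_le_global_testing:
  assumes p: "1 < p" and pq: "p < q"
  shows "testing_const D (cubes_inside D) c \<mu> \<nu> p q \<le>
    ennreal (global_to_local_factor p q) * testing_const D (cubes_containing D) c \<mu> \<nu> p q"
proof (rule ennreal_le_cmult_of_bounds[OF global_to_local_factor_pos[OF p pq]])
  fix L :: real assume L: "0 < L" and t: "testing_const D (cubes_containing D) c \<mu> \<nu> p q \<le> ennreal L"
  have q: "1 < q" using p pq by simp
  define s where "s = 1 / p - 1 / q"
  have s: "0 < s" using p pq by (simp add: s_def frac_less2)
  show "testing_const D (cubes_inside D) c \<mu> \<nu> p q \<le> ennreal (global_to_local_factor p q * L)"
    unfolding testing_const_def
  proof (intro SUP_least, clarify)
    fix R assume R: "R \<in> D" "emeasure \<mu> R \<noteq> 0"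
    let ?M = "measure \<mu> R"
    have M: "0 < ?M" using R emeasure_mu[OF R(1)] by (simp add: zero_less_measure_iff)
    have "Lnorm q \<nu> (dyadic_potential (cubes_inside D R) c \<mu> (indicator R)) \<le>
        ennreal (global_to_local_factor p q * L * ?M powr (1 / p))"
      unfolding dyadic_potential_def
    proof (rule Lnorm_infsum_le)
      show "countable (cubes_inside D R)" using countable_D by (rule countable_subset[rotated]) auto
      show "(\<lambda>x. ennreal (c Q) * (\<integral>\<^sup>+y\<in>Q. indicator R y \<partial>\<mu>) * indicator Q x) \<in> borel_measurable \<nu>"
        if "Q \<in> cubes_inside D R" for Q using that in_sets_nu by auto
      fix S0 assume S0: "finite S0" "S0 \<subseteq> cubes_inside D R"
      define S where "S = {Q\<in>S0. 0 < measure \<mu> Q}"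
      define I where "I = (\<lambda>Q. level (measure \<mu> Q)) ` S"
      have S: "finite S" "S \<subseteq> D" and SR: "\<And>Q. Q \<in> S \<Longrightarrow> Q \<subseteq> R" and Spos: "\<And>Q. Q \<in> S \<Longrightarrow> 0 < measure \<mu> Q"
        using S0 by (auto simp: S_def)
      have eq: "(\<Sum>Q\<in>S0. ennreal (c Q) * (\<integral>\<^sup>+y\<in>Q. indicator R y \<partial>\<mu>) * indicator Q x) =
          (\<Sum>k\<in>I. \<Sum>Q\<in>{Q\<in>S. level (measure \<mu> Q) = k}. ennreal (c Q * measure \<mu> Q) * indicator Q x)" for x
      proof -
        have "(\<Sum>Q\<in>S0. ennreal (c Q) * (\<integral>\<^sup>+y\<in>Q. indicator R y \<partial>\<mu>) * indicator Q x) =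
           (\<Sum>Q\<in>S0. ennreal (c Q * measure \<mu> Q) * indicator Q x)"
        proof (rule sum.cong[OF refl])
          fix Q assume "Q \<in> S0"
          hence Q: "Q \<in> D" "Q \<inter> R = Q" using S0 by auto
          thus "ennreal (c Q) * (\<integral>\<^sup>+y\<in>Q. indicator R y \<partial>\<mu>) * indicator Q x = ennreal (c Q * measure \<mu> Q) * indicator Q x"
            using R c_nonneg by (simp add: integral_indicator_inter emeasure_mu ennreal_mult)
        qed
        also have "\<dots> = (\<Sum>Q\<in>S. ennreal (c Q * measure \<mu> Q) * indicator Q x)"
          using S0 by (intro sum.mono_neutral_right) (auto simp: S_def not_less measure_le_0_iff)
        also have "\<dots> = (\<Sum>k\<in>I. \<Sum>Q\<in>{Q\<in>S. level (measure \<mu> Q) = k}. ennreal (c Q * measure \<mu> Q) * indicator Q x)"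
          using S by (intro sum.group[symmetric]) (auto simp: I_def)
        finally show ?thesis .
      qed
      have "Lnorm q \<nu> (\<lambda>x. \<Sum>Q\<in>S0. ennreal (c Q) * (\<integral>\<^sup>+y\<in>Q. indicator R y \<partial>\<mu>) * indicator Q x) \<le>
          (\<Sum>k\<in>I. Lnorm q \<nu> (\<lambda>x. \<Sum>Q\<in>{Q\<in>S. level (measure \<mu> Q) = k}. ennreal (c Q * measure \<mu> Q) * indicator Q x))"
        unfolding eq
      proof (rule Lnorm_sum_le[OF q])
        show "(\<lambda>x. \<Sum>Q\<in>{Q\<in>S. level (measure \<mu> Q) = k}. ennreal (c Q * measure \<mu> Q) * indicator Q x) \<in> borel_measurable \<nu>" for k
          using S in_sets_nu by (intro borel_measurable_sum borel_measurable_times_ennreal) auto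
      qed (use S in \<open>auto simp: I_def\<close>)
      also have "\<dots> \<le> (\<Sum>k\<in>I. ennreal (2 * L * ?M powr (1 / q) * 2 powr (s * of_int k)))"
        unfolding s_def using S SR Spos L
        by (intro sum_mono single_level_estimate[OF t p q _ R(1)]) auto
      also have "\<dots> = ennreal (2 * L * ?M powr (1 / q) * (\<Sum>k\<in>I. 2 powr (s * of_int k)))"
        using L by (simp add: sum_ennreal sum_distrib_left)
      also have "\<dots> \<le> ennreal (global_to_local_factor p q * L * ?M powr (1 / p))"
      proof (rule ennreal_leI)
        have "(\<Sum>k\<in>I. 2 powr (s * of_int k)) \<le> 2 powr (s * of_int (level ?M)) / (1 - 2 powr (- s))"
        proof (rule sum_geometric_int_le[OF s])
          fix k assume "k \<in> I"
          then obtain Q where Q: "Q \<in> S" "k = level (measure \<mu> Q)" by (auto simp: I_def)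
          have "emeasure \<mu> Q \<le> emeasure \<mu> R" using SR[OF Q(1)] in_sets[OF R(1)] by (rule emeasure_mono)
          hence "measure \<mu> Q \<le> ?M" using Q S emeasure_mu[of Q] emeasure_mu[OF R(1)] by auto
          thus "k \<le> level ?M" using Q Spos by (auto intro: level_mono)
        qed (use S in \<open>auto simp: I_def\<close>)
        also have "\<dots> \<le> ?M powr s / (1 - 2 powr (- s))"
        proof (rule divide_right_mono)
          have "(2 powr of_int (level ?M)) powr s \<le> ?M powr s"
            using level_bounds[OF M] s by (intro powr_mono2) auto
          thus "2 powr (s * of_int (level ?M)) \<le> ?M powr s" by (simp add: powr_powr mult.commute)
          show "0 \<le> 1 - 2 powr (- s)" using s by (simp add: powr_less_one less_imp_le)
        qed
        finally have "2 * L * ?M powr (1 / q) * (\<Sum>k\<in>I. 2 powr (s * of_int k)) \<le>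
            2 * L * ?M powr (1 / q) * (?M powr s / (1 - 2 powr (- s)))"
          using L by (intro mult_left_mono) auto
        also have "\<dots> = 2 / (1 - 2 powr (- s)) * L * (?M powr (1 / q) * ?M powr s)" by simp
        also have "?M powr (1 / q) * ?M powr s = ?M powr (1 / p)"
          by (simp add: s_def powr_add[symmetric])
        finally show "2 * L * ?M powr (1 / q) * (\<Sum>k\<in>I. 2 powr (s * of_int k)) \<le>
            global_to_local_factor p q * L * ?M powr (1 / p)"
          by (simp add: global_to_local_factor_def s_def)
      qed
      finally show "Lnorm q \<nu> (\<lambda>x. \<Sum>Q\<in>S0. ennreal (c Q) * (\<integral>\<^sup>+y\<in>Q. indicator R y \<partial>\<mu>) * indicator Q x) \<le>
          ennreal (global_to_local_factor p q * L * ?M powr (1 / p))" .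
    qed (use q in auto)
    thus "Lnorm q \<nu> (dyadic_potential (cubes_inside D R) c \<mu> (indicator R)) / ennreal_powr (emeasure \<mu> R) (1 / p)
        \<le> ennreal (global_to_local_factor p q * L)"
      using M L global_to_local_factor_pos[OF p pq] emeasure_mu[OF R(1)]
      by (intro divide_le_posI_ennreal) (auto simp: ennreal_mult[symmetric] mult.commute)
  qed
qed

section \<open>Equivalence of the operator norm with the testing constants\<close>

lemma potential_norm_equiv_local_testing:
  assumes p: "1 < p" and pq: "p \<le> q" and ps: "1 / p + 1 / s = 1" and qr: "1 / q + 1 / r = 1"
  defines "T \<equiv> testing_const D (cubes_inside D) c \<nu> \<mu> r s + testing_const D (cubes_inside D) c \<mu> \<nu> p q"
  shows "potential_norm D c \<mu> \<nu> p q \<le> ennreal (corona_factor p r + corona_factor r p) * T"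
    and "T \<le> 2 * potential_norm D c \<mu> \<nu> p q"
proof -
  have q: "1 < q" using p pq by simp
  have r: "1 < r" and s: "1 < s" using conjugate_exponent_gt_1 p q ps qr by blast+
  interpret sw: dyadic_pair D c \<nu> \<mu> by (rule swap)
  show "potential_norm D c \<mu> \<nu> p q \<le> ennreal (corona_factor p r + corona_factor r p) * T"
  proof (rule ennreal_le_cmult_of_bounds)
    have "0 < carleson_factor p" "0 < carleson_factor r" using p r carleson_factor_pos by blast+
    hence "0 < corona_factor p r" "0 < corona_factor r p" unfolding corona_factor_def by simp_all
    thus "0 < corona_factor p r + corona_factor r p" by simp
    fix L :: real assume L: "0 < L" "T \<le> ennreal L"
    have "testing_const D (cubes_inside D) c \<mu> \<nu> p q \<le> ennreal L"
         "testing_const D (cubes_inside D) c \<nu> \<mu> r s \<le> ennreal L"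
      using L(2) unfolding T_def by (auto elim: order_trans[rotated])
    thus "potential_norm D c \<mu> \<nu> p q \<le> ennreal ((corona_factor p r + corona_factor r p) * L)"
      unfolding potential_norm_eq_form_norm[OF p q qr]
      using form_norm_le_testing[OF p pq ps qr L(1)] by blast
  qed
  have "testing_const D (cubes_inside D) c \<nu> \<mu> r s \<le> potential_norm D c \<nu> \<mu> r s"
    using r s by (intro sw.testing_le_potential_norm) auto
  also have "\<dots> = potential_norm D c \<mu> \<nu> p q" by (rule potential_norm_dual[OF p q ps qr])
  moreover have "testing_const D (cubes_inside D) c \<mu> \<nu> p q \<le> potential_norm D c \<mu> \<nu> p q"
    using p q by (intro testing_le_potential_norm) auto
  ultimately show "T \<le> 2 * potential_norm D c \<mu> \<nu> p q"
    unfolding T_def mult_2 by (intro add_mono) auto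
qed

lemma potential_norm_equiv_global_testing:
  assumes p: "1 < p" and pq: "p < q" and ps: "1 / p + 1 / s = 1" and qr: "1 / q + 1 / r = 1"
  defines "T \<equiv> testing_const D (cubes_containing D) c \<nu> \<mu> r s + testing_const D (cubes_containing D) c \<mu> \<nu> p q"
  shows "potential_norm D c \<mu> \<nu> p q \<le>
      ennreal ((corona_factor p r + corona_factor r p) * (global_to_local_factor r s + global_to_local_factor p q)) * T"
    and "T \<le> 2 * potential_norm D c \<mu> \<nu> p q"
proof -
  have q: "1 < q" using p pq by simp
  have r: "1 < r" and s: "1 < s" using conjugate_exponent_gt_1 p q ps qr by blast+
  have rs: "r < s"
  proof -
    have "1 / q < 1 / p" using p pq by (simp add: frac_less2)
    hence "1 / s < 1 / r" using ps qr by linarith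
    thus ?thesis using r s by (simp add: field_simps)
  qed
  interpret sw: dyadic_pair D c \<nu> \<mu> by (rule swap)
  have pos: "0 < global_to_local_factor r s" "0 < global_to_local_factor p q"
    using global_to_local_factor_pos p pq r rs by blast+
  have cpos: "0 \<le> corona_factor p r + corona_factor r p" unfolding corona_factor_def by simp
  let ?C = "ennreal (corona_factor p r + corona_factor r p)"
  let ?A = "testing_const D (cubes_containing D) c \<nu> \<mu> r s" and ?B = "testing_const D (cubes_containing D) c \<mu> \<nu> p q"
  have "potential_norm D c \<mu> \<nu> p q \<le> ?C *
      (testing_const D (cubes_inside D) c \<nu> \<mu> r s + testing_const D (cubes_inside D) c \<mu> \<nu> p q)"
    using potential_norm_equiv_local_testing(1)[OF p _ ps qr] pq by simp
  also have "\<dots> \<le> ?C * (ennreal (global_to_local_factor r s) * ?A + ennreal (global_to_local_factor p q) * ?B)"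
    by (intro mult_left_mono add_mono local_testing_le_global_testing sw.local_testing_le_global_testing p pq r rs) simp
  also have "\<dots> \<le> ?C * (ennreal (global_to_local_factor r s + global_to_local_factor p q) * ?A +
      ennreal (global_to_local_factor r s + global_to_local_factor p q) * ?B)"
    using pos by (intro mult_left_mono add_mono mult_right_mono ennreal_leI) auto
  also have "\<dots> = ennreal ((corona_factor p r + corona_factor r p) * (global_to_local_factor r s + global_to_local_factor p q)) * T"
    unfolding T_def using pos cpos
    by (subst ennreal_mult) (simp_all only: distrib_left mult.assoc add_nonneg_nonneg less_imp_le)
  finally show "potential_norm D c \<mu> \<nu> p q \<le>
      ennreal ((corona_factor p r + corona_factor r p) * (global_to_local_factor r s + global_to_local_factor p q)) * T" .
  have "?A \<le> potential_norm D c \<nu> \<mu> r s"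
    using r s by (intro sw.testing_le_potential_norm) auto
  also have "\<dots> = potential_norm D c \<mu> \<nu> p q" by (rule potential_norm_dual[OF p q ps qr])
  moreover have "?B \<le> potential_norm D c \<mu> \<nu> p q"
    using p q by (intro testing_le_potential_norm) auto
  ultimately show "T \<le> 2 * potential_norm D c \<mu> \<nu> p q"
    unfolding T_def mult_2 by (intro add_mono) auto
qed

end

section \<open>Dyadic cubes and weights\<close>

lemma hcube_bounds: "box a (a + (\<chi> i. l)) \<subseteq> hcube a l" "hcube a l \<subseteq> cbox a (a + (\<chi> i. l))"
  by (auto simp: hcube_def mem_box_cart less_imp_le)

lemma hcube_borel: "hcube a l \<in> sets borel"
proof -
  have "hcube a l = (\<Inter>i. {x. a $ i \<le> x $ i} \<inter> {x. x $ i < a $ i + l})"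
    by (auto simp: hcube_def)
  also have "\<dots> \<in> sets borel"
    by (intro sets.finite_INT sets.Int borel_closed borel_open closed_halfspace_component_ge_cart
        open_halfspace_component_lt_cart) auto
  finally show ?thesis .
qed

lemma hcube_sets_lebesgue: "hcube a l \<in> sets lebesgue"
  by (rule sets_completionI_sets) (simp add: hcube_borel)

lemma hcube_interior:
  assumes "0 < l" shows "interior (hcube a l) \<noteq> {}"
proof -
  have "box a (a + (\<chi> i. l)) \<noteq> {}" using assms by (auto simp: interval_ne_empty_cart)
  moreover have "box a (a + (\<chi> i. l)) \<subseteq> interior (hcube a l)"
    by (intro interior_maximal hcube_bounds open_box)
  ultimately show ?thesis by auto
qed

lemma emeasure_hcube:
  assumes "0 < l" shows "0 < emeasure lebesgue (hcube a l)" "emeasure lebesgue (hcube a l) < top"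
proof -
  have "interior (hcube a l) \<subseteq> {}" if "emeasure lebesgue (hcube a l) = 0"
  proof -
    have "hcube a l \<in> null_sets lebesgue" using that hcube_sets_lebesgue by auto
    hence "negligible (hcube a l)" by (simp add: negligible_iff_null_sets)
    hence "negligible (interior (hcube a l))" by (rule negligible_subset) (rule interior_subset)
    thus ?thesis using open_not_negligible[OF open_interior] by auto
  qed
  thus "0 < emeasure lebesgue (hcube a l)"
    using hcube_interior[OF assms, of a] by (auto simp: zero_less_iff_neq_zero)
  have "emeasure lebesgue (hcube a l) \<le> emeasure lebesgue (cbox a (a + (\<chi> i. l)))"
    by (intro emeasure_mono hcube_bounds) auto
  also have "\<dots> < top" using emeasure_lborel_cbox_finite by (simp add: less_top[symmetric])
  finally show "emeasure lebesgue (hcube a l) < top" .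
qed

lemma dyadic_grid_cube:
  assumes "dyadic_grid \<Q>" "Q \<in> \<Q>"
  shows "\<exists>a (k::int). Q = hcube a (2 powi k)"
proof -
  have "\<forall>Q\<in>\<Q>. \<exists>a (k::int). Q = hcube a (2 powi k)"
    using assms(1) unfolding dyadic_grid_def by (rule conjunct1)
  thus ?thesis using assms(2) by (rule bspec)
qed

text \<open>
Each generation consists of disjoint sets with non-empty interior in a second-countable space.
\<close>

lemma dyadic_grid_countable:
  fixes \<Q> :: "(real ^ 'd) set set"
  assumes "dyadic_grid \<Q>" shows "countable \<Q>"
proof -
  have "\<Q> \<subseteq> (\<Union>k::int. {Q\<in>\<Q>. \<exists>a. Q = hcube a (2 powi k)})"
  proof
    fix Q assume Q: "Q \<in> \<Q>"
    obtain a k where "Q = hcube a (2 powi (k::int))" using dyadic_grid_cube[OF assms Q] by (elim exE)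
    with Q show "Q \<in> (\<Union>k::int. {Q\<in>\<Q>. \<exists>a. Q = hcube a (2 powi k)})" by blast
  qed
  moreover have "countable {Q\<in>\<Q>. \<exists>a. Q = hcube a (2 powi k)}" for k :: int
  proof (rule countable_disjoint_nonempty_interior_subsets)
    show "pairwise disjnt {Q\<in>\<Q>. \<exists>a. Q = hcube a (2 powi k)}"
    proof -
      have "partition_on UNIV {Q\<in>\<Q>. \<exists>a. Q = hcube a (2 powi k)}"
        using assms unfolding dyadic_grid_def by simp
      thus ?thesis by (rule partition_onD2)
    qed
    fix S assume "S \<in> {Q\<in>\<Q>. \<exists>a. Q = hcube a (2 powi k)}" "interior S = {}"
    thus "S = {}" using hcube_interior[of "2 powi k"] by auto
  qed
  ultimately show ?thesis by (meson countable_UN countable_subset countableI_type)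
qed

lemma sets_weight_measure [simp]: "sets (weight_measure w) = sets lebesgue"
  by (simp add: weight_measure_def)

lemma borel_measurable_weight_measure [simp]: "borel_measurable (weight_measure w) = borel_measurable lebesgue"
  by (rule measurable_cong_sets) simp_all

lemma nn_integral_weight_measure:
  assumes "weight w" "F \<in> borel_measurable lebesgue"
  shows "(\<integral>\<^sup>+x. F x \<partial>weight_measure w) = (\<integral>\<^sup>+x. ennreal (w x) * F x \<partial>lebesgue)"
  unfolding weight_measure_def using assms by (intro nn_integral_density) (auto simp: weight_def)

lemma weight_measure_cube_finite:
  assumes w: "weight w" shows "emeasure (weight_measure w) (hcube a l) < top"
proof -
  let ?C = "cbox a (a + (\<chi> i. l))"
  have "emeasure (weight_measure w) (hcube a l) = (\<integral>\<^sup>+x. ennreal (w x) * indicator (hcube a l) x \<partial>lebesgue)"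
    unfolding weight_measure_def using w hcube_sets_lebesgue by (intro emeasure_density) (auto simp: weight_def)
  also have "\<dots> \<le> (\<integral>\<^sup>+x. ennreal (norm (indicator ?C x *\<^sub>R w x)) \<partial>lebesgue)"
    using hcube_bounds(2)[of a l] w by (intro nn_integral_mono) (auto simp: indicator_def weight_def)
  also have "\<dots> < \<infinity>"
  proof -
    have "integrable lebesgue (\<lambda>x. indicator ?C x *\<^sub>R w x)"
      using w compact_cbox unfolding weight_def set_integrable_def by blast
    thus ?thesis unfolding integrable_iff_bounded by blast
  qed
  finally show ?thesis by simp
qed

text \<open>
With these coefficients the average over \<open>Q\<close> becomes the integral against the weighted measure.
\<close>

definition cube_coeff :: "((real ^ 'd) set \<Rightarrow> real) \<Rightarrow> (real ^ 'd) set \<Rightarrow> real" where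
  "cube_coeff \<tau> Q = \<tau> Q / measure lebesgue Q"

lemma dyadic_pair_weights:
  assumes grid: "dyadic_grid \<Q>" and "\<forall>Q\<in>\<Q>. 0 \<le> \<tau> Q" and w: "weight \<sigma>" "weight \<omega>"
  shows "dyadic_pair \<Q> (cube_coeff \<tau>) (weight_measure \<sigma>) (weight_measure \<omega>)"
proof
  show "countable \<Q>" using grid by (rule dyadic_grid_countable)
  show "Q \<inter> R = {} \<or> Q \<subseteq> R \<or> R \<subseteq> Q" if "Q \<in> \<Q>" "R \<in> \<Q>" for Q R
    using that grid unfolding dyadic_grid_def by blast
  show "0 \<le> cube_coeff \<tau> Q" if "Q \<in> \<Q>" for Q unfolding cube_coeff_def using that assms by simp
  fix Q assume "Q \<in> \<Q>"
  obtain a k where "Q = hcube a (2 powi (k::int))" using dyadic_grid_cube[OF grid \<open>Q \<in> \<Q>\<close>] by (elim exE)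
  thus "Q \<in> sets (weight_measure \<sigma>)" "emeasure (weight_measure \<sigma>) Q < top" "emeasure (weight_measure \<omega>) Q < top"
    using hcube_sets_lebesgue weight_measure_cube_finite w by auto
qed simp

lemma cube_avg_weight:
  assumes "dyadic_grid \<Q>" "Q \<in> \<Q>" "\<forall>Q\<in>\<Q>. 0 \<le> \<tau> Q" "weight \<sigma>" "f \<in> borel_measurable lebesgue"
  shows "ennreal (\<tau> Q) * cube_avg Q (\<lambda>x. f x * ennreal (\<sigma> x)) =
         ennreal (cube_coeff \<tau> Q) * (\<integral>\<^sup>+x\<in>Q. f x \<partial>weight_measure \<sigma>)"
    and "cube_avg Q (\<lambda>x. f x * ennreal (\<sigma> x)) * emeasure lebesgue Q = (\<integral>\<^sup>+x\<in>Q. f x \<partial>weight_measure \<sigma>)"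
proof -
  obtain a k where Q: "Q = hcube a (2 powi (k::int))" using dyadic_grid_cube[OF assms(1,2)] by (elim exE)
  have e: "0 < emeasure lebesgue Q" "emeasure lebesgue Q < top" unfolding Q by (auto intro!: emeasure_hcube)
  have [measurable]: "Q \<in> sets lebesgue" unfolding Q by (rule hcube_sets_lebesgue)
  have em: "emeasure lebesgue Q = ennreal (measure lebesgue Q)"
    by (rule emeasure_eq_ennreal_measure) (use e(2) in simp)
  have m: "0 < measure lebesgue Q" using e em by (simp add: zero_less_measure_iff)
  have I: "(\<integral>\<^sup>+x\<in>Q. f x * ennreal (\<sigma> x) \<partial>lebesgue) = (\<integral>\<^sup>+x\<in>Q. f x \<partial>weight_measure \<sigma>)"
    using assms by (subst nn_integral_weight_measure) (auto simp: ac_simps)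
  show "ennreal (\<tau> Q) * cube_avg Q (\<lambda>x. f x * ennreal (\<sigma> x)) =
      ennreal (cube_coeff \<tau> Q) * (\<integral>\<^sup>+x\<in>Q. f x \<partial>weight_measure \<sigma>)"
  proof -
    have "ennreal (cube_coeff \<tau> Q) = ennreal (\<tau> Q) / emeasure lebesgue Q"
      unfolding cube_coeff_def em using m assms(2,3) by (simp add: divide_ennreal)
    thus ?thesis unfolding cube_avg_def I by (simp add: divide_ennreal_def ac_simps)
  qed
  show "cube_avg Q (\<lambda>x. f x * ennreal (\<sigma> x)) * emeasure lebesgue Q = (\<integral>\<^sup>+x\<in>Q. f x \<partial>weight_measure \<sigma>)"
  proof -
    have "emeasure lebesgue Q / emeasure lebesgue Q = 1" using e by (intro ennreal_divide_self) auto
    thus ?thesis unfolding cube_avg_def I by (simp add: ennreal_divide_times)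
  qed
qed

lemma T_op_eq_dyadic_potential:
  assumes "dyadic_grid \<Q>" "\<Q>' \<subseteq> \<Q>" "\<forall>Q\<in>\<Q>. 0 \<le> \<tau> Q" "weight \<sigma>" "f \<in> borel_measurable lebesgue"
  shows "T_op \<Q>' \<tau> (\<lambda>x. f x * ennreal (\<sigma> x)) = dyadic_potential \<Q>' (cube_coeff \<tau>) (weight_measure \<sigma>) f"
proof
  fix x
  show "T_op \<Q>' \<tau> (\<lambda>x. f x * ennreal (\<sigma> x)) x = dyadic_potential \<Q>' (cube_coeff \<tau>) (weight_measure \<sigma>) f x"
    unfolding T_op_def dyadic_potential_def
  proof (rule infsum_cong)
    fix Q assume "Q \<in> \<Q>'"
    hence Q: "Q \<in> \<Q>" using assms(2) by blast
    show "ennreal (\<tau> Q) * cube_avg Q (\<lambda>x. f x * ennreal (\<sigma> x)) * indicator Q x =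
        ennreal (cube_coeff \<tau> Q) * (\<integral>\<^sup>+y\<in>Q. f y \<partial>weight_measure \<sigma>) * indicator Q x"
      using cube_avg_weight(1)[OF assms(1) Q assms(3) assms(4,5)] by (simp only:)
  qed
qed

lemma T_opnorm_eq_potential_norm:
  assumes "dyadic_grid \<Q>" "\<forall>Q\<in>\<Q>. 0 \<le> \<tau> Q" "weight \<sigma>"
  shows "T_opnorm \<Q> \<tau> \<sigma> \<omega> p q = potential_norm \<Q> (cube_coeff \<tau>) (weight_measure \<sigma>) (weight_measure \<omega>) p q"
  unfolding T_opnorm_def potential_norm_def Lp_norm_eq_Lnorm borel_measurable_weight_measure
  by (intro arg_cong[where f = Inf] Collect_cong ball_cong refl)
    (simp only: T_op_eq_dyadic_potential[OF assms(1) subset_refl assms(2,3)])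

lemma T_op_indicator_eq_dyadic_potential:
  assumes "dyadic_grid \<Q>" "\<Q>' \<subseteq> \<Q>" "\<forall>Q\<in>\<Q>. 0 \<le> \<tau> Q" "weight \<omega>" "R \<in> \<Q>"
  shows "T_op \<Q>' \<tau> (\<lambda>x. ennreal (\<omega> x) * indicator R x) =
    dyadic_potential \<Q>' (cube_coeff \<tau>) (weight_measure \<omega>) (indicator R)"
proof -
  obtain a k where "R = hcube a (2 powi (k::int))" using dyadic_grid_cube[OF assms(1,5)] by (elim exE)
  hence "R \<in> sets lebesgue" using hcube_sets_lebesgue by simp
  thus ?thesis using T_op_eq_dyadic_potential[OF assms(1-4), where f = "indicator R"] by (simp add: mult.commute)
qed

lemma Loc_const_eq_testing_const:
  assumes "dyadic_grid \<Q>" "\<forall>Q\<in>\<Q>. 0 \<le> \<tau> Q" "weight \<omega>"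
  shows "Loc_const \<Q> \<tau> \<sigma> \<omega> p q = testing_const \<Q> (cubes_inside \<Q>) (cube_coeff \<tau>)
    (weight_measure \<omega>) (weight_measure \<sigma>) (conj_exp q) (conj_exp p)"
  unfolding Loc_const_def testing_const_def T_in_def Lp_norm_eq_Lnorm
proof (rule SUP_cong[OF refl])
  fix R assume "R \<in> {R\<in>\<Q>. emeasure (weight_measure \<omega>) R \<noteq> 0}"
  hence R: "R \<in> \<Q>" by simp
  have "T_op (cubes_inside \<Q> R) \<tau> (\<lambda>x. ennreal (\<omega> x) * indicator R x) =
      dyadic_potential (cubes_inside \<Q> R) (cube_coeff \<tau>) (weight_measure \<omega>) (indicator R)"
    by (rule T_op_indicator_eq_dyadic_potential[OF assms(1) _ assms(2,3) R]) auto
  thus "Lnorm (conj_exp p) (weight_measure \<sigma>) (T_op (cubes_inside \<Q> R) \<tau> (\<lambda>x. ennreal (\<omega> x) * indicator R x)) /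
      ennreal_powr (emeasure (weight_measure \<omega>) R) (1 / conj_exp q) =
    Lnorm (conj_exp p) (weight_measure \<sigma>)
      (dyadic_potential (cubes_inside \<Q> R) (cube_coeff \<tau>) (weight_measure \<omega>) (indicator R)) /
      ennreal_powr (emeasure (weight_measure \<omega>) R) (1 / conj_exp q)"
    by (simp only:)
qed

lemma Glo_const_eq_testing_const:
  assumes "dyadic_grid \<Q>" "\<forall>Q\<in>\<Q>. 0 \<le> \<tau> Q" "weight \<omega>"
  shows "Glo_const \<Q> \<tau> \<sigma> \<omega> p q = testing_const \<Q> (cubes_containing \<Q>) (cube_coeff \<tau>)
    (weight_measure \<omega>) (weight_measure \<sigma>) (conj_exp q) (conj_exp p)"
  unfolding Glo_const_def testing_const_def T_out_def Lp_norm_eq_Lnorm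
proof (rule SUP_cong[OF refl])
  fix R assume "R \<in> {R\<in>\<Q>. emeasure (weight_measure \<omega>) R \<noteq> 0}"
  hence R: "R \<in> \<Q>" by simp
  have "T_op (cubes_containing \<Q> R) \<tau> (\<lambda>x. ennreal (\<omega> x) * indicator R x) =
      dyadic_potential (cubes_containing \<Q> R) (cube_coeff \<tau>) (weight_measure \<omega>) (indicator R)"
    by (rule T_op_indicator_eq_dyadic_potential[OF assms(1) _ assms(2,3) R]) auto
  thus "Lnorm (conj_exp p) (weight_measure \<sigma>) (T_op (cubes_containing \<Q> R) \<tau> (\<lambda>x. ennreal (\<omega> x) * indicator R x)) /
      ennreal_powr (emeasure (weight_measure \<omega>) R) (1 / conj_exp q) =
    Lnorm (conj_exp p) (weight_measure \<sigma>)
      (dyadic_potential (cubes_containing \<Q> R) (cube_coeff \<tau>) (weight_measure \<omega>) (indicator R)) /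
      ennreal_powr (emeasure (weight_measure \<omega>) R) (1 / conj_exp q)"
    by (simp only:)
qed

lemma C3_const_eq_form_norm:
  assumes "dyadic_grid \<Q>" "\<forall>Q\<in>\<Q>. 0 \<le> \<tau> Q" "weight \<sigma>" "weight \<omega>"
  shows "C3_const \<Q> \<tau> \<sigma> \<omega> = form_norm \<Q> (cube_coeff \<tau>) (weight_measure \<sigma>) (weight_measure \<omega>) 2 2"
proof -
  have "(\<Sum>\<^sub>\<infinity>Q\<in>\<Q>. ennreal (\<tau> Q) * cube_avg Q (\<lambda>x. f x * ennreal (\<sigma> x))
               * cube_avg Q (\<lambda>x. g x * ennreal (\<omega> x)) * emeasure lebesgue Q) =
      dyadic_form \<Q> (cube_coeff \<tau>) (weight_measure \<sigma>) (weight_measure \<omega>) f g"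
    if "f \<in> borel_measurable lebesgue" "g \<in> borel_measurable lebesgue" for f g
    unfolding dyadic_form_def
  proof (rule infsum_cong)
    fix Q assume Q: "Q \<in> \<Q>"
    show "ennreal (\<tau> Q) * cube_avg Q (\<lambda>x. f x * ennreal (\<sigma> x))
               * cube_avg Q (\<lambda>x. g x * ennreal (\<omega> x)) * emeasure lebesgue Q =
      ennreal (cube_coeff \<tau> Q) * (\<integral>\<^sup>+x\<in>Q. f x \<partial>weight_measure \<sigma>) * (\<integral>\<^sup>+x\<in>Q. g x \<partial>weight_measure \<omega>)"
      using cube_avg_weight(1)[OF assms(1) Q assms(2) assms(3) that(1)]
        cube_avg_weight(2)[OF assms(1) Q assms(2) assms(4) that(2)]
      by (simp only: mult.assoc)
  qed
  thus ?thesis unfolding C3_const_def form_norm_def Lp_norm_eq_Lnorm by simp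
qed

lemma ennreal_powr_two: "ennreal_powr x 2 = x ^ 2"
  using ennreal_powr_add[of 1 1 x] by (simp add: power2_eq_square)

text \<open>
The square and the square root are the powers in the \<open>L\<^sup>2\<close> norm, and the square root commutes with
the supremum. On \<open>Q \<subseteq> R\<close> the averages of \<open>\<sigma>\<close> and of \<open>\<sigma> 1\<^sub>R\<close> agree.
\<close>

lemma C1_const_eq_testing_const:
  assumes "dyadic_grid \<Q>" "\<forall>Q\<in>\<Q>. 0 \<le> \<tau> Q" "weight \<sigma>" "weight \<omega>"
  shows "C1_const \<Q> \<tau> \<sigma> \<omega> =
    testing_const \<Q> (cubes_inside \<Q>) (cube_coeff \<tau>) (weight_measure \<sigma>) (weight_measure \<omega>) 2 2"
proof -
  interpret dyadic_pair \<Q> "cube_coeff \<tau>" "weight_measure \<sigma>" "weight_measure \<omega>"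
    by (rule dyadic_pair_weights[OF assms])
  have "(\<integral>\<^sup>+ x. (\<Sum>\<^sub>\<infinity>Q\<in>{Q\<in>\<Q>. Q \<subseteq> R}. ennreal (\<tau> Q) * indicator Q x * cube_avg Q (\<lambda>y. ennreal (\<sigma> y))) ^ 2
           * ennreal (\<omega> x) \<partial>lebesgue) =
        (\<integral>\<^sup>+ x. ennreal_powr (dyadic_potential (cubes_inside \<Q> R) (cube_coeff \<tau>) (weight_measure \<sigma>) (indicator R) x) 2
           \<partial>weight_measure \<omega>)" if R: "R \<in> \<Q>" for R
  proof -
    let ?F = "dyadic_potential (cubes_inside \<Q> R) (cube_coeff \<tau>) (weight_measure \<sigma>) (indicator R)"
    interpret sub: dyadic_pair "cubes_inside \<Q> R" "cube_coeff \<tau>" "weight_measure \<sigma>" "weight_measure \<omega>"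
      by (rule restrict_family) auto
    have "(\<Sum>\<^sub>\<infinity>Q\<in>{Q\<in>\<Q>. Q \<subseteq> R}. ennreal (\<tau> Q) * indicator Q x * cube_avg Q (\<lambda>y. ennreal (\<sigma> y))) = ?F x" for x
    proof -
      have "cube_avg Q (\<lambda>y. ennreal (\<sigma> y)) = cube_avg Q (\<lambda>y. ennreal (\<sigma> y) * indicator R y)" if "Q \<subseteq> R" for Q
        unfolding cube_avg_def using that
        by (intro arg_cong2[of _ _ _ _ "(/)"] nn_integral_cong) (auto simp: indicator_def)
      hence "(\<Sum>\<^sub>\<infinity>Q\<in>{Q\<in>\<Q>. Q \<subseteq> R}. ennreal (\<tau> Q) * indicator Q x * cube_avg Q (\<lambda>y. ennreal (\<sigma> y))) =
          T_op {Q\<in>\<Q>. Q \<subseteq> R} \<tau> (\<lambda>y. ennreal (\<sigma> y) * indicator R y) x"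
        unfolding T_op_def by (intro infsum_cong) (simp add: ac_simps)
      thus ?thesis
        using T_op_indicator_eq_dyadic_potential[OF assms(1) _ assms(2,3) R, of "{Q\<in>\<Q>. Q \<subseteq> R}"] by simp
    qed
    moreover have "?F \<in> borel_measurable lebesgue" using sub.potential_measurable by simp
    ultimately show ?thesis
      using assms(4) by (subst nn_integral_weight_measure) (simp_all add: ennreal_powr_two mult.commute)
  qed
  thus ?thesis
    unfolding C1_const_def testing_const_def Lnorm_def
    by (subst ennreal_powr_SUP) (auto simp: ennreal_powr_divide intro!: SUP_cong)
qed

lemma C2_const_eq_C1_const: "C2_const \<Q> \<tau> \<sigma> \<omega> = C1_const \<Q> \<tau> \<omega> \<sigma>"
  unfolding C1_const_def C2_const_def ..

lemma conj_exp_conjugate: "1 < p \<Longrightarrow> 1 / p + 1 / conj_exp p = 1"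
  unfolding conj_exp_def by (simp add: field_simps)

lemma conj_exp_gt_1: "1 < p \<Longrightarrow> 1 < conj_exp p"
  unfolding conj_exp_def by (simp add: field_simps)

lemma conj_exp_antimono:
  assumes "1 < p" "p < q" shows "conj_exp q < conj_exp p"
proof -
  have "conj_exp q = 1 + 1 / (q - 1)" "conj_exp p = 1 + 1 / (p - 1)"
    using assms by (auto simp: conj_exp_def field_simps)
  thus ?thesis using assms by (simp add: frac_less2)
qed

lemma conj_exp_conj_exp: "1 < p \<Longrightarrow> conj_exp (conj_exp p) = p"
  unfolding conj_exp_def by (simp add: field_simps)

lemma comparableI:
  assumes "A \<le> ennreal K * B" "B \<le> 2 * A" "0 \<le> K" shows "comparable (K + 2) A B"
proof -
  have "ennreal K * B \<le> ennreal (K + 2) * B" using assms(3) by (intro mult_right_mono ennreal_leI) auto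
  moreover have "2 * A \<le> ennreal (K + 2) * A"
    using assms(3) ennreal_leI[of 2 "K + 2"] by (intro mult_right_mono) auto
  ultimately show ?thesis unfolding comparable_def using assms by (meson order_trans)
qed

definition local_factor :: "real \<Rightarrow> real \<Rightarrow> real" where
  "local_factor p q = corona_factor p (conj_exp q) + corona_factor (conj_exp q) p"

lemma local_factor_nonneg: "0 \<le> local_factor p q"
  unfolding local_factor_def corona_factor_def by simp

lemma local_testing_theorem:
  assumes p: "1 < p" "p \<le> q"
    and Q: "dyadic_grid \<Q>" "\<forall>Q\<in>\<Q>. 0 \<le> \<tau> Q" "weight \<sigma>" "weight \<omega>"
  shows "comparable (local_factor p q + 2) (T_opnorm \<Q> \<tau> \<sigma> \<omega> p q)
    (Loc_const \<Q> \<tau> \<sigma> \<omega> p q + Loc_const \<Q> \<tau> \<omega> \<sigma> (conj_exp q) (conj_exp p))"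
proof -
  interpret dyadic_pair \<Q> "cube_coeff \<tau>" "weight_measure \<sigma>" "weight_measure \<omega>"
    by (rule dyadic_pair_weights[OF Q])
  have q: "1 < q" using p by simp
  note equiv = potential_norm_equiv_local_testing[OF p conj_exp_conjugate[OF p(1)] conj_exp_conjugate[OF q]]
  show ?thesis
    unfolding T_opnorm_eq_potential_norm[OF Q(1-3)] Loc_const_eq_testing_const[OF Q(1,2,3)]
      Loc_const_eq_testing_const[OF Q(1,2,4)] conj_exp_conj_exp[OF p(1)] conj_exp_conj_exp[OF q]
    by (rule comparableI[OF _ equiv(2)])
      (use equiv(1) local_factor_nonneg[of p q] in \<open>simp_all only: local_factor_def\<close>)
qed

lemma global_testing_theorem:
  assumes p: "1 < p" "p < q"
    and Q: "dyadic_grid \<Q>" "\<forall>Q\<in>\<Q>. 0 \<le> \<tau> Q" "weight \<sigma>" "weight \<omega>"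
  shows "comparable
    (local_factor p q * (global_to_local_factor (conj_exp q) (conj_exp p) + global_to_local_factor p q) + 2)
    (T_opnorm \<Q> \<tau> \<sigma> \<omega> p q)
    (Glo_const \<Q> \<tau> \<sigma> \<omega> p q + Glo_const \<Q> \<tau> \<omega> \<sigma> (conj_exp q) (conj_exp p))"
proof -
  interpret dyadic_pair \<Q> "cube_coeff \<tau>" "weight_measure \<sigma>" "weight_measure \<omega>"
    by (rule dyadic_pair_weights[OF Q])
  have q: "1 < q" using p by simp
  have "1 < conj_exp q" "conj_exp q < conj_exp p"
    using conj_exp_gt_1[OF q] conj_exp_antimono[OF p] by auto
  hence "0 \<le> local_factor p q * (global_to_local_factor (conj_exp q) (conj_exp p) + global_to_local_factor p q)"
    using p local_factor_nonneg by (intro mult_nonneg_nonneg add_nonneg_nonneg) (auto intro: less_imp_le global_to_local_factor_pos)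
  moreover note equiv = potential_norm_equiv_global_testing[OF p conj_exp_conjugate[OF p(1)] conj_exp_conjugate[OF q]]
  ultimately show ?thesis
    unfolding T_opnorm_eq_potential_norm[OF Q(1-3)] Glo_const_eq_testing_const[OF Q(1,2,3)]
      Glo_const_eq_testing_const[OF Q(1,2,4)] conj_exp_conj_exp[OF p(1)] conj_exp_conj_exp[OF q]
    by (intro comparableI[OF _ equiv(2)]) (simp_all only: local_factor_def)
qed

theorem theorem1p11:
  fixes p q :: real
  shows
    "(1 < p \<and> p \<le> q \<longrightarrow>
       (\<exists>K>0. \<forall>(\<Q> :: (real ^ 'd) set set) \<tau> \<sigma> \<omega>.
          dyadic_grid \<Q> \<and> (\<forall>Q\<in>\<Q>. 0 \<le> \<tau> Q) \<and> weight \<sigma> \<and> weight \<omega> \<longrightarrow>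
          comparable K (T_opnorm \<Q> \<tau> \<sigma> \<omega> p q)
            (Loc_const \<Q> \<tau> \<sigma> \<omega> p q + Loc_const \<Q> \<tau> \<omega> \<sigma> (conj_exp q) (conj_exp p))))
     \<and>
     (1 < p \<and> p < q \<longrightarrow>
       (\<exists>K>0. \<forall>(\<Q> :: (real ^ 'd) set set) \<tau> \<sigma> \<omega>.
          dyadic_grid \<Q> \<and> (\<forall>Q\<in>\<Q>. 0 \<le> \<tau> Q) \<and> weight \<sigma> \<and> weight \<omega> \<longrightarrow>
          comparable K (T_opnorm \<Q> \<tau> \<sigma> \<omega> p q)
            (Glo_const \<Q> \<tau> \<sigma> \<omega> p q + Glo_const \<Q> \<tau> \<omega> \<sigma> (conj_exp q) (conj_exp p))))
     \<and>
     (\<exists>K>0. \<forall>(\<Q> :: (real ^ 'd) set set) \<tau> \<sigma> \<omega>.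
          dyadic_grid \<Q> \<and> (\<forall>Q\<in>\<Q>. 0 \<le> \<tau> Q) \<and> weight \<sigma> \<and> weight \<omega> \<longrightarrow>
          C3_const \<Q> \<tau> \<sigma> \<omega> = T_opnorm \<Q> \<tau> \<sigma> \<omega> 2 2 \<and>
          C1_const \<Q> \<tau> \<sigma> \<omega> = Loc_const \<Q> \<tau> \<omega> \<sigma> (conj_exp 2) (conj_exp 2) \<and>
          C2_const \<Q> \<tau> \<sigma> \<omega> = Loc_const \<Q> \<tau> \<sigma> \<omega> 2 2 \<and>
          comparable K (C3_const \<Q> \<tau> \<sigma> \<omega>) (C1_const \<Q> \<tau> \<sigma> \<omega> + C2_const \<Q> \<tau> \<sigma> \<omega>))"
proof (intro conjI impI)
  assume pq: "1 < p \<and> p \<le> q"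
  show "\<exists>K>0. \<forall>(\<Q> :: (real ^ 'd) set set) \<tau> \<sigma> \<omega>.
      dyadic_grid \<Q> \<and> (\<forall>Q\<in>\<Q>. 0 \<le> \<tau> Q) \<and> weight \<sigma> \<and> weight \<omega> \<longrightarrow>
      comparable K (T_opnorm \<Q> \<tau> \<sigma> \<omega> p q)
        (Loc_const \<Q> \<tau> \<sigma> \<omega> p q + Loc_const \<Q> \<tau> \<omega> \<sigma> (conj_exp q) (conj_exp p))"
  proof (intro exI[of _ "local_factor p q + 2"] conjI allI impI)
    show "0 < local_factor p q + 2" using local_factor_nonneg[of p q] by simp
  qed (rule local_testing_theorem; use pq in blast)
next
  assume pq: "1 < p \<and> p < q"
  let ?K = "local_factor p q * (global_to_local_factor (conj_exp q) (conj_exp p) + global_to_local_factor p q) + 2"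
  have "1 < conj_exp q" "conj_exp q < conj_exp p"
    using pq conj_exp_gt_1[of q] conj_exp_antimono[of p q] by auto
  hence "0 \<le> local_factor p q * (global_to_local_factor (conj_exp q) (conj_exp p) + global_to_local_factor p q)"
    using pq local_factor_nonneg by (intro mult_nonneg_nonneg add_nonneg_nonneg) (auto intro: less_imp_le global_to_local_factor_pos)
  hence "0 < ?K" by simp
  show "\<exists>K>0. \<forall>(\<Q> :: (real ^ 'd) set set) \<tau> \<sigma> \<omega>.
      dyadic_grid \<Q> \<and> (\<forall>Q\<in>\<Q>. 0 \<le> \<tau> Q) \<and> weight \<sigma> \<and> weight \<omega> \<longrightarrow>
      comparable K (T_opnorm \<Q> \<tau> \<sigma> \<omega> p q)
        (Glo_const \<Q> \<tau> \<sigma> \<omega> p q + Glo_const \<Q> \<tau> \<omega> \<sigma> (conj_exp q) (conj_exp p))"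
  proof (intro exI[of _ ?K] conjI allI impI)
    show "0 < ?K" by fact
  qed (rule global_testing_theorem; use pq in blast)
next
  have two: "conj_exp 2 = 2" by (simp add: conj_exp_def)
  show "\<exists>K>0. \<forall>(\<Q> :: (real ^ 'd) set set) \<tau> \<sigma> \<omega>.
          dyadic_grid \<Q> \<and> (\<forall>Q\<in>\<Q>. 0 \<le> \<tau> Q) \<and> weight \<sigma> \<and> weight \<omega> \<longrightarrow>
          C3_const \<Q> \<tau> \<sigma> \<omega> = T_opnorm \<Q> \<tau> \<sigma> \<omega> 2 2 \<and>
          C1_const \<Q> \<tau> \<sigma> \<omega> = Loc_const \<Q> \<tau> \<omega> \<sigma> (conj_exp 2) (conj_exp 2) \<and>
          C2_const \<Q> \<tau> \<sigma> \<omega> = Loc_const \<Q> \<tau> \<sigma> \<omega> 2 2 \<and>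
          comparable K (C3_const \<Q> \<tau> \<sigma> \<omega>) (C1_const \<Q> \<tau> \<sigma> \<omega> + C2_const \<Q> \<tau> \<sigma> \<omega>)"
  proof (intro exI[of _ "local_factor 2 2 + 2"] conjI allI impI; (elim conjE)?)
    show "0 < local_factor 2 2 + 2" using local_factor_nonneg[of 2 2] by simp
    fix \<Q> :: "(real ^ 'd) set set" and \<tau> :: "(real ^ 'd) set \<Rightarrow> real"
      and \<sigma> \<omega> :: "real ^ 'd \<Rightarrow> real"
    assume Q: "dyadic_grid \<Q>" "\<forall>Q\<in>\<Q>. 0 \<le> \<tau> Q" and w: "weight \<sigma>" "weight \<omega>"
    interpret dyadic_pair \<Q> "cube_coeff \<tau>" "weight_measure \<sigma>" "weight_measure \<omega>"
      by (rule dyadic_pair_weights[OF Q w])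
    show C3: "C3_const \<Q> \<tau> \<sigma> \<omega> = T_opnorm \<Q> \<tau> \<sigma> \<omega> 2 2"
      using C3_const_eq_form_norm[OF Q w] T_opnorm_eq_potential_norm[OF Q w(1)]
        potential_norm_eq_form_norm[of 2 2 2] by simp
    show C1: "C1_const \<Q> \<tau> \<sigma> \<omega> = Loc_const \<Q> \<tau> \<omega> \<sigma> (conj_exp 2) (conj_exp 2)"
      using C1_const_eq_testing_const[OF Q w] Loc_const_eq_testing_const[OF Q w(1)] by (simp add: two)
    show C2: "C2_const \<Q> \<tau> \<sigma> \<omega> = Loc_const \<Q> \<tau> \<sigma> \<omega> 2 2"
      unfolding C2_const_eq_C1_const
      using C1_const_eq_testing_const[OF Q w(2,1)] Loc_const_eq_testing_const[OF Q w(2)] by (simp add: two)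
    show "comparable (local_factor 2 2 + 2) (C3_const \<Q> \<tau> \<sigma> \<omega>) (C1_const \<Q> \<tau> \<sigma> \<omega> + C2_const \<Q> \<tau> \<sigma> \<omega>)"
      unfolding C1 C2 C3 using local_testing_theorem[OF _ _ Q w, of 2 2] by (simp add: add.commute)
  qed
qed

end
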